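(* Let $\Phi=\{\phi_i\}_{i\in\mathcal{D}}$ be a conformal iterated function system satisfying the open set condition, with attractor $X\subset\mathbb{R}^d$, and let $z\in X$. Suppose $\theta:\mathbb{N}\to\mathbb{R}_{\geq 0}$ is a function satisfying $$\sum_{n=1}^{\infty}\sum_{I\in\mathcal{D}^{n}}(Diam(X_I)\theta(n))^{\dim_{H}(X)}=\infty$$ and, as $Q\to\infty$, $$\sum_{n=1}^{Q}\theta(n)^{\dim_{H}(X)}\log\frac{1}{\theta(n)}=\mathcal{O}\Big(\Big(\sum_{n=1}^{Q}\theta(n)^{\dim_{H}(X)}\Big)^2\Big).$$ Then $\mathcal{H}^{\dim_{H}(X)}$-almost every $x\in X$ is an element of $W(\theta,z)$.
   Context: An iterated function system (IFS) is a finite set of contractions $\Phi=\{\phi_i\}_{i\in\mathcal{D}}$ of a closed set $Y\subset\mathbb{R}^d$ into itself; its attractor is the unique non-empty compact set $X$ with $X=\bigcup_{i\in\mathcal{D}}\phi_i(X)$. Write $\mathcal{D}^n$ for words of length $n$ over $\mathcal{D}$, $\mathcal{D}^*=\bigcup_{n\ge1}\mathcal{D}^n$; for $I=(i_1,\dots,i_n)$, $|I|=n$, $\phi_I=\phi_{i_1}\circ\cdots\circ\phi_{i_n}$, $X_I=\phi_I(X)$. $\dim_H$ and $\mathcal{H}^s$ denote Hausdorff dimension and $s$-dimensional Hausdorff measure, $Diam$ denotes diameter, $B(x,r)$ is the closed Euclidean ball of centre $x$ and radius $r$. Conformal IFS: an IFS $\Phi$ on a compact set $Y\subset\mathbb{R}^d$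 such that each $\phi_i$ extends to an injective conformal contraction on some open connected neighbourhood $V$ of $Y$ (conformal: $C^1$ with $|\phi_i'(x)y|=|\phi_i'(x)||y|$ for all $x\in V$, $y\in\mathbb{R}^d$), with $0<\inf_{x\in V}|\phi_i'(x)|\le\sup_{x\in V}|\phi_i'(x)|<1$, and such that for some $\alpha,c>0$, $||\phi_i'(x)|-|\phi_i'(y)||\le c|x-y|^\alpha$ for all $x,y\in V$, $i\in\mathcal{D}$. Open set condition: there is a non-empty open set $O\subset\mathbb{R}^d$ (in the domain of the maps) with $\phi_i(O)\subset O$ for all $i\in\mathcal{D}$ and $\phi_i(O)\cap\phi_j(O)=\emptyset$ for all $i\ne j$. For $z\in X$ and $\theta:\mathbb{N}\to\mathbb{R}_{\ge0}$, $$W(\theta,z):=\{x\in X: x\in B(\phi_I(z),Diam(X_I)\theta(|I|))\text{ for infinitely many } I\in\mathcal{D}^*\}.$$ Convention: $\theta(n)^{\dim_H(X)}\log(1/\theta(n))$ is taken to be $0$ when $\theta(n)=0$. *)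

theory Defs
  imports "HOL-Analysis.Analysis" "HOL-Library.Landau_Symbols"
begin

section \<open>Hausdorff measure and dimension\<close>

(* Real power with the convention 0^0 = 1 (the library has 0 powr 0 = 0).  For s > 0 it is
   powr; the convention matters for the zero-dimensional measure (counting measure). *)
definition rpow :: "real \<Rightarrow> real \<Rightarrow> real" where
  "rpow x s = (if s = 0 then 1 else x powr s)"

(* The library diameter is meaningful only for bounded sets, hence the boundedness condition. *)
definition delta_cover :: "real \<Rightarrow> 'a::euclidean_space set \<Rightarrow> (nat \<Rightarrow> 'a set) \<Rightarrow> bool" where
  "delta_cover \<delta> A U \<longleftrightarrow> A \<subseteq> (\<Union>k. U k) \<and> (\<forall>k. bounded (U k) \<and> diameter (U k) \<le> \<delta>)"

(* Empty members of a cover contribute 0, also when s = 0; so finite covers are included. *)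
definition hausdorff_premeasure :: "real \<Rightarrow> real \<Rightarrow> 'a::euclidean_space set \<Rightarrow> ennreal" where
  "hausdorff_premeasure s \<delta> A =
     (INF U\<in>{U. delta_cover \<delta> A U}. \<Sum>k. if U k = {} then 0 else ennreal (rpow (diameter (U k)) s))"

(* Hausdorff (outer) measure, defined on all subsets. *)
definition hausdorff_measure :: "real \<Rightarrow> 'a::euclidean_space set \<Rightarrow> ennreal" where
  "hausdorff_measure s A = (SUP \<delta>\<in>{0<..}. hausdorff_premeasure s \<delta> A)"

(* In a Euclidean space of dimension d the set below contains every s > d, so the real
   infimum is a genuine one. *)
definition hausdorff_dim :: "'a::euclidean_space set \<Rightarrow> real" where
  "hausdorff_dim A = Inf {s. 0 \<le> s \<and> hausdorff_measure s A = 0}"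

section \<open>Conformal iterated function systems\<close>

definition contraction_on :: "'a::euclidean_space set \<Rightarrow> ('a \<Rightarrow> 'a) \<Rightarrow> bool" where
  "contraction_on S f \<longleftrightarrow> (\<exists>r<1. r-lipschitz_on S f)"

definition ifs :: "'a::euclidean_space set \<Rightarrow> 'i set \<Rightarrow> ('i \<Rightarrow> 'a \<Rightarrow> 'a) \<Rightarrow> bool" where
  "ifs Y D \<phi> \<longleftrightarrow> closed Y \<and> finite D \<and> (\<forall>i\<in>D. \<phi> i ` Y \<subseteq> Y \<and> contraction_on Y (\<phi> i))"

(* Among subsets of Y such an X is unique. *)
definition attractor ::
  "'a::euclidean_space set \<Rightarrow> 'i set \<Rightarrow> ('i \<Rightarrow> 'a \<Rightarrow> 'a) \<Rightarrow> 'a set \<Rightarrow> bool" where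
  "attractor Y D \<phi> X \<longleftrightarrow> X \<noteq> {} \<and> compact X \<and> X \<subseteq> Y \<and> X = (\<Union>i\<in>D. \<phi> i ` X)"

(* Operator norm of the derivative. *)
definition deriv_norm :: "('a::euclidean_space \<Rightarrow> 'a) \<Rightarrow> 'a \<Rightarrow> real" where
  "deriv_norm f x = onorm (frechet_derivative f (at x))"

definition C1_on :: "'a::euclidean_space set \<Rightarrow> ('a \<Rightarrow> 'a) \<Rightarrow> bool" where
  "C1_on V f \<longleftrightarrow> (\<exists>f' :: 'a \<Rightarrow> 'a \<Rightarrow>\<^sub>L 'a. continuous_on V f' \<and>
      (\<forall>x\<in>V. (f has_derivative blinfun_apply (f' x)) (at x)))"

definition conformal_on :: "'a::euclidean_space set \<Rightarrow> ('a \<Rightarrow> 'a) \<Rightarrow> bool" where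
  "conformal_on V f \<longleftrightarrow> C1_on V f \<and>
     (\<forall>x\<in>V. \<forall>y. norm (frechet_derivative f (at x) y) = deriv_norm f x * norm y)"

(* The functions phi i are total; on the neighbourhood V of Y they are the conformal
   extensions of the maps of the system, outside V their values are irrelevant.
   The bounds a and b express 0 < inf and sup < 1 of the derivative norm over V. *)
definition conformal_ifs ::
  "'a::euclidean_space set \<Rightarrow> 'a set \<Rightarrow> 'i set \<Rightarrow> ('i \<Rightarrow> 'a \<Rightarrow> 'a) \<Rightarrow> bool" where
  "conformal_ifs Y V D \<phi> \<longleftrightarrow>
     compact Y \<and> ifs Y D \<phi> \<and> open V \<and> connected V \<and> Y \<subseteq> V \<and>
     (\<forall>i\<in>D. inj_on (\<phi> i) V \<and> conformal_on V (\<phi> i) \<and> contraction_on V (\<phi> i) \<and>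
        (\<exists>a b. 0 < a \<and> b < 1 \<and> (\<forall>x\<in>V. a \<le> deriv_norm (\<phi> i) x \<and> deriv_norm (\<phi> i) x \<le> b))) \<and>
     (\<exists>\<alpha> c. 0 < \<alpha> \<and> 0 < c \<and> (\<forall>i\<in>D. \<forall>x\<in>V. \<forall>y\<in>V.
        \<bar>deriv_norm (\<phi> i) x - deriv_norm (\<phi> i) y\<bar> \<le> c * norm (x - y) powr \<alpha>))"

definition open_set_condition ::
  "'a::euclidean_space set \<Rightarrow> 'i set \<Rightarrow> ('i \<Rightarrow> 'a \<Rightarrow> 'a) \<Rightarrow> bool" where
  "open_set_condition V D \<phi> \<longleftrightarrow> (\<exists>U. open U \<and> U \<noteq> {} \<and> U \<subseteq> V \<and>
     (\<forall>i\<in>D. \<phi> i ` U \<subseteq> U) \<and>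
     (\<forall>i\<in>D. \<forall>j\<in>D. i \<noteq> j \<longrightarrow> \<phi> i ` U \<inter> \<phi> j ` U = {}))"

section \<open>Words and limsup sets\<close>

definition words :: "'i set \<Rightarrow> nat \<Rightarrow> 'i list set" where
  "words D n = {I. set I \<subseteq> D \<and> length I = n}"

definition word_map :: "('i \<Rightarrow> 'a \<Rightarrow> 'a) \<Rightarrow> 'i list \<Rightarrow> 'a \<Rightarrow> 'a" where
  "word_map \<phi> I = foldr (\<lambda>i f. \<phi> i \<circ> f) I id"

definition W_set ::
  "'i set \<Rightarrow> ('i \<Rightarrow> 'a \<Rightarrow> 'a) \<Rightarrow> 'a::euclidean_space set \<Rightarrow> (nat \<Rightarrow> real) \<Rightarrow> 'a \<Rightarrow> 'a set" where
  "W_set D \<phi> X \<theta> z =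
     {x \<in> X. infinite {I \<in> (\<Union>n\<in>{1..}. words D n).
        x \<in> cball (word_map \<phi> I z) (diameter (word_map \<phi> I ` X) * \<theta> (length I))}}"

end

theory Submission
  imports Defs "HOL-Library.Sublist"
begin

text \<open>
  The problem is transferred to the space of words, where it is a shrinking target problem for a
  measure with product-like structure.

  Suppose that there are at least two maps, and write \<open>scale I\<close> for the norm of the derivative of the composed map of the word \<open>I\<close>.  By bounded
  distortion (\<open>bounded_distortion\<close>) the scales are multiplicative up to a constant, and the diameter
  of the cylinder of \<open>I\<close> is comparable with \<open>scale I\<close>.  Hence there is an exponent \<open>s\<close> for which
  the sums of \<open>scale I powr s\<close> over the levels stay bounded above and below (\<open>critical_exponent\<close>), and
  there are weights \<open>m I\<close> comparable with \<open>scale I powr s\<close> that are additive over the extensions of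
  a word (\<open>additive_weights\<close>).  The open set condition bounds the number of cylinders of size about
  \<open>r\<close> near a point, and the mass distribution principle then shows that the Hausdorff measure of
  \<open>X\<close> with exponent \<open>s\<close> is positive and finite, so \<open>s\<close> is the dimension (\<open>hausdorff_dim_X\<close>).

  Let \<open>P n\<close> be a word of scale about \<open>\<theta> n\<close> whose cylinder contains \<open>z\<close>.  For a word \<open>J\<close> of length
  \<open>n\<close>, the cylinder of \<open>J @ P n\<close> lies in the ball of \<open>J\<close>.  So it is enough to find the target \<open>P n\<close> at
  the position \<open>n\<close> of a word, for arbitrarily large \<open>n\<close>.  These occurrences have mass about
  \<open>\<theta> n powr s\<close>, whose sum diverges.  Occurrences at positions that differ by at least the length of
  the earlier target are quasi-independent.  The others contribute at most the sum of
  \<open>length (P n) * m (P n)\<close>, that is about \<open>\<theta> n powr s * ln (1 / \<theta> n)\<close>, and this is what the growth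
  hypothesis controls.  By the second moment method (\<open>mass_some_hit_ge\<close>) the occurrences beyond any
  level fill at least a proportion \<open>\<rho>\<close> of every cylinder, with \<open>\<rho>\<close> independent of the cylinder and of
  the level.

  A set that misses such a proportion of every cylinder is null: the measure of its part in a cylinder
  drops by the factor \<open>1 - \<rho>\<close> each time the argument is applied to the subcylinders that it still meets
  (\<open>hausdorff_measure_zero_if_misses_proportion\<close>).  This takes the place of a density theorem, and
  the finitely additive weights take the place of a measure on \<open>X\<close>.

  Two cases are immediate and treated apart: a single map, whose attractor is a point, and functions
  \<open>\<theta>\<close> with values at least \<open>1\<close> infinitely often, for which the balls contain whole cylinders.
\<close>

section \<open>Hausdorff measure and dimension\<close>

lemma rpow_nonneg: "0 \<le> x \<Longrightarrow> 0 \<le> rpow x s"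
  by (simp add: rpow_def)

lemma hausdorff_premeasure_le_cover:
  assumes "delta_cover \<delta> A U"
  shows "hausdorff_premeasure s \<delta> A \<le> (\<Sum>k. if U k = {} then 0 else ennreal (rpow (diameter (U k)) s))"
  unfolding hausdorff_premeasure_def using assms by (intro INF_lower) auto

lemma hausdorff_premeasure_le_measure:
  "\<delta> > 0 \<Longrightarrow> hausdorff_premeasure s \<delta> A \<le> hausdorff_measure s A"
  unfolding hausdorff_measure_def by (intro SUP_upper) auto

lemma hausdorff_measure_mono:
  assumes "A \<subseteq> B"
  shows "hausdorff_measure s A \<le> hausdorff_measure s B"
  unfolding hausdorff_measure_def hausdorff_premeasure_def
proof (intro SUP_mono' INF_superset_mono)
  show "{U. delta_cover \<delta> B U} \<subseteq> {U. delta_cover \<delta> A U}" for \<delta>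
    using assms unfolding delta_cover_def by blast
qed simp

lemma hausdorff_measure_UN_le:
  fixes A :: "nat \<Rightarrow> 'a::euclidean_space set"
  shows "hausdorff_measure s (\<Union>n. A n) \<le> (\<Sum>n. hausdorff_measure s (A n))"
  unfolding hausdorff_measure_def[of s "\<Union>n. A n"]
proof (rule SUP_least)
  fix \<delta> :: real assume "\<delta> \<in> {0<..}"
  then have \<delta>: "\<delta> > 0" by simp
  let ?cost = "\<lambda>S :: 'a set. if S = {} then 0 else ennreal (rpow (diameter S) s)"
  show "hausdorff_premeasure s \<delta> (\<Union>n. A n) \<le> (\<Sum>n. hausdorff_measure s (A n))"
  proof (rule ennreal_le_epsilon)
    fix e :: real assume fin: "(\<Sum>n. hausdorff_measure s (A n)) < top" and e: "0 < e"
    define \<eta> where "\<eta> n = e * (1/2) ^ Suc n" for n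
    have \<eta>: "\<eta> n > 0" for n using e by (simp add: \<eta>_def)
    have "\<exists>U. delta_cover \<delta> (A n) U \<and> (\<Sum>k. ?cost (U k)) \<le> hausdorff_measure s (A n) + ennreal (\<eta> n)" for n
    proof -
      have le: "hausdorff_premeasure s \<delta> (A n) \<le> hausdorff_measure s (A n)"
        using \<delta> by (rule hausdorff_premeasure_le_measure)
      moreover have "hausdorff_measure s (A n) < top"
        using fin ennreal_suminf_lessD by blast
      ultimately have "hausdorff_premeasure s \<delta> (A n) < hausdorff_premeasure s \<delta> (A n) + ennreal (\<eta> n)"
        using \<eta>[of n] by (cases "hausdorff_premeasure s \<delta> (A n)")
            (auto simp: ennreal_less_iff simp flip: ennreal_plus)
      then obtain U where "delta_cover \<delta> (A n) U"
          "(\<Sum>k. ?cost (U k)) < hausdorff_premeasure s \<delta> (A n) + ennreal (\<eta> n)"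
        unfolding hausdorff_premeasure_def INF_less_iff by auto
      then show ?thesis using le by (meson add_right_mono less_imp_le order_trans)
    qed
    then obtain U where U: "\<And>n. delta_cover \<delta> (A n) (U n)"
      "\<And>n. (\<Sum>k. ?cost (U n k)) \<le> hausdorff_measure s (A n) + ennreal (\<eta> n)" by metis
    define W where "W k = (case prod_decode k of (n, j) \<Rightarrow> U n j)" for k
    have cov: "delta_cover \<delta> (\<Union>n. A n) W"
      unfolding delta_cover_def
    proof (intro conjI allI subsetI)
      fix x assume "x \<in> (\<Union>n. A n)"
      then obtain n j where "x \<in> U n j" using U(1) unfolding delta_cover_def by blast
      then have "x \<in> W (prod_encode (n, j))" by (simp add: W_def)
      then show "x \<in> (\<Union>k. W k)" by blast
    qed (use U(1) in \<open>auto simp: W_def delta_cover_def split: prod.split\<close>)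
    have "hausdorff_premeasure s \<delta> (\<Union>n. A n) \<le> (\<Sum>k. ?cost (W k))"
      by (rule hausdorff_premeasure_le_cover[OF cov])
    also have "\<dots> = (\<Sum>k. (\<lambda>p. ?cost (U (fst p) (snd p))) (prod_decode k))"
      unfolding W_def case_prod_unfold by simp
    also have "\<dots> = (\<Sum>n j. ?cost (U n j))"
      using suminf_ennreal_2dimen[OF refl, of "\<lambda>p. ?cost (U (fst p) (snd p))"]
      unfolding comp_def fst_conv snd_conv .
    also have "\<dots> \<le> (\<Sum>n. hausdorff_measure s (A n) + ennreal (\<eta> n))"
      by (intro suminf_le U summableI)
    also have "\<dots> = (\<Sum>n. hausdorff_measure s (A n)) + (\<Sum>n. ennreal (\<eta> n))"
      by (rule suminf_add[symmetric]) auto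
    also have "(\<Sum>n. ennreal (\<eta> n)) = ennreal e"
    proof (rule suminf_ennreal_eq)
      show "\<eta> sums e" using sums_mult[OF power_half_series, of e] by (simp add: \<eta>_def[abs_def])
    qed (use \<eta> less_imp_le in blast)
    finally show "hausdorff_premeasure s \<delta> (\<Union>n. A n) \<le> (\<Sum>n. hausdorff_measure s (A n)) + ennreal e" .
  qed
qed

text \<open>The indices of a cover are the natural numbers, so a finite cover has to be padded with empty sets.\<close>

lemma hausdorff_measure_le_finite_covers:
  fixes A :: "'a::euclidean_space set"
  assumes "\<And>\<delta>. \<delta> > 0 \<Longrightarrow> \<exists>(F :: 'i set) U. finite F \<and> A \<subseteq> (\<Union>i\<in>F. U i)
      \<and> (\<forall>i\<in>F. bounded (U i) \<and> diameter (U i) \<le> \<delta>) \<and> (\<Sum>i\<in>F. rpow (diameter (U i)) s) \<le> c"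
  shows "hausdorff_measure s A \<le> ennreal c"
  unfolding hausdorff_measure_def
proof (rule SUP_least)
  fix \<delta> :: real assume "\<delta> \<in> {0<..}"
  then obtain F :: "'i set" and U where F: "finite F" "A \<subseteq> (\<Union>i\<in>F. U i)" "\<forall>i\<in>F. bounded (U i) \<and> diameter (U i) \<le> \<delta>"
      "(\<Sum>i\<in>F. rpow (diameter (U i)) s) \<le> c"
    using assms[of \<delta>] by (auto simp del: UN_simps)
  have \<delta>: "\<delta> > 0" using \<open>\<delta> \<in> {0<..}\<close> by simp
  obtain h where h: "bij_betw h {..<card F} F"
    using ex_bij_betw_nat_finite[OF F(1)] by (auto simp: atLeast0LessThan)
  define W where "W k = (if k < card F then U (h k) else {})" for k
  have hF: "k < card F \<Longrightarrow> h k \<in> F" for k using h by (auto simp: bij_betw_def)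
  have "delta_cover \<delta> A W"
    unfolding delta_cover_def
  proof (intro conjI subsetI allI)
    fix x assume "x \<in> A"
    then obtain i where i: "i \<in> F" "x \<in> U i" using F(2) by blast
    then have "i \<in> h ` {..<card F}" using h by (auto simp: bij_betw_def)
    then obtain k where "k < card F" "h k = i" by auto
    then have "x \<in> W k" using i by (simp add: W_def)
    then show "x \<in> (\<Union>k. W k)" by blast
  qed (use F(3) hF \<delta> in \<open>auto simp: W_def\<close>)
  then have "hausdorff_premeasure s \<delta> A
      \<le> (\<Sum>k. if W k = {} then 0 else ennreal (rpow (diameter (W k)) s))"
    by (rule hausdorff_premeasure_le_cover)
  also have "\<dots> = (\<Sum>k<card F. if W k = {} then 0 else ennreal (rpow (diameter (W k)) s))"
    by (rule suminf_finite) (auto simp: W_def)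
  also have "\<dots> \<le> (\<Sum>k<card F. ennreal (rpow (diameter (U (h k))) s))"
    by (intro sum_mono) (auto simp: W_def)
  also have "\<dots> = (\<Sum>i\<in>F. ennreal (rpow (diameter (U i)) s))"
    using sum.reindex_bij_betw[OF h] by fastforce
  also have "\<dots> = ennreal (\<Sum>i\<in>F. rpow (diameter (U i)) s)"
    using F(3) by (intro sum_ennreal) (auto simp: rpow_nonneg diameter_ge_0)
  also have "\<dots> \<le> ennreal c" using F(4) by (rule ennreal_leI)
  finally show "hausdorff_premeasure s \<delta> A \<le> ennreal c" .
qed

lemma hausdorff_measure_empty [simp]: "hausdorff_measure s {} = 0"
proof -
  have "hausdorff_measure s {} \<le> ennreal 0"
  proof (rule hausdorff_measure_le_finite_covers)
    fix \<delta> :: real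
    show "\<exists>(F :: nat set) U. finite F \<and> {} \<subseteq> (\<Union>i\<in>F. U i) \<and> (\<forall>i\<in>F. bounded (U i) \<and> diameter (U i) \<le> \<delta>)
        \<and> (\<Sum>i\<in>F. rpow (diameter (U i)) s) \<le> 0"
      by (rule exI[of _ "{}"]) simp
  qed
  then show ?thesis by simp
qed

lemma hausdorff_measure_singleton:
  assumes "s \<noteq> 0"
  shows "hausdorff_measure s {x :: 'a::euclidean_space} = 0"
proof -
  have "hausdorff_measure s {x} \<le> ennreal 0"
  proof (rule hausdorff_measure_le_finite_covers)
    fix \<delta> :: real assume "\<delta> > 0"
    then show "\<exists>(F :: nat set) U. finite F \<and> {x} \<subseteq> (\<Union>i\<in>F. U i) \<and> (\<forall>i\<in>F. bounded (U i) \<and> diameter (U i) \<le> \<delta>)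
        \<and> (\<Sum>i\<in>F. rpow (diameter (U i)) s) \<le> 0"
      using assms by (intro exI[of _ "{0}"] exI[of _ "\<lambda>_. {x}"]) (simp add: rpow_def)
  qed
  then show ?thesis by simp
qed

lemma hausdorff_measure_Un_le:
  fixes A B :: "'a::euclidean_space set"
  shows "hausdorff_measure s (A \<union> B) \<le> hausdorff_measure s A + hausdorff_measure s B"
proof -
  let ?F = "\<lambda>n::nat. if n = 0 then A else if n = 1 then B else {}"
  have "A \<union> B = (\<Union>n. ?F n)" by (auto split: if_splits)
  then have "hausdorff_measure s (A \<union> B) \<le> (\<Sum>n. hausdorff_measure s (?F n))"
    using hausdorff_measure_UN_le[of s ?F] by simp
  also have "\<dots> = (\<Sum>n\<in>{0,1}. hausdorff_measure s (?F n))"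
    by (rule suminf_finite) auto
  finally show ?thesis by simp
qed

lemma hausdorff_measure_finite_UN_le:
  fixes A :: "'i \<Rightarrow> 'a::euclidean_space set"
  assumes "finite F"
  shows "hausdorff_measure s (\<Union>i\<in>F. A i) \<le> (\<Sum>i\<in>F. hausdorff_measure s (A i))"
  using assms
proof (induction F rule: finite_induct)
  case (insert i F)
  have "hausdorff_measure s (\<Union>j\<in>insert i F. A j)
      \<le> hausdorff_measure s (A i) + hausdorff_measure s (\<Union>j\<in>F. A j)"
    using hausdorff_measure_Un_le[of s "A i" "\<Union>j\<in>F. A j"] by simp
  also have "\<dots> \<le> hausdorff_measure s (A i) + (\<Sum>j\<in>F. hausdorff_measure s (A j))"
    using insert.IH by (rule add_left_mono)
  finally show ?case using insert.hyps by simp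
qed simp

text \<open>The factor \<open>d powr (t - s)\<close> by which the cost of a set of diameter \<open>d\<close> changes is
  arbitrarily small for fine covers.\<close>

lemma hausdorff_measure_larger_exponent:
  fixes A :: "'a::euclidean_space set"
  assumes s: "0 \<le> s" "s < t" and fin: "hausdorff_measure s A < top"
  shows "hausdorff_measure t A = 0"
proof -
  obtain B where B: "hausdorff_measure s A = ennreal B" "B \<ge> 0"
    using fin by (cases "hausdorff_measure s A") auto
  have "hausdorff_premeasure t \<delta> A \<le> ennreal (e * (B + 1))"
    if \<delta>: "\<delta> > 0" and e: "e > 0" for \<delta> e
  proof -
    define \<delta>' where "\<delta>' = min \<delta> (e powr (1 / (t - s)))"
    have \<delta>': "\<delta>' > 0" "\<delta>' \<le> \<delta>" using \<delta> e by (auto simp: \<delta>'_def)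
    have small: "rpow d t \<le> e * rpow d s" if d: "0 \<le> d" "d \<le> \<delta>'" for d
    proof (cases "d = 0")
      case True then show ?thesis using s e by (simp add: rpow_def)
    next
      case False
      have "d powr (t - s) \<le> (e powr (1 / (t - s))) powr (t - s)"
        using d s \<delta>' by (intro powr_mono2) (auto simp: \<delta>'_def)
      also have "\<dots> = e" using s e by (simp add: powr_powr)
      finally have "d powr (t - s) * d powr s \<le> e * d powr s" by (intro mult_right_mono) auto
      moreover have "d powr (t - s) * d powr s = d powr t" by (simp flip: powr_add)
      ultimately show ?thesis using s d False by (auto simp: rpow_def)
    qed
    have "hausdorff_premeasure s \<delta>' A < ennreal (B + 1)"
      using hausdorff_premeasure_le_measure[OF \<delta>'(1), of s A] B
      by (auto simp: ennreal_less_iff intro: le_less_trans)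
    then obtain U where U: "delta_cover \<delta>' A U"
        "(\<Sum>k. if U k = {} then 0 else ennreal (rpow (diameter (U k)) s)) < ennreal (B + 1)"
      unfolding hausdorff_premeasure_def INF_less_iff by auto
    have "delta_cover \<delta> A U" using U(1) \<delta>' unfolding delta_cover_def by (meson order_trans)
    then have "hausdorff_premeasure t \<delta> A
        \<le> (\<Sum>k. if U k = {} then 0 else ennreal (rpow (diameter (U k)) t))"
      by (rule hausdorff_premeasure_le_cover)
    also have "\<dots> \<le> (\<Sum>k. ennreal e * (if U k = {} then 0 else ennreal (rpow (diameter (U k)) s)))"
    proof (intro suminf_le summableI)
      fix k
      have "bounded (U k)" "diameter (U k) \<le> \<delta>'" using U(1) by (auto simp: delta_cover_def)
      then have "ennreal (rpow (diameter (U k)) t) \<le> ennreal (e * rpow (diameter (U k)) s)"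
        by (intro ennreal_leI small diameter_ge_0)
      then show "(if U k = {} then 0 else ennreal (rpow (diameter (U k)) t))
        \<le> ennreal e * (if U k = {} then 0 else ennreal (rpow (diameter (U k)) s))"
        using e by (simp add: ennreal_mult')
    qed
    also have "\<dots> = ennreal e * (\<Sum>k. if U k = {} then 0 else ennreal (rpow (diameter (U k)) s))"
      by (rule ennreal_suminf_cmult)
    also have "\<dots> \<le> ennreal e * ennreal (B + 1)" using U(2) by (intro mult_left_mono) auto
    finally show ?thesis using e B by (simp add: ennreal_mult')
  qed
  note ** = this
  have *: "hausdorff_measure t A \<le> ennreal (e * (B + 1))" if "e > 0" for e
    unfolding hausdorff_measure_def[of t A] by (rule SUP_least) (use that ** in simp)
  have "hausdorff_measure t A \<le> 0 + ennreal e" if "e > 0" for e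
  proof -
    have "e / (B + 1) > 0" using that B by simp
    moreover have "e / (B + 1) * (B + 1) = e" using B by simp
    ultimately show ?thesis using *[of "e / (B + 1)"] by simp
  qed
  then have "hausdorff_measure t A \<le> 0" by (rule ennreal_le_epsilon)
  then show ?thesis by simp
qed

lemma hausdorff_dim_eqI:
  assumes s: "0 \<le> s" and fin: "hausdorff_measure s A < top" and pos: "hausdorff_measure s A \<noteq> 0"
  shows "hausdorff_dim A = s"
  unfolding hausdorff_dim_def
proof (rule cInf_eq_non_empty)
  show "{t. 0 \<le> t \<and> hausdorff_measure t A = 0} \<noteq> {}"
  proof -
    have "s + 1 \<in> {t. 0 \<le> t \<and> hausdorff_measure t A = 0}"
      using hausdorff_measure_larger_exponent[OF s _ fin, of "s + 1"] s by simp
    then show ?thesis by blast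
  qed
next
  fix t assume "t \<in> {t. 0 \<le> t \<and> hausdorff_measure t A = 0}"
  then have t: "0 \<le> t" "hausdorff_measure t A = 0" by auto
  show "s \<le> t"
  proof (rule ccontr)
    assume "\<not> s \<le> t"
    then have "hausdorff_measure s A = 0"
      using t by (intro hausdorff_measure_larger_exponent[of t s A]) auto
    with pos show False by simp
  qed
next
  fix y assume y: "\<And>t. t \<in> {t. 0 \<le> t \<and> hausdorff_measure t A = 0} \<Longrightarrow> y \<le> t"
  show "y \<le> s"
  proof (rule dense_ge)
    fix t assume "s < t"
    then have "hausdorff_measure t A = 0" by (rule hausdorff_measure_larger_exponent[OF s _ fin])
    then show "y \<le> t" using y[of t] s \<open>s < t\<close> by simp
  qed
qed

section \<open>Geometry of the cylinder sets\<close>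

lemma word_map_Nil [simp]: "word_map \<phi> [] x = x"
  by (simp add: word_map_def)

lemma word_map_Cons [simp]: "word_map \<phi> (i # I) x = \<phi> i (word_map \<phi> I x)"
  by (simp add: word_map_def)

lemma word_map_append: "word_map \<phi> (I @ J) x = word_map \<phi> I (word_map \<phi> J x)"
  by (induction I) auto

primrec word_deriv :: "('i \<Rightarrow> 'a::euclidean_space \<Rightarrow> 'a) \<Rightarrow> 'i list \<Rightarrow> 'a \<Rightarrow> real" where
  "word_deriv \<phi> [] x = 1"
| "word_deriv \<phi> (i # I) x = deriv_norm (\<phi> i) (word_map \<phi> I x) * word_deriv \<phi> I x"

lemma word_deriv_append:
  "word_deriv \<phi> (I @ J) x = word_deriv \<phi> I (word_map \<phi> J x) * word_deriv \<phi> J x"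
  by (induction I) (auto simp: word_map_append)

text \<open>To hit a target \<open>y\<close> near \<open>f x\<close>, minimise \<open>|f w - y| + k |w - x|\<close> over the closed ball for
  a \<open>k\<close> slightly below \<open>l\<close>.  The minimiser is interior, and if it missed \<open>y\<close>, then moving it in
  the direction that \<open>f'\<close> sends to \<open>y - f w\<close> would gain more in the first summand than it
  loses in the second.\<close>

lemma ball_subset_image_cball_if_derivative_expands:
  fixes f :: "'a::euclidean_space \<Rightarrow> 'a"
  assumes \<rho>: "0 < \<rho>" and l: "0 < l"
    and der: "\<And>w. w \<in> cball x \<rho> \<Longrightarrow>
      \<exists>f' L. (f has_derivative f') (at w) \<and> l \<le> L \<and> (\<forall>v. norm (f' v) = L * norm v)"
  shows "ball (f x) (l * \<rho>) \<subseteq> f ` cball x \<rho>"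
proof
  fix y assume "y \<in> ball (f x) (l * \<rho>)"
  then have y: "dist (f x) y < l * \<rho>" by simp
  define k where "k = (dist (f x) y / \<rho> + l) / 2"
  have q: "dist (f x) y / \<rho> < l" using y \<rho> by (simp add: field_simps)
  have k: "k < l" "0 < k" "dist (f x) y < k * \<rho>"
  proof -
    show "k < l" using q by (simp add: k_def)
    have "0 \<le> dist (f x) y / \<rho>" using \<rho> by simp
    then have "0 < dist (f x) y / \<rho> + l" using l by linarith
    then show "0 < k" by (simp add: k_def)
    have "2 * k = dist (f x) y / \<rho> + l" by (simp add: k_def)
    then have "dist (f x) y / \<rho> < k" using q by linarith
    then show "dist (f x) y < k * \<rho>" using \<rho> by (simp add: field_simps)
  qed
  define g where "g w = dist (f w) y + k * dist w x" for w
  have "continuous_on (cball x \<rho>) f"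
  proof (intro continuous_at_imp_continuous_on ballI)
    fix w assume "w \<in> cball x \<rho>"
    then show "isCont f w" using der has_derivative_continuous by blast
  qed
  then have "continuous_on (cball x \<rho>) g"
    unfolding g_def by (intro continuous_intros)
  then obtain w where w: "w \<in> cball x \<rho>" and min: "\<And>v. v \<in> cball x \<rho> \<Longrightarrow> g w \<le> g v"
    using continuous_attains_inf[of "cball x \<rho>" g] \<rho> by auto
  have "k * dist w x \<le> g w" by (simp add: g_def)
  also have "g w \<le> g x" using min[of x] \<rho> by simp
  also have "g x < k * \<rho>" using k by (simp add: g_def)
  finally have interior: "dist w x < \<rho>" using k by simp
  obtain f' L where f': "(f has_derivative f') (at w)" and L: "l \<le> L" "\<And>v. norm (f' v) = L * norm v"
    using der[OF w] by blast
  have lin: "linear f'" using f' has_derivative_linear by blast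
  have "inj f'"
  proof (rule linear_injective_0[THEN iffD2, OF lin], intro allI impI)
    fix v assume "f' v = 0"
    then show "v = 0" using L(2)[of v] L(1) l by simp
  qed
  then have "surj f'" using lin linear_injective_imp_surjective by blast
  then obtain v where v: "f' v = y - f w" by (metis surjD)
  have "f w = y"
  proof (rule ccontr)
    assume ne: "f w \<noteq> y"
    define R where "R = norm (f w - y)"
    have R: "R > 0" using ne by (simp add: R_def)
    have LR: "L * norm v = R" using L(2)[of v] v by (simp add: R_def norm_minus_commute)
    have v0: "v \<noteq> 0" using R LR by auto
    define \<eta> where "\<eta> = R - k * norm v"
    have "k * norm v < L * norm v" using v0 k L by (intro mult_strict_right_mono) auto
    then have \<eta>: "\<eta> > 0" using LR by (simp add: \<eta>_def)
    define e where "e = \<eta> / (2 * norm v)"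
    have "e > 0" using \<eta> v0 by (simp add: e_def)
    then obtain d where d: "d > 0"
      "\<And>u. norm (u - w) < d \<Longrightarrow> norm (f u - f w - f' (u - w)) \<le> e * norm (u - w)"
      using f' unfolding has_derivative_at_alt by blast
    define t where "t = min 1 (min (d / norm v) ((\<rho> - dist w x) / norm v) / 2)"
    have t0: "t > 0" using d v0 interior by (simp add: t_def)
    have t1: "t \<le> 1" by (simp add: t_def)
    have "t < d / norm v" "t \<le> (\<rho> - dist w x) / norm v"
    proof -
      let ?A = "d / norm v" and ?B = "(\<rho> - dist w x) / norm v"
      have "0 < ?A" "0 < ?B" using d v0 interior by simp_all
      moreover have "t \<le> min ?A ?B / 2" unfolding t_def by (rule min.cobounded2)
      moreover have "t < p \<and> t \<le> q" if "0 < p" "0 < q" "t \<le> min p q / 2" for p q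
        using that by (auto simp: min_def split: if_splits)
      ultimately show "t < ?A" "t \<le> ?B" by blast+
    qed
    then have t: "t * norm v < d" "t * norm v \<le> \<rho> - dist w x"
      using v0 by (auto simp: field_simps)
    let ?u = "w + t *\<^sub>R v"
    have "dist x ?u \<le> dist x w + dist w ?u" by (rule dist_triangle)
    also have "dist w ?u = t * norm v" using t0 by (simp add: dist_norm)
    finally have u: "?u \<in> cball x \<rho>" "dist ?u x \<le> dist w x + t * norm v"
      using t by (auto simp: dist_commute)
    have "norm (f ?u - f w - f' (t *\<^sub>R v)) \<le> e * (t * norm v)"
      using d(2)[of ?u] t t0 by simp
    also have "\<dots> = t * (\<eta> / 2)" using v0 by (simp add: e_def)
    finally have err: "norm (f ?u - f w - t *\<^sub>R (y - f w)) \<le> t * (\<eta> / 2)"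
      using v linear_cmul[OF lin, of t v] by simp
    have "f ?u - y = (f ?u - f w - t *\<^sub>R (y - f w)) + (1 - t) *\<^sub>R (f w - y)"
      by (simp add: algebra_simps)
    then have "dist (f ?u) y \<le> t * (\<eta> / 2) + norm ((1 - t) *\<^sub>R (f w - y))"
      using err norm_triangle_ineq unfolding dist_norm by (smt (verit))
    also have "norm ((1 - t) *\<^sub>R (f w - y)) = (1 - t) * R" using t1 by (simp add: R_def)
    finally have "dist (f ?u) y \<le> t * (\<eta> / 2) + (1 - t) * R" .
    moreover have "k * dist ?u x \<le> k * dist w x + t * (k * norm v)"
      using mult_left_mono[OF u(2), of k] k by (simp add: algebra_simps)
    ultimately have "g ?u \<le> t * (\<eta> / 2) + (1 - t) * R + k * dist w x + t * (k * norm v)"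
      by (simp add: g_def)
    also have "\<dots> = g w - t * (\<eta> / 2)"
      by (simp add: g_def \<eta>_def R_def dist_norm field_simps)
    also have "\<dots> < g w" using t0 \<eta> by simp
    finally show False using min[OF u(1)] by simp
  qed
  then show "y \<in> f ` cball x \<rho>" using w by blast
qed

text \<open>The constants of a conformal system are gathered in a locale.  A single \<open>b\<close> bounds the Lipschitz
  constants and the derivatives, and \<open>\<epsilon>\<close> is such that \<open>V\<close> contains the \<open>\<epsilon>\<close>-neighbourhood of
  the attractor.\<close>

locale conformal_attractor =
  fixes D :: "'i set" and \<phi> :: "'i \<Rightarrow> 'a::euclidean_space \<Rightarrow> 'a" and X V :: "'a set"
    and a b c \<alpha> \<epsilon> :: real and z :: 'a
  assumes finite_D: "finite D"
    and compact_X: "compact X"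
    and X_eq: "X = (\<Union>i\<in>D. \<phi> i ` X)"
    and z_in_X: "z \<in> X"
    and eps_pos: "0 < \<epsilon>"
    and ball_subset_V: "x \<in> X \<Longrightarrow> ball x \<epsilon> \<subseteq> V"
    and inj_phi: "i \<in> D \<Longrightarrow> inj_on (\<phi> i) V"
    and deriv_phi: "i \<in> D \<Longrightarrow> x \<in> V \<Longrightarrow> (\<phi> i has_derivative frechet_derivative (\<phi> i) (at x)) (at x)"
    and conformal_phi: "i \<in> D \<Longrightarrow> x \<in> V \<Longrightarrow>
      norm (frechet_derivative (\<phi> i) (at x) v) = deriv_norm (\<phi> i) x * norm v"
    and contraction_phi: "i \<in> D \<Longrightarrow> x \<in> V \<Longrightarrow> y \<in> V \<Longrightarrow> dist (\<phi> i x) (\<phi> i y) \<le> b * dist x y"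
    and a_pos: "0 < a" and a_le: "i \<in> D \<Longrightarrow> x \<in> V \<Longrightarrow> a \<le> deriv_norm (\<phi> i) x"
    and b_pos: "0 < b" and b_less_1: "b < 1"
    and le_b: "i \<in> D \<Longrightarrow> x \<in> V \<Longrightarrow> deriv_norm (\<phi> i) x \<le> b"
    and holder_pos: "0 < \<alpha>" "0 < c"
    and holder: "i \<in> D \<Longrightarrow> x \<in> V \<Longrightarrow> y \<in> V \<Longrightarrow>
      \<bar>deriv_norm (\<phi> i) x - deriv_norm (\<phi> i) y\<bar> \<le> c * norm (x - y) powr \<alpha>"
begin

text \<open>The maps need not send \<open>V\<close> into itself.  All estimates therefore take place on the
  \<open>\<epsilon>\<close>-neighbourhood of the attractor, which is invariant.\<close>

definition nbhd :: "'a set" where "nbhd = (\<Union>x\<in>X. ball x \<epsilon>)"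

lemma phi_in_X: "i \<in> D \<Longrightarrow> x \<in> X \<Longrightarrow> \<phi> i x \<in> X"
  using X_eq by blast

lemma word_map_in_X: "set I \<subseteq> D \<Longrightarrow> x \<in> X \<Longrightarrow> word_map \<phi> I x \<in> X"
  by (induction I) (auto intro: phi_in_X)

lemma nbhd_subset_V: "nbhd \<subseteq> V"
  using ball_subset_V by (auto simp: nbhd_def)

lemma X_subset_nbhd: "X \<subseteq> nbhd"
  using eps_pos by (force simp: nbhd_def)

lemma X_subset_V: "X \<subseteq> V"
  using X_subset_nbhd nbhd_subset_V by blast

lemma phi_in_ball:
  assumes "i \<in> D" "x \<in> X" "y \<in> ball x \<epsilon>"
  shows "\<phi> i y \<in> ball (\<phi> i x) \<epsilon>"
proof -
  have "dist (\<phi> i x) (\<phi> i y) \<le> b * dist x y"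
    using assms ball_subset_V[OF assms(2)] X_subset_V by (intro contraction_phi) blast+
  also have "\<dots> \<le> 1 * dist x y" using b_less_1 by (intro mult_right_mono) auto
  finally show ?thesis using assms by simp
qed

lemma phi_nbhd: "i \<in> D \<Longrightarrow> \<phi> i ` nbhd \<subseteq> nbhd"
  unfolding nbhd_def using phi_in_ball phi_in_X by blast

lemma word_map_invariant:
  "(\<And>i. i \<in> D \<Longrightarrow> \<phi> i ` S \<subseteq> S) \<Longrightarrow> set I \<subseteq> D \<Longrightarrow> x \<in> S \<Longrightarrow> word_map \<phi> I x \<in> S"
  by (induction I) auto

lemma word_map_in_nbhd: "set I \<subseteq> D \<Longrightarrow> x \<in> nbhd \<Longrightarrow> word_map \<phi> I x \<in> nbhd"
  using word_map_invariant[of nbhd] phi_nbhd by blast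

lemma word_map_contracts:
  assumes S: "S \<subseteq> V" "\<And>i. i \<in> D \<Longrightarrow> \<phi> i ` S \<subseteq> S" and xy: "x \<in> S" "y \<in> S" and I: "set I \<subseteq> D"
  shows "dist (word_map \<phi> I x) (word_map \<phi> I y) \<le> b ^ length I * dist x y"
  using I
proof (induction I)
  case (Cons i I)
  have "word_map \<phi> I x \<in> S" "word_map \<phi> I y \<in> S"
    using word_map_invariant[of S I] S(2) xy Cons.prems by auto
  then have "dist (word_map \<phi> (i # I) x) (word_map \<phi> (i # I) y)
      \<le> b * dist (word_map \<phi> I x) (word_map \<phi> I y)"
    using Cons.prems S(1) by (auto intro!: contraction_phi)
  also have "\<dots> \<le> b * (b ^ length I * dist x y)"
    using Cons b_pos by (intro mult_left_mono) auto
  finally show ?case by (simp add: mult.assoc)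
qed simp

lemma inj_on_word_map:
  assumes S: "S \<subseteq> V" "\<And>i. i \<in> D \<Longrightarrow> \<phi> i ` S \<subseteq> S" and I: "set I \<subseteq> D"
  shows "inj_on (word_map \<phi> I) S"
  using I
proof (induction I)
  case (Cons i I)
  show ?case
  proof (rule inj_onI)
    fix x y assume xy: "x \<in> S" "y \<in> S" "word_map \<phi> (i # I) x = word_map \<phi> (i # I) y"
    have "word_map \<phi> I x \<in> V" "word_map \<phi> I y \<in> V"
      using word_map_invariant[of S I] S xy Cons.prems by auto
    then have "word_map \<phi> I x = word_map \<phi> I y"
      using xy(3) inj_phi[of i] Cons.prems by (auto dest: inj_onD)
    then show "x = y" using Cons xy by (auto dest: inj_onD)
  qed
qed (simp add: inj_on_def)

lemma word_map_has_derivative: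
  assumes "set I \<subseteq> D" "x \<in> nbhd"
  shows "\<exists>f'. (word_map \<phi> I has_derivative f') (at x) \<and> (\<forall>v. norm (f' v) = word_deriv \<phi> I x * norm v)"
  using assms(1)
proof (induction I)
  case Nil
  have "word_map \<phi> [] = (\<lambda>x. x)" by auto
  then show ?case by (auto intro!: exI[of _ "\<lambda>v. v"])
next
  case (Cons i I)
  then obtain f' where f': "(word_map \<phi> I has_derivative f') (at x)"
    "\<And>v. norm (f' v) = word_deriv \<phi> I x * norm v" by auto
  let ?u = "word_map \<phi> I x"
  have u: "?u \<in> V" "i \<in> D" using word_map_in_nbhd[of I x] assms(2) Cons.prems nbhd_subset_V by auto
  have der: "(\<phi> i \<circ> word_map \<phi> I has_derivative frechet_derivative (\<phi> i) (at ?u) \<circ> f') (at x)"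
    using f'(1) deriv_phi[OF u(2,1)] by (rule diff_chain_at)
  have comp: "word_map \<phi> (i # I) = \<phi> i \<circ> word_map \<phi> I" by auto
  show ?case
    unfolding comp
  proof (intro exI conjI allI)
    show "norm ((frechet_derivative (\<phi> i) (at ?u) \<circ> f') v) = word_deriv \<phi> (i # I) x * norm v" for v
      using f'(2) conformal_phi[OF u(2,1)] by simp
  qed (rule der)
qed

lemma word_deriv_bounds:
  assumes "set I \<subseteq> D" "x \<in> nbhd"
  shows "a ^ length I \<le> word_deriv \<phi> I x" "word_deriv \<phi> I x \<le> b ^ length I" "0 < word_deriv \<phi> I x"
proof -
  have "a ^ length I \<le> word_deriv \<phi> I x \<and> word_deriv \<phi> I x \<le> b ^ length I"
    using assms(1)
  proof (induction I)
    case (Cons i I)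
    have u: "word_map \<phi> I x \<in> V" "i \<in> D"
      using word_map_in_nbhd[of I x] assms(2) Cons.prems nbhd_subset_V by auto
    have IH: "a ^ length I \<le> word_deriv \<phi> I x" "word_deriv \<phi> I x \<le> b ^ length I" using Cons by auto
    have "0 \<le> word_deriv \<phi> I x" using IH(1) a_pos zero_le_power[of a] by (meson less_imp_le order_trans)
    then show ?case
      using a_le[OF u(2,1)] le_b[OF u(2,1)] IH a_pos b_pos by (auto intro!: mult_mono)
  qed simp
  then show "a ^ length I \<le> word_deriv \<phi> I x" "word_deriv \<phi> I x \<le> b ^ length I" by auto
  then show "0 < word_deriv \<phi> I x" using a_pos by (meson zero_less_power less_le_trans)
qed

lemma bounded_nbhd:
  obtains R where "0 < R" "\<And>x y. x \<in> nbhd \<Longrightarrow> y \<in> nbhd \<Longrightarrow> dist x y \<le> R"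
proof -
  obtain B where B: "B > 0" "\<And>x. x \<in> X \<Longrightarrow> norm x \<le> B"
    using compact_imp_bounded[OF compact_X] unfolding bounded_pos by blast
  have n: "norm x \<le> B + \<epsilon>" if x: "x \<in> nbhd" for x
  proof -
    obtain y where "y \<in> X" "dist y x < \<epsilon>" using x by (auto simp: nbhd_def)
    then show ?thesis using B(2)[of y] norm_triangle_sub[of x y] by (simp add: dist_norm norm_minus_commute)
  qed
  show ?thesis
  proof (rule that[of "2 * (B + \<epsilon>)"])
    show "dist x y \<le> 2 * (B + \<epsilon>)" if "x \<in> nbhd" "y \<in> nbhd" for x y
      using n[OF that(1)] n[OF that(2)] norm_triangle_ineq4[of x y] by (simp add: dist_norm)
  qed (use B eps_pos in auto)
qed

text \<open>Two orbits along the same word approach each other geometrically, so the logarithms of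
  the two derivatives differ, by Holder continuity, by at most a geometric series.\<close>

lemma bounded_distortion:
  obtains K where "1 \<le> K"
    "\<And>I x y. set I \<subseteq> D \<Longrightarrow> x \<in> nbhd \<Longrightarrow> y \<in> nbhd \<Longrightarrow> word_deriv \<phi> I x \<le> K * word_deriv \<phi> I y"
proof -
  obtain R where R: "R > 0" "\<And>x y. x \<in> nbhd \<Longrightarrow> y \<in> nbhd \<Longrightarrow> dist x y \<le> R"
    using bounded_nbhd by blast
  define G where "G = c / a * R powr \<alpha>"
  have G: "G \<ge> 0" using holder_pos a_pos by (simp add: G_def)
  define q where "q = b powr \<alpha>"
  have q: "0 < q" "q < 1"
    using b_pos b_less_1 holder_pos powr_less_mono2[of \<alpha> b 1] by (auto simp: q_def)
  have main: "word_deriv \<phi> I x \<le> exp (G * (\<Sum>k<length I. q ^ k)) * word_deriv \<phi> I y"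
    if "set I \<subseteq> D" "x \<in> nbhd" "y \<in> nbhd" for I x y
    using that(1)
  proof (induction I)
    case (Cons i I)
    let ?u = "word_map \<phi> I x" and ?v = "word_map \<phi> I y"
    have I: "set I \<subseteq> D" "i \<in> D" using Cons.prems by auto
    have uv: "?u \<in> V" "?v \<in> V" using word_map_in_nbhd[OF I(1)] that nbhd_subset_V by auto
    have "dist ?u ?v \<le> b ^ length I * dist x y"
      by (rule word_map_contracts[OF nbhd_subset_V phi_nbhd that(2,3) I(1)])
    also have "\<dots> \<le> b ^ length I * R" using R(2) that b_pos by (intro mult_left_mono) auto
    finally have "norm (?u - ?v) powr \<alpha> \<le> (b ^ length I * R) powr \<alpha>"
      using holder_pos by (intro powr_mono2) (auto simp: dist_norm)
    also have "\<dots> = q ^ length I * R powr \<alpha>"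
      using b_pos R by (simp add: powr_mult q_def powr_powr flip: powr_realpow) (simp add: mult.commute)
    finally have "deriv_norm (\<phi> i) ?u \<le> deriv_norm (\<phi> i) ?v + c * (q ^ length I * R powr \<alpha>)"
      using holder[OF I(2) uv] holder_pos mult_left_mono[of _ _ c] by (smt (verit))
    also have "\<dots> = deriv_norm (\<phi> i) ?v + a * (G * q ^ length I)"
      using a_pos by (simp add: G_def)
    also have "\<dots> \<le> deriv_norm (\<phi> i) ?v + deriv_norm (\<phi> i) ?v * (G * q ^ length I)"
      using a_le[OF I(2) uv(2)] G q by (intro add_left_mono mult_right_mono) auto
    also have "\<dots> = deriv_norm (\<phi> i) ?v * (1 + G * q ^ length I)" by (simp add: algebra_simps)
    also have "\<dots> \<le> deriv_norm (\<phi> i) ?v * exp (G * q ^ length I)"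
      using a_le[OF I(2) uv(2)] a_pos by (intro mult_left_mono exp_ge_add_one_self) auto
    finally have 1: "deriv_norm (\<phi> i) ?u \<le> deriv_norm (\<phi> i) ?v * exp (G * q ^ length I)" .
    have "word_deriv \<phi> (i # I) x \<le> (deriv_norm (\<phi> i) ?v * exp (G * q ^ length I))
       * (exp (G * (\<Sum>k<length I. q ^ k)) * word_deriv \<phi> I y)"
      unfolding word_deriv.simps
      using 1 Cons.IH[OF I(1)] word_deriv_bounds(3)[OF I(1)] that a_le[OF I(2) uv(1)] a_pos
        a_le[OF I(2) uv(2)]
      by (intro mult_mono) (auto intro: less_imp_le)
    also have "\<dots> = exp (G * (\<Sum>k<length (i # I). q ^ k)) * word_deriv \<phi> (i # I) y"
      by (simp add: algebra_simps exp_add)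
    finally show ?case .
  qed simp
  show ?thesis
  proof (rule that[of "exp (G / (1 - q))"])
    fix I x y assume *: "set I \<subseteq> D" "x \<in> nbhd" "y \<in> nbhd"
    have "(\<Sum>k<length I. q ^ k) \<le> 1 / (1 - q)"
      using q sum_le_suminf[of "\<lambda>k. q ^ k" "{..<length I}"] by (simp add: summable_geometric suminf_geometric)
    then have "G * (\<Sum>k<length I. q ^ k) \<le> G / (1 - q)"
      using mult_left_mono[of _ _ G] G by fastforce
    then have "exp (G * (\<Sum>k<length I. q ^ k)) * word_deriv \<phi> I y \<le> exp (G / (1 - q)) * word_deriv \<phi> I y"
      using word_deriv_bounds(3)[OF *(1,3)] by (intro mult_right_mono) auto
    then show "word_deriv \<phi> I x \<le> exp (G / (1 - q)) * word_deriv \<phi> I y"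
      using main[OF *] by linarith
  qed (use G q in simp)
qed

text \<open>By bounded distortion, the derivative at the one point \<open>z\<close> measures the size of a cylinder up
  to a constant factor.\<close>

abbreviation scale :: "'i list \<Rightarrow> real" where "scale I \<equiv> word_deriv \<phi> I z"

lemma z_in_nbhd: "z \<in> nbhd" using z_in_X X_subset_nbhd by blast

lemmas scale_bounds = word_deriv_bounds[OF _ z_in_nbhd]

lemma scale_quasi_multiplicative:
  obtains K where "1 \<le> K"
    "\<And>I J. set I \<subseteq> D \<Longrightarrow> set J \<subseteq> D \<Longrightarrow> scale I * scale J \<le> K * scale (I @ J)"
    "\<And>I J. set I \<subseteq> D \<Longrightarrow> set J \<subseteq> D \<Longrightarrow> scale (I @ J) \<le> K * (scale I * scale J)"
proof -
  obtain K where K: "1 \<le> K"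
    "\<And>I x y. set I \<subseteq> D \<Longrightarrow> x \<in> nbhd \<Longrightarrow> y \<in> nbhd \<Longrightarrow> word_deriv \<phi> I x \<le> K * word_deriv \<phi> I y"
    using bounded_distortion by metis
  show ?thesis
  proof (rule that[OF K(1)])
    fix I J assume IJ: "set I \<subseteq> D" "set J \<subseteq> D"
    have u: "word_map \<phi> J z \<in> nbhd" using IJ z_in_nbhd by (rule_tac word_map_in_nbhd)
    note pos = scale_bounds(3)[OF IJ(2)]
    show "scale I * scale J \<le> K * scale (I @ J)"
      using mult_right_mono[OF K(2)[OF IJ(1) z_in_nbhd u], of "scale J"] pos
      by (simp add: word_deriv_append mult.assoc)
    show "scale (I @ J) \<le> K * (scale I * scale J)"
      using mult_right_mono[OF K(2)[OF IJ(1) u z_in_nbhd], of "scale J"] pos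
      by (simp add: word_deriv_append mult.assoc)
  qed
qed

text \<open>Within one of the balls of \<open>nbhd\<close> the mean value inequality applies.  Points far apart
  enter a common ball after a bounded number of steps, and these cost a constant factor.\<close>

lemma dist_word_map_le_scale:
  obtains K where "1 \<le> K"
    "\<And>I x y. set I \<subseteq> D \<Longrightarrow> x \<in> X \<Longrightarrow> y \<in> nbhd \<Longrightarrow> dist (word_map \<phi> I x) (word_map \<phi> I y) \<le> K * scale I"
proof -
  obtain K where K: "1 \<le> K"
    "\<And>I x y. set I \<subseteq> D \<Longrightarrow> x \<in> nbhd \<Longrightarrow> y \<in> nbhd \<Longrightarrow> word_deriv \<phi> I x \<le> K * word_deriv \<phi> I y"
    using bounded_distortion by metis
  obtain R where R: "R > 0" "\<And>x y. x \<in> nbhd \<Longrightarrow> y \<in> nbhd \<Longrightarrow> dist x y \<le> R"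
    using bounded_nbhd by blast
  have near: "dist (word_map \<phi> I x) (word_map \<phi> I y) \<le> K * scale I * \<epsilon>"
    if I: "set I \<subseteq> D" and x: "x \<in> X" and y: "y \<in> ball x \<epsilon>" for I x y
  proof -
    have sub: "ball x \<epsilon> \<subseteq> nbhd" using x by (auto simp: nbhd_def)
    have "\<exists>f'. \<forall>w\<in>ball x \<epsilon>. (word_map \<phi> I has_derivative f' w) (at w) \<and>
        (\<forall>v. norm (f' w v) = word_deriv \<phi> I w * norm v)"
      using word_map_has_derivative[OF I] sub by (intro bchoice) auto
    then obtain f' where f': "\<And>w. w \<in> ball x \<epsilon> \<Longrightarrow> (word_map \<phi> I has_derivative f' w) (at w)"
        "\<And>w v. w \<in> ball x \<epsilon> \<Longrightarrow> norm (f' w v) = word_deriv \<phi> I w * norm v"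
      by blast
    have "norm (word_map \<phi> I x - word_map \<phi> I y) \<le> K * scale I * norm (x - y)"
    proof (rule differentiable_bound[of "ball x \<epsilon>" _ f'])
      show "(word_map \<phi> I has_derivative f' w) (at w within ball x \<epsilon>)" if "w \<in> ball x \<epsilon>" for w
        using f'(1)[OF that] by (rule has_derivative_at_withinI)
      show "onorm (f' w) \<le> K * scale I" if "w \<in> ball x \<epsilon>" for w
      proof (rule onorm_le)
        fix v
        have "word_deriv \<phi> I w \<le> K * scale I" using K(2)[OF I _ z_in_nbhd] that sub by auto
        then show "norm (f' w v) \<le> K * scale I * norm v"
          using f'(2)[OF that] by (auto intro: mult_right_mono)
      qed
    qed (use y eps_pos in auto)
    also have "\<dots> \<le> K * scale I * \<epsilon>"
      using y K(1) scale_bounds(3)[OF I] by (intro mult_left_mono) (auto simp: dist_norm)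
    finally show ?thesis by (simp add: dist_norm)
  qed
  obtain N where N: "b ^ N < \<epsilon> / R"
    using real_arch_pow_inv[of "\<epsilon> / R" b] eps_pos R b_less_1 by auto
  define M where "M = (R + K * K * \<epsilon>) / a ^ N"
  have far: "dist (word_map \<phi> I x) (word_map \<phi> I y) \<le> M * scale I"
    if I: "set I \<subseteq> D" and x: "x \<in> X" and y: "y \<in> nbhd" for I x y
  proof (cases "length I < N")
    case True
    have pos: "0 \<le> R / a ^ N" "0 \<le> K * K * \<epsilon> / a ^ N" using R a_pos K eps_pos by auto
    have "word_map \<phi> I x \<in> nbhd" "word_map \<phi> I y \<in> nbhd"
      using I x y X_subset_nbhd by (auto intro!: word_map_in_nbhd)
    then have "dist (word_map \<phi> I x) (word_map \<phi> I y) \<le> R" by (rule R(2))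
    also have "a \<le> 1"
    proof (cases "I = []")
      case False
      then obtain i where "i \<in> D" using I by (cases I) auto
      then show ?thesis using a_le[of i z] le_b[of i z] b_less_1 z_in_X X_subset_V by force
    next
      case True
      have "D \<noteq> {}" using X_eq z_in_X by blast
      then obtain i where "i \<in> D" by blast
      then show ?thesis using a_le[of i z] le_b[of i z] b_less_1 z_in_X X_subset_V by force
    qed
    then have "a ^ N \<le> a ^ length I" using True a_pos by (intro power_decreasing) auto
    then have "a ^ N \<le> scale I" using scale_bounds(1)[OF I] by linarith
    then have "R \<le> R / a ^ N * scale I" using R a_pos by (simp add: field_simps)
    also have "\<dots> \<le> M * scale I"
      using pos scale_bounds(3)[OF I] by (intro mult_right_mono) (auto simp: M_def add_divide_distrib)
    finally show ?thesis .
  next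
    case False
    define J where "J = take (length I - N) I"
    define T where "T = drop (length I - N) I"
    have JT: "I = J @ T" "length T = N" "set J \<subseteq> D" "set T \<subseteq> D"
      using False I set_take_subset[of _ I] set_drop_subset[of _ I] unfolding J_def T_def by (auto; blast)+
    let ?u = "word_map \<phi> T x" and ?v = "word_map \<phi> T y"
    have u: "?u \<in> X" using JT x by (intro word_map_in_X)
    have "dist ?u ?v \<le> b ^ length T * dist x y"
      using x y X_subset_nbhd by (intro word_map_contracts[OF nbhd_subset_V phi_nbhd _ _ JT(4)]) auto
    also have "\<dots> \<le> b ^ N * R"
      using R(2)[of x y] x y X_subset_nbhd b_pos JT by (auto intro!: mult_left_mono)
    also have "\<dots> < \<epsilon>" using N R by (simp add: field_simps)
    finally have v: "?v \<in> ball ?u \<epsilon>" by simp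
    have "dist (word_map \<phi> I x) (word_map \<phi> I y) \<le> K * scale J * \<epsilon>"
      using near[OF JT(3) u v] JT(1) by (simp add: word_map_append)
    also have "\<dots> \<le> K * (K * scale I / a ^ N) * \<epsilon>"
    proof -
      have "word_map \<phi> T z \<in> nbhd" using JT z_in_nbhd by (intro word_map_in_nbhd)
      then have 1: "scale J \<le> K * word_deriv \<phi> J (word_map \<phi> T z)" by (rule K(2)[OF JT(3) z_in_nbhd])
      have 2: "word_deriv \<phi> J (word_map \<phi> T z) * a ^ N \<le> scale I"
        using scale_bounds(1)[OF JT(4)] JT(1,2) word_deriv_bounds(3)[OF JT(3) \<open>word_map \<phi> T z \<in> nbhd\<close>]
        by (simp add: word_deriv_append mult_left_mono)
      then have "word_deriv \<phi> J (word_map \<phi> T z) \<le> scale I / a ^ N" using a_pos by (simp add: field_simps)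
      then have "scale J \<le> K * (scale I / a ^ N)" using 1 K(1) mult_left_mono[of _ _ K] by (smt (verit))
      then show ?thesis using K eps_pos by (intro mult_right_mono mult_left_mono) auto
    qed
    also have "\<dots> \<le> M * scale I"
      using R a_pos K eps_pos scale_bounds(3)[OF I] by (simp add: M_def field_simps)
    finally show ?thesis .
  qed
  show ?thesis
  proof (rule that[of "max 1 M"])
    fix I x y assume *: "set I \<subseteq> D" "x \<in> X" "y \<in> nbhd"
    have "M * scale I \<le> max 1 M * scale I" using scale_bounds(3)[OF *(1)] by (intro mult_right_mono) auto
    then show "dist (word_map \<phi> I x) (word_map \<phi> I y) \<le> max 1 M * scale I" using far[OF *] by linarith
  qed simp
qed

lemma ball_subset_image_word_map:
  assumes \<rho>: "0 < \<rho>" and sub: "cball x \<rho> \<subseteq> nbhd"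
  obtains l where "0 < l"
    "\<And>I. set I \<subseteq> D \<Longrightarrow> ball (word_map \<phi> I x) (l * scale I) \<subseteq> word_map \<phi> I ` cball x \<rho>"
proof -
  obtain K where K: "1 \<le> K"
    "\<And>I x y. set I \<subseteq> D \<Longrightarrow> x \<in> nbhd \<Longrightarrow> y \<in> nbhd \<Longrightarrow> word_deriv \<phi> I x \<le> K * word_deriv \<phi> I y"
    using bounded_distortion by metis
  show ?thesis
  proof (rule that[of "\<rho> / K"])
    fix I assume I: "set I \<subseteq> D"
    have "ball (word_map \<phi> I x) (scale I / K * \<rho>) \<subseteq> word_map \<phi> I ` cball x \<rho>"
    proof (rule ball_subset_image_cball_if_derivative_expands[OF \<rho>])
      fix w assume w: "w \<in> cball x \<rho>"
      have "scale I \<le> K * word_deriv \<phi> I w" using K(2)[OF I z_in_nbhd] w sub by auto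
      then have "scale I / K \<le> word_deriv \<phi> I w" using K(1) by (simp add: field_simps)
      then show "\<exists>f' L. (word_map \<phi> I has_derivative f') (at w) \<and> scale I / K \<le> L
          \<and> (\<forall>v. norm (f' v) = L * norm v)"
        using word_map_has_derivative[OF I, of w] w sub by blast
    qed (use K(1) scale_bounds(3)[OF I] in simp)
    then show "ball (word_map \<phi> I x) (\<rho> / K * scale I) \<subseteq> word_map \<phi> I ` cball x \<rho>"
      by (simp add: mult.commute)
  qed (use \<rho> K in simp)
qed

text \<open>The image of a ball about \<open>x\<close> that does not contain \<open>y\<close> contains a ball of radius comparable with
  the scale, and by injectivity it avoids the image of \<open>y\<close>.\<close>

lemma scale_le_dist_word_map:
  assumes xy: "x \<in> X" "y \<in> X" "x \<noteq> y"
  obtains l where "0 < l"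
    "\<And>I. set I \<subseteq> D \<Longrightarrow> l * scale I \<le> dist (word_map \<phi> I x) (word_map \<phi> I y)"
proof -
  define \<rho> where "\<rho> = min (\<epsilon> / 2) (dist x y / 2)"
  have \<rho>: "0 < \<rho>" "\<rho> < \<epsilon>" "\<rho> < dist x y" using xy eps_pos by (auto simp: \<rho>_def min_def)
  have "cball x \<rho> \<subseteq> nbhd" using \<rho> xy by (force simp: nbhd_def)
  then obtain l where l: "0 < l"
      "\<And>I. set I \<subseteq> D \<Longrightarrow> ball (word_map \<phi> I x) (l * scale I) \<subseteq> word_map \<phi> I ` cball x \<rho>"
    using ball_subset_image_word_map[OF \<rho>(1)] by metis
  show ?thesis
  proof (rule that[OF l(1)], rule ccontr)
    fix I assume I: "set I \<subseteq> D" and "\<not> l * scale I \<le> dist (word_map \<phi> I x) (word_map \<phi> I y)"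
    then have "word_map \<phi> I y \<in> word_map \<phi> I ` cball x \<rho>" using l(2)[OF I] by auto
    moreover have "inj_on (word_map \<phi> I) nbhd"
      by (rule inj_on_word_map[OF nbhd_subset_V phi_nbhd I])
    ultimately have "y \<in> cball x \<rho>"
      using xy X_subset_nbhd \<open>cball x \<rho> \<subseteq> nbhd\<close> by (auto dest!: inj_onD)
    then show False using \<rho> by simp
  qed
qed

text \<open>The open set \<open>U\<close> may be disjoint from \<open>X\<close>, but it contains orbits, and these approach \<open>X\<close>.
  A point \<open>p\<close> of \<open>U\<close> close to \<open>X\<close> marks the cylinders: the image of a small ball about \<open>p\<close> under
  a word contains a ball comparable with the cylinder and lies in the image of \<open>U\<close>, which the
  marker of an incomparable word avoids.\<close>

lemma separated_markers:
  assumes U: "open U" "U \<noteq> {}" "U \<subseteq> V" "\<And>i. i \<in> D \<Longrightarrow> \<phi> i ` U \<subseteq> U"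
    and disj: "\<And>i j. i \<in> D \<Longrightarrow> j \<in> D \<Longrightarrow> i \<noteq> j \<Longrightarrow> \<phi> i ` U \<inter> \<phi> j ` U = {}"
  obtains p l where "p \<in> nbhd" "0 < l"
    "\<And>I J. set I \<subseteq> D \<Longrightarrow> set J \<subseteq> D \<Longrightarrow> I \<parallel> J \<Longrightarrow> l * scale I \<le> dist (word_map \<phi> I p) (word_map \<phi> J p)"
proof -
  obtain u where u: "u \<in> U" using U by blast
  obtain i where i: "i \<in> D" using X_eq z_in_X by blast
  obtain N where N: "b ^ N < \<epsilon> / (dist z u + 1)"
    using real_arch_pow_inv[of "\<epsilon> / (dist z u + 1)" b] eps_pos b_less_1
    by (metis add_nonneg_pos divide_pos_pos zero_le_dist zero_less_one)
  define p where "p = word_map \<phi> (replicate N i) u"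
  define x where "x = word_map \<phi> (replicate N i) z"
  have iN: "set (replicate N i) \<subseteq> D" using i by auto
  have p: "p \<in> U" unfolding p_def by (rule word_map_invariant[OF U(4) iN u])
  have x: "x \<in> X" unfolding x_def by (rule word_map_in_X[OF iN z_in_X])
  have "dist x p \<le> b ^ length (replicate N i) * dist z u"
    unfolding x_def p_def
    using U(3,4) X_subset_V phi_in_X z_in_X u iN by (intro word_map_contracts[of "X \<union> U"]) auto
  also have "\<dots> \<le> b ^ N * (dist z u + 1)" using b_pos by (auto intro!: mult_left_mono)
  also have "\<dots> < \<epsilon>"
  proof -
    have "0 < dist z u + 1" by (simp add: add_nonneg_pos)
    with N show ?thesis by (simp only: pos_less_divide_eq)
  qed
  finally have "p \<in> ball x \<epsilon> \<inter> U" using p by simp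
  moreover have "open (ball x \<epsilon> \<inter> U)" using U(1) by blast
  ultimately obtain \<rho> where \<rho>: "0 < \<rho>" "cball p \<rho> \<subseteq> ball x \<epsilon> \<inter> U"
    using open_contains_cball by meson
  then have sub: "cball p \<rho> \<subseteq> nbhd" "cball p \<rho> \<subseteq> U" using x by (auto simp: nbhd_def)
  obtain l where l: "0 < l"
      "\<And>I. set I \<subseteq> D \<Longrightarrow> ball (word_map \<phi> I p) (l * scale I) \<subseteq> word_map \<phi> I ` cball p \<rho>"
    using ball_subset_image_word_map[OF \<rho>(1) sub(1)] by metis
  show ?thesis
  proof (rule that[of p, OF _ l(1)])
    show "p \<in> nbhd" using sub(1) \<rho>(1) by auto
    fix I J assume I: "set I \<subseteq> D" and J: "set J \<subseteq> D" and par: "I \<parallel> J"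
    obtain P i I' j J' where dec: "i \<noteq> j" "I = P @ i # I'" "J = P @ j # J'"
      using parallel_decomp[OF par] by blast
    have mem: "set P \<subseteq> D" "i \<in> D" "j \<in> D" "set I' \<subseteq> D" "set J' \<subseteq> D" using I J dec by auto
    have inv: "word_map \<phi> Q v \<in> U" if "set Q \<subseteq> D" "v \<in> U" for Q v
      using word_map_invariant[of U] U(4) that by blast
    show "l * scale I \<le> dist (word_map \<phi> I p) (word_map \<phi> J p)"
    proof (rule ccontr)
      assume "\<not> ?thesis"
      then have "word_map \<phi> J p \<in> word_map \<phi> I ` cball p \<rho>" using l(2)[OF I] by auto
      then obtain q where q: "q \<in> U" "word_map \<phi> J p = word_map \<phi> I q" using sub(2) by auto
      let ?v = "\<phi> j (word_map \<phi> J' p)" and ?w = "\<phi> i (word_map \<phi> I' q)"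
      have "?v \<in> \<phi> j ` U" "?w \<in> \<phi> i ` U" using inv mem q p by blast+
      moreover have "?v = ?w"
      proof (rule inj_onD[OF inj_on_word_map[OF U(3,4) mem(1)]])
        show "word_map \<phi> P ?v = word_map \<phi> P ?w" using q(2) dec by (simp add: word_map_append)
      qed (use \<open>?v \<in> \<phi> j ` U\<close> \<open>?w \<in> \<phi> i ` U\<close> U(4) mem in blast)+
      ultimately show False using disj[OF mem(2,3) dec(1)] by auto
    qed
  qed
qed

end

section \<open>Weights on words\<close>

lemma finite_words: "finite D \<Longrightarrow> finite (words D n)"
  unfolding words_def by (rule finite_lists_length_eq)

lemma words_0: "words D 0 = {[]}"
  by (auto simp: words_def)

lemma card_words: "finite D \<Longrightarrow> card (words D n) = card D ^ n"
  unfolding words_def by (rule card_lists_length_eq)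

lemma words_append: "I \<in> words D m \<Longrightarrow> J \<in> words D n \<Longrightarrow> I @ J \<in> words D (m + n)"
  by (auto simp: words_def)

lemma take_words: "w \<in> words D (m + n) \<Longrightarrow> take m w \<in> words D m"
  by (auto simp: words_def dest: in_set_takeD)

lemma drop_words: "w \<in> words D (m + n) \<Longrightarrow> drop m w \<in> words D n"
  by (auto simp: words_def dest: in_set_dropD)

lemma sum_words_split:
  assumes "finite D"
  shows "(\<Sum>w | w \<in> words D (m + n) \<and> P (take m w) \<and> Q (drop m w). f w)
    = (\<Sum>I | I \<in> words D m \<and> P I. \<Sum>J | J \<in> words D n \<and> Q J. f (I @ J))"
proof -
  let ?A = "{I \<in> words D m. P I}" and ?B = "{J \<in> words D n. Q J}"
  have fin: "finite ?A" "finite ?B" using finite_words[OF assms] by auto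
  have "(\<Sum>I\<in>?A. \<Sum>J\<in>?B. f (I @ J)) = (\<Sum>(I, J)\<in>?A \<times> ?B. f (I @ J))"
    using fin by (subst sum.Sigma) auto
  also have "\<dots> = (\<Sum>w | w \<in> words D (m + n) \<and> P (take m w) \<and> Q (drop m w). f w)"
    by (rule sum.reindex_bij_witness[of _ "\<lambda>w. (take m w, drop m w)" "\<lambda>(I, J). I @ J"])
      (auto simp: words_append take_words drop_words, auto simp: words_def)
  finally show ?thesis by simp
qed

lemma sum_words_add:
  "finite D \<Longrightarrow> (\<Sum>w\<in>words D (m + n). f w) = (\<Sum>I\<in>words D m. \<Sum>J\<in>words D n. f (I @ J))"
  using sum_words_split[where P = "\<lambda>_. True" and Q = "\<lambda>_. True"] by simp

lemma sum_words_1: "(\<Sum>w\<in>words D (Suc 0). f w) = (\<Sum>i\<in>D. f [i])"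
  by (rule sum.reindex_bij_witness[of _ "\<lambda>i. [i]" hd]) (auto simp: words_def length_Suc_conv)

text \<open>The critical exponent, the weights and the second moment estimate depend on the geometry only
  through the scales of the words, which are multiplicative up to the factor \<open>K\<close> and decay
  exponentially.\<close>

locale word_scale =
  fixes D :: "'i set" and scale :: "'i list \<Rightarrow> real" and a b K :: real
  assumes finite_D: "finite D" and card_D: "2 \<le> card D"
    and a_pos: "0 < a" and b_pos: "0 < b" and b_less_1: "b < 1"
    and scale_ge: "set I \<subseteq> D \<Longrightarrow> a ^ length I \<le> scale I"
    and scale_le: "set I \<subseteq> D \<Longrightarrow> scale I \<le> b ^ length I"
    and K_ge_1: "1 \<le> K"
    and scale_mult_le: "set I \<subseteq> D \<Longrightarrow> set J \<subseteq> D \<Longrightarrow> scale I * scale J \<le> K * scale (I @ J)"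
    and scale_append_le: "set I \<subseteq> D \<Longrightarrow> set J \<subseteq> D \<Longrightarrow> scale (I @ J) \<le> K * (scale I * scale J)"
begin

lemma scale_pos: "set I \<subseteq> D \<Longrightarrow> 0 < scale I"
  using scale_ge[of I] zero_less_power[OF a_pos, of "length I"] by linarith

lemma scale_Nil: "scale [] = 1"
  using scale_ge[of "[]"] scale_le[of "[]"] by simp

lemma a_less_1: "a < 1"
proof -
  obtain i where "i \<in> D" using card_D by (metis all_not_in_conv card.empty not_numeral_le_zero)
  then have "a \<le> b" using scale_ge[of "[i]"] scale_le[of "[i]"] by simp
  then show ?thesis using b_less_1 by simp
qed

lemma powr_append:
  assumes "set I \<subseteq> D" "set J \<subseteq> D" "0 \<le> t"
  shows "scale (I @ J) powr t \<le> K powr t * (scale I powr t * scale J powr t)"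
    "scale I powr t * scale J powr t \<le> K powr t * scale (I @ J) powr t"
proof -
  note pos = scale_pos[OF assms(1)] scale_pos[OF assms(2)] scale_pos[of "I @ J"]
  show "scale (I @ J) powr t \<le> K powr t * (scale I powr t * scale J powr t)"
    using powr_mono2[OF assms(3) _ scale_append_le[OF assms(1,2)]] pos K_ge_1 assms
    by (simp add: powr_mult)
  show "scale I powr t * scale J powr t \<le> K powr t * scale (I @ J) powr t"
    using powr_mono2[OF assms(3) _ scale_mult_le[OF assms(1,2)]] pos K_ge_1 assms
    by (simp add: powr_mult)
qed

text \<open>After the constant \<open>K powr t\<close> is absorbed on the one or the other side, the level sums
  become sub- or supermultiplicative, which \<open>level_sum_power\<close> iterates.\<close>

definition level_sum :: "real \<Rightarrow> nat \<Rightarrow> real" where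
  "level_sum t n = (\<Sum>I\<in>words D n. scale I powr t)"

lemma level_sum_nonneg: "0 \<le> level_sum t n"
  by (simp add: level_sum_def sum_nonneg)

lemma level_sum_add:
  assumes "0 \<le> t"
  shows "level_sum t (m + n) \<le> K powr t * (level_sum t m * level_sum t n)"
    "level_sum t m * level_sum t n \<le> K powr t * level_sum t (m + n)"
proof -
  have prod: "level_sum t m * level_sum t n
      = (\<Sum>I\<in>words D m. \<Sum>J\<in>words D n. scale I powr t * scale J powr t)"
    by (simp add: level_sum_def sum_product)
  have add: "level_sum t (m + n) = (\<Sum>I\<in>words D m. \<Sum>J\<in>words D n. scale (I @ J) powr t)"
    unfolding level_sum_def by (rule sum_words_add[OF finite_D])
  show "level_sum t (m + n) \<le> K powr t * (level_sum t m * level_sum t n)"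
    unfolding prod add sum_distrib_left
    by (intro sum_mono powr_append(1) assms) (auto simp: words_def)
  show "level_sum t m * level_sum t n \<le> K powr t * level_sum t (m + n)"
    unfolding prod add sum_distrib_left
    by (intro sum_mono powr_append(2) assms) (auto simp: words_def)
qed

lemma level_sum_power:
  assumes "0 \<le> t"
  shows "K powr t * level_sum t (m * Suc n) \<le> (K powr t * level_sum t m) ^ Suc n"
    "(level_sum t m / K powr t) ^ Suc n \<le> level_sum t (m * Suc n) / K powr t"
proof -
  have Kt: "K powr t > 0" using K_ge_1 by simp
  show "K powr t * level_sum t (m * Suc n) \<le> (K powr t * level_sum t m) ^ Suc n"
  proof (induction n)
    case (Suc n)
    have "K powr t * level_sum t (m * Suc (Suc n))
        \<le> K powr t * (K powr t * (level_sum t m * level_sum t (m * Suc n)))"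
      using level_sum_add(1)[OF assms, of m "m * Suc n"] Kt by (intro mult_left_mono) auto
    also have "\<dots> = (K powr t * level_sum t m) * (K powr t * level_sum t (m * Suc n))"
      by (simp only: mult_ac)
    also have "\<dots> \<le> (K powr t * level_sum t m) * (K powr t * level_sum t m) ^ Suc n"
      using Suc Kt level_sum_nonneg by (intro mult_left_mono) auto
    finally show ?case by simp
  qed simp
  show "(level_sum t m / K powr t) ^ Suc n \<le> level_sum t (m * Suc n) / K powr t"
  proof (induction n)
    case (Suc n)
    have "(level_sum t m / K powr t) ^ Suc (Suc n)
        \<le> (level_sum t m / K powr t) * (level_sum t (m * Suc n) / K powr t)"
      using Suc Kt level_sum_nonneg by (subst power_Suc) (intro mult_left_mono, auto)
    also have "\<dots> \<le> level_sum t (m * Suc (Suc n)) / K powr t"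
      using level_sum_add(2)[OF assms, of m "m * Suc n"] Kt by (simp add: field_simps)
    finally show ?case .
  qed simp
qed

text \<open>The exponents for which the level sums decay, and those for which they grow, form two
  disjoint sets that are open in the connected half-line, and neither is empty.  So some
  exponent belongs to neither.\<close>

lemma critical_exponent:
  obtains s where "0 < s" "\<And>n. 1 \<le> K powr s * level_sum s n" "\<And>n. level_sum s n \<le> K powr s"
proof -
  define A where "A = {t. \<exists>n. 0 < n \<and> K powr t * level_sum t n < 1}"
  define B where "B = {t. \<exists>n. 0 < n \<and> 1 < level_sum t n / K powr t}"
  have cont: "continuous_on UNIV (\<lambda>t. level_sum t n)" "continuous_on UNIV (\<lambda>t. K powr t)" for n
    unfolding level_sum_def using scale_pos K_ge_1
    by (auto intro!: continuous_intros simp: words_def) force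
  have "open A"
  proof -
    have "A = (\<Union>n\<in>{0<..}. {t. K powr t * level_sum t n < 1})" by (auto simp: A_def)
    then show ?thesis by (auto intro!: open_Collect_less continuous_intros cont)
  qed
  have "open B"
  proof -
    have "B = (\<Union>n\<in>{0<..}. {t. 1 < level_sum t n / K powr t})" by (auto simp: B_def)
    then show ?thesis using K_ge_1 by (auto intro!: open_Collect_less continuous_intros cont)
  qed
  have "A \<inter> B \<inter> {0..} = {}"
  proof (rule ccontr)
    assume "A \<inter> B \<inter> {0..} \<noteq> {}"
    then obtain t m n where t: "0 \<le> t" and m: "0 < m" "K powr t * level_sum t m < 1"
      and n: "0 < n" "1 < level_sum t n / K powr t" by (auto simp: A_def B_def)
    obtain m' n' where mn: "m = Suc m'" "n = Suc n'" using m n by (metis gr0_implies_Suc)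
    have Kt: "1 \<le> K powr t" using K_ge_1 t by (simp add: ge_one_powr_ge_zero)
    have "K powr t * level_sum t (m * n) \<le> (K powr t * level_sum t m) ^ n"
      using level_sum_power(1)[OF t, of m n'] mn by simp
    also have "\<dots> < 1" 
    proof -
      let ?x = "K powr t * level_sum t m"
      have x: "0 \<le> ?x" "?x < 1" using m level_sum_nonneg Kt by auto
      then have "?x ^ Suc n' \<le> ?x * 1"
        unfolding power_Suc by (intro mult_left_mono power_le_one) auto
      then show ?thesis using x mn by simp
    qed
    finally have 1: "K powr t * level_sum t (m * n) < 1" .
    have "1 < (level_sum t n / K powr t) ^ m" using n m by (simp add: one_less_power)
    also have "\<dots> \<le> level_sum t (n * m) / K powr t"
      using level_sum_power(2)[OF t, of n m'] mn by simp
    finally have "1 < level_sum t (m * n) / K powr t" by (simp add: mult.commute)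
    moreover have Kt0: "0 < K powr t" using Kt by linarith
    ultimately have "K powr t < level_sum t (m * n)" by (simp add: pos_less_divide_eq)
    then have "K powr t * K powr t < K powr t * level_sum t (m * n)"
      using Kt0 by (rule mult_strict_left_mono)
    then have "K powr t * K powr t < 1" using 1 by simp
    moreover have "1 * 1 \<le> K powr t * K powr t" using Kt by (intro mult_mono) auto
    ultimately show False by simp
  qed
  moreover have zero: "0 \<in> B"
  proof -
    have "level_sum 0 1 = real (card D)"
    proof -
      have "scale I powr 0 = 1" if "I \<in> words D 1" for I using scale_pos[of I] that by (auto simp: words_def)
      then show ?thesis by (simp add: level_sum_def card_words[OF finite_D])
    qed
    then have "1 < level_sum 0 1 / K powr 0" using card_D K_ge_1 by simp
    then show ?thesis unfolding B_def by (intro CollectI exI[of _ 1]) simp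
  qed
  moreover have "A \<inter> {0..} \<noteq> {}"
  proof -
    obtain n where n: "b ^ n < 1 / K"
      using real_arch_pow_inv[of "1 / K" b] b_less_1 K_ge_1 by auto
    have n0: "0 < n" using n K_ge_1 by (cases n) auto
    define q where "q = K * b ^ n"
    have q: "0 < q" "q < 1" using n K_ge_1 b_pos by (auto simp: q_def field_simps)
    obtain j where j: "q ^ j < 1 / card D ^ n"
      using real_arch_pow_inv[of "1 / card D ^ n" q] q card_D by auto
    have "K powr j * level_sum j n \<le> K powr j * (\<Sum>I\<in>words D n. (b ^ n) powr j)"
      unfolding level_sum_def
    proof (intro mult_left_mono sum_mono powr_mono2)
      fix I assume "I \<in> words D n"
      then show "0 \<le> scale I" "scale I \<le> b ^ n"
        using scale_pos[of I] scale_le[of I] by (auto simp: words_def)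
    qed auto
    also have "\<dots> = card D ^ n * q ^ j"
      using K_ge_1 b_pos by (simp add: card_words[OF finite_D] q_def powr_realpow power_mult_distrib)
    also have "\<dots> < 1" using j card_D by (simp add: field_simps)
    finally have "real j \<in> A" using n0 by (auto simp: A_def)
    then show ?thesis by auto
  qed
  ultimately have "\<not> {0..} \<subseteq> A \<union> B"
    using connectedD[OF connected_Ici[of "0::real"] \<open>open A\<close> \<open>open B\<close>] by auto
  then obtain s where s: "0 \<le> s" "s \<notin> A" "s \<notin> B" by auto
  have "s \<noteq> 0" using s zero by auto
  have Ks: "1 \<le> K powr s" using K_ge_1 s by (simp add: ge_one_powr_ge_zero)
  have zero_level: "level_sum s 0 = 1" by (simp add: level_sum_def words_0 scale_Nil)
  show ?thesis
  proof (rule that[of s])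
    show "1 \<le> K powr s * level_sum s n" for n
    proof (cases "n = 0")
      case False
      then have "\<not> K powr s * level_sum s n < 1" using s(2) unfolding A_def by blast
      then show ?thesis by simp
    qed (use Ks zero_level in simp)
    show "level_sum s n \<le> K powr s" for n
    proof (cases "n = 0")
      case False
      then have "\<not> 1 < level_sum s n / K powr s" using s(3) unfolding B_def by blast
      moreover have "0 < K powr s" using Ks by linarith
      ultimately show ?thesis by (simp add: pos_less_divide_eq not_less)
    qed (use Ks zero_level in simp)
  qed (use s \<open>s \<noteq> 0\<close> in auto)
qed

text \<open>At the critical exponent there are weights that are exactly additive and comparable with
  the powers of the scales: the masses of the cylinders for a conformal measure.  For each \<open>q\<close>
  the sums over the descendants of level \<open>q\<close> have these properties on the words of length at
  most \<open>q\<close>, and compactness of a product of intervals yields weights that have them on all words.\<close>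

lemma additive_weights:
  assumes s: "0 < s" and Z: "\<And>n. 1 \<le> K powr s * level_sum s n" "\<And>n. level_sum s n \<le> K powr s"
  obtains m C where "1 \<le> C"
    "\<And>I. set I \<subseteq> D \<Longrightarrow> m I = (\<Sum>i\<in>D. m (I @ [i]))"
    "\<And>I. set I \<subseteq> D \<Longrightarrow> scale I powr s \<le> C * m I"
    "\<And>I. set I \<subseteq> D \<Longrightarrow> m I \<le> C * scale I powr s"
proof -
  have Ks: "1 \<le> K powr s" using K_ge_1 s by (simp add: ge_one_powr_ge_zero)
  define C where "C = K powr s * K powr s"
  have C: "1 \<le> C" using mult_mono[OF Ks Ks] Ks by (simp add: C_def)
  define box where "box = (\<Pi>\<^sub>E I\<in>(UNIV :: 'i list set). {0..C * scale I powr s})"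
  have "compactin (product_topology (\<lambda>_. euclidean) UNIV) box"
    unfolding box_def by (simp add: compactin_PiE)
  then have box: "compact box" by (simp add: euclidean_product_topology)
  \<comment> \<open>The strict inequality \<open>length I < q\<close> leaves room for the sum over the one-letter extensions.\<close>
  define good where "good q = {m. \<forall>I. set I \<subseteq> D \<longrightarrow> length I < q \<longrightarrow>
      m I = (\<Sum>i\<in>D. m (I @ [i])) \<and> scale I powr s \<le> C * m I}" for q
  define approx where "approx q I = (if set I \<subseteq> D \<and> length I \<le> q
      then \<Sum>J\<in>words D (q - length I). scale (I @ J) powr s else 0)" for q I
  have approx: "approx q \<in> box \<inter> good q" for q
  proof -
    have le: "approx q I \<le> C * scale I powr s" for I
    proof (cases "set I \<subseteq> D \<and> length I \<le> q")
      case True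
      let ?n = "q - length I"
      have "approx q I \<le> (\<Sum>J\<in>words D ?n. K powr s * (scale I powr s * scale J powr s))"
        using True s unfolding approx_def by (auto intro!: sum_mono powr_append simp: words_def)
      also have "\<dots> = K powr s * scale I powr s * level_sum s ?n"
        by (simp add: level_sum_def sum_distrib_left mult.assoc)
      also have "\<dots> \<le> K powr s * scale I powr s * K powr s"
        using Z(2) by (intro mult_left_mono) auto
      finally show ?thesis by (simp add: C_def mult_ac)
    qed (use C in \<open>auto simp: approx_def\<close>)
    have ge: "scale I powr s \<le> C * approx q I" if I: "set I \<subseteq> D" "length I \<le> q" for I
    proof -
      let ?n = "q - length I"
      have "scale I powr s * level_sum s ?n \<le> (\<Sum>J\<in>words D ?n. K powr s * scale (I @ J) powr s)"
        unfolding level_sum_def sum_distrib_left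
        using I s by (auto intro!: sum_mono powr_append simp: words_def)
      also have "\<dots> = K powr s * approx q I"
        using I by (simp add: approx_def sum_distrib_left)
      finally have "K powr s * (scale I powr s * level_sum s ?n) \<le> K powr s * (K powr s * approx q I)"
        using Ks by (intro mult_left_mono) auto
      moreover have "scale I powr s * 1 \<le> scale I powr s * (K powr s * level_sum s ?n)"
        using Z(1) by (intro mult_left_mono) auto
      ultimately show ?thesis by (simp add: C_def mult_ac)
    qed
    have additive: "approx q I = (\<Sum>i\<in>D. approx q (I @ [i]))" if I: "set I \<subseteq> D" "length I < q" for I
    proof -
      obtain n where n: "q - length I = Suc 0 + n" using I by (metis Suc_diff_Suc add_Suc plus_nat.add_0)
      have "approx q I = (\<Sum>J\<in>words D (Suc 0 + n). scale (I @ J) powr s)"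
        using I n by (simp add: approx_def)
      also have "\<dots> = (\<Sum>i\<in>D. \<Sum>J\<in>words D n. scale (I @ [i] @ J) powr s)"
        by (subst sum_words_add[OF finite_D]) (simp add: sum_words_1)
      also have "\<dots> = (\<Sum>i\<in>D. approx q (I @ [i]))"
      proof (rule sum.cong)
        fix i assume "i \<in> D"
        moreover have "q - length (I @ [i]) = n" "length (I @ [i]) \<le> q" using n I by auto
        ultimately show "(\<Sum>J\<in>words D n. scale (I @ [i] @ J) powr s) = approx q (I @ [i])"
          using I by (simp add: approx_def)
      qed simp
      finally show ?thesis .
    qed
    have "0 \<le> approx q I" for I by (simp add: approx_def sum_nonneg)
    then have "approx q \<in> box" using le by (auto simp: box_def)
    moreover have "approx q \<in> good q"
      unfolding good_def by (blast intro: additive ge less_imp_le)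
    ultimately show ?thesis by blast
  qed
  have closed: "closed (good q)" for q
    unfolding good_def
    by (intro closed_Collect_all closed_Collect_imp closed_Collect_conj open_Collect_const
        closed_Collect_eq closed_Collect_le continuous_intros continuous_on_product_coordinates)
  have "box \<inter> (\<Inter>q. good q) \<noteq> {}"
  proof (rule compact_imp_fip_image[OF box closed])
    fix S :: "nat set" assume "finite S"
    have "approx (Max (insert 0 S)) \<in> good q" if "q \<in> S" for q
    proof -
      have "q \<le> Max (insert 0 S)" using that \<open>finite S\<close> by simp
      then have "good (Max (insert 0 S)) \<subseteq> good q" unfolding good_def by fastforce
      then show ?thesis using approx by blast
    qed
    then show "box \<inter> (\<Inter>q\<in>S. good q) \<noteq> {}"
      using approx[of "Max (insert 0 S)"] by blast
  qed
  then obtain m where m: "m \<in> box" "\<And>q. m \<in> good q" by blast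
  show ?thesis
  proof (rule that[OF C])
    fix I assume "set I \<subseteq> D"
    then show "m I = (\<Sum>i\<in>D. m (I @ [i]))" "scale I powr s \<le> C * m I"
      using m(2)[of "Suc (length I)"] by (auto simp: good_def)
    show "m I \<le> C * scale I powr s" using m(1) by (auto simp: box_def PiE_iff)
  qed
qed

text \<open>The words at which the scale first drops to \<open>r\<close> (a Moran cut).  For \<open>r \<ge> 1\<close> this is the empty word.\<close>

definition cut :: "real \<Rightarrow> 'i list set" where
  "cut r = {J. set J \<subseteq> D \<and> scale J \<le> r \<and> (\<forall>I. strict_prefix I J \<longrightarrow> r < scale I)}"

lemma cut_prefix_exists:
  assumes "set I \<subseteq> D" "scale I \<le> r"
  obtains J where "J \<in> cut r" "prefix J I"
proof -
  define k where "k = (LEAST k. scale (take k I) \<le> r)"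
  have k: "scale (take k I) \<le> r"
    unfolding k_def by (rule LeastI[of _ "length I"]) (use assms in simp)
  show ?thesis
  proof (rule that[of "take k I"])
    show "take k I \<in> cut r"
      unfolding cut_def
    proof (intro CollectI conjI allI impI k)
      show "set (take k I) \<subseteq> D" using assms set_take_subset[of k I] by auto
      fix J assume J: "strict_prefix J (take k I)"
      have "length J < length (take k I)" using J by (rule prefix_length_less)
      moreover have "prefix J I"
        using J take_is_prefix[of k I] by (meson prefix_order.less_imp_le prefix_order.trans)
      then have "J = take (length J) I" by (auto simp: prefix_def)
      ultimately have "length J < k" "J = take (length J) I" by auto
      then show "r < scale J" using not_less_Least[of "length J"] by (metis k_def not_le)
    qed
  qed (rule take_is_prefix)
qed

text \<open>Removing the last letter of a word in the cut gives a scale above \<open>r\<close>, and one letter costs at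
  most the factor \<open>a / K\<close>.\<close>

lemma cut_scale_ge:
  assumes "J \<in> cut r" "0 < r" "r \<le> 1"
  shows "a / K * r \<le> scale J"
proof (cases J rule: rev_cases)
  case Nil
  have "a / K \<le> 1" using a_less_1 K_ge_1 by simp
  then have "a / K * r \<le> 1 * 1" using assms a_pos K_ge_1 by (intro mult_mono) auto
  then show ?thesis using Nil scale_Nil by simp
next
  case (snoc J' i)
  have "strict_prefix J' J" using snoc by (simp add: strict_prefix_def)
  then have J: "set J' \<subseteq> D" "i \<in> D" "r < scale J'" using assms(1) snoc by (auto simp: cut_def)
  have "a * r \<le> scale [i] * scale J'"
    using scale_ge[of "[i]"] J assms a_pos by (intro mult_mono) auto
  also have "\<dots> \<le> K * scale J" using scale_mult_le[of J' "[i]"] J snoc by (simp add: mult.commute)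
  finally show ?thesis using K_ge_1 by (simp add: field_simps)
qed

lemma cut_parallel:
  assumes "I \<in> cut r" "J \<in> cut r" "I \<noteq> J"
  shows "I \<parallel> J"
proof (rule parallelI)
  have no: "\<not> prefix I' J'" if "I' \<in> cut r" "J' \<in> cut r" "I' \<noteq> J'" for I' J'
  proof
    assume "prefix I' J'"
    then have "strict_prefix I' J'" using that by (simp add: strict_prefix_def)
    then have "r < scale I'" using that by (auto simp: cut_def)
    then show False using that by (simp add: cut_def)
  qed
  show "\<not> prefix I J" "\<not> prefix J I"
    using no assms by auto
qed

end

section \<open>The shrinking target in the space of words\<close>

locale word_weights = word_scale +
  fixes s C :: real and m :: "'a list \<Rightarrow> real"
  assumes s_pos: "0 < s" and C_ge_1: "1 \<le> C"
    and m_additive: "set I \<subseteq> D \<Longrightarrow> m I = (\<Sum>i\<in>D. m (I @ [i]))"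
    and scale_le_m: "set I \<subseteq> D \<Longrightarrow> scale I powr s \<le> C * m I"
    and m_le_scale: "set I \<subseteq> D \<Longrightarrow> m I \<le> C * scale I powr s"
begin

lemma m_pos: "set I \<subseteq> D \<Longrightarrow> 0 < m I"
proof -
  assume I: "set I \<subseteq> D"
  have "0 < C * m I" using scale_le_m[OF I] scale_pos[OF I] by (smt (verit) powr_gt_zero)
  then show ?thesis using C_ge_1 by (simp add: zero_less_mult_iff)
qed

lemma m_nonneg: "set I \<subseteq> D \<Longrightarrow> 0 \<le> m I"
  using m_pos by (rule less_imp_le)

lemma m_eq_sum_extensions: "set I \<subseteq> D \<Longrightarrow> m I = (\<Sum>J\<in>words D n. m (I @ J))"
proof (induction n)
  case (Suc n)
  have "(\<Sum>J\<in>words D (Suc n). m (I @ J)) = (\<Sum>J\<in>words D n. \<Sum>i\<in>D. m ((I @ J) @ [i]))"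
    using sum_words_add[OF finite_D, where m = n and n = "Suc 0" and f = "\<lambda>w. m (I @ w)"]
    by (simp add: sum_words_1)
  also have "\<dots> = (\<Sum>J\<in>words D n. m (I @ J))"
    using Suc.prems by (intro sum.cong refl m_additive[symmetric]) (auto simp: words_def)
  finally show ?case using Suc by simp
qed (simp add: words_0)

text \<open>The weights inherit quasi-multiplicativity from the scales, with this constant.\<close>

definition B :: real where "B = C * C * C * K powr s"

lemma B_ge_1: "1 \<le> B"
proof -
  have "1 \<le> K powr s" using K_ge_1 s_pos by (simp add: ge_one_powr_ge_zero)
  moreover have "1 * 1 * 1 \<le> C * C * C" using C_ge_1 by (intro mult_mono) auto
  ultimately have "1 * 1 \<le> C * C * C * K powr s" by (intro mult_mono) auto
  then show ?thesis by (simp add: B_def)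
qed

lemma m_append:
  assumes I: "set I \<subseteq> D" and J: "set J \<subseteq> D"
  shows "m (I @ J) \<le> B * (m I * m J)" "m I * m J \<le> B * m (I @ J)"
proof -
  have IJ: "set (I @ J) \<subseteq> D" using I J by auto
  have K0: "0 \<le> K powr s" by simp
  have C0: "0 \<le> C" using C_ge_1 by simp
  have "m (I @ J) \<le> C * (K powr s * (scale I powr s * scale J powr s))"
    using m_le_scale[OF IJ] mult_left_mono[OF powr_append(1)[OF I J, of s] C0] s_pos by auto
  also have "\<dots> \<le> C * (K powr s * ((C * m I) * (C * m J)))"
    using scale_le_m[OF I] scale_le_m[OF J] C0 m_pos[OF I]
    by (intro mult_left_mono mult_mono) auto
  finally show "m (I @ J) \<le> B * (m I * m J)" by (simp add: B_def mult_ac)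
  have "m I * m J \<le> (C * scale I powr s) * (C * scale J powr s)"
    using m_le_scale[OF I] m_le_scale[OF J] m_pos[OF I] m_pos[OF J] C0 by (intro mult_mono) auto
  also have "\<dots> = C * C * (scale I powr s * scale J powr s)" by (simp add: mult_ac)
  also have "\<dots> \<le> C * C * (K powr s * (C * m (I @ J)))"
  proof (rule mult_left_mono)
    have "scale I powr s * scale J powr s \<le> K powr s * scale (I @ J) powr s"
      using powr_append(2)[OF I J, of s] s_pos by simp
    also have "\<dots> \<le> K powr s * (C * m (I @ J))"
      using scale_le_m[OF IJ] by (intro mult_left_mono) auto
    finally show "scale I powr s * scale J powr s \<le> K powr s * (C * m (I @ J))" .
  qed (use C0 in auto)
  finally show "m I * m J \<le> B * m (I @ J)" by (simp add: B_def mult_ac)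
qed

definition mass :: "'a list set \<Rightarrow> real" where "mass A = sum m A"

lemma mass_nonneg: "A \<subseteq> words D n \<Longrightarrow> 0 \<le> mass A"
  unfolding mass_def by (intro sum_nonneg) (auto simp: words_def intro!: m_nonneg)

lemma mass_mono: "A \<subseteq> A' \<Longrightarrow> A' \<subseteq> words D n \<Longrightarrow> mass A \<le> mass A'"
  unfolding mass_def
  by (intro sum_mono2 finite_subset[OF _ finite_words[OF finite_D]])
    (auto simp: words_def intro!: m_nonneg)

lemma mass_take:
  assumes "A \<subseteq> words D k" "k \<le> n"
  shows "mass {w \<in> words D n. take k w \<in> A} = mass A"
proof -
  obtain j where n: "n = k + j" using assms(2) le_Suc_ex by blast
  have "mass {w \<in> words D n. take k w \<in> A} = (\<Sum>I | I \<in> words D k \<and> I \<in> A. \<Sum>J\<in>words D j. m (I @ J))"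
    using sum_words_split[OF finite_D, where m = k and n = j and P = "\<lambda>I. I \<in> A" and Q = "\<lambda>_. True"]
    by (simp add: mass_def n)
  also have "\<dots> = (\<Sum>I | I \<in> words D k \<and> I \<in> A. m I)"
    by (intro sum.cong refl m_eq_sum_extensions[symmetric]) (auto simp: words_def)
  also have "{I. I \<in> words D k \<and> I \<in> A} = A" using assms(1) by auto
  finally show ?thesis by (simp add: mass_def)
qed

text \<open>If \<open>w\<close> is read as an orbit of the shift, then a hit is a visit to the cylinder of \<open>P\<close> at the
  time \<open>n\<close>.\<close>

definition hit :: "'a list \<Rightarrow> nat \<Rightarrow> 'a list \<Rightarrow> bool" where
  "hit P n w \<longleftrightarrow> take (length P) (drop n w) = P"

text \<open>Occurrences of a word beyond a position are, up to a factor \<open>B\<close>, independent of what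
  happens before this position.\<close>

lemma mass_hit:
  assumes A: "A \<subseteq> words D k" and kn: "k \<le> n" and P: "set P \<subseteq> D" and L: "n + length P \<le> L"
  shows "mass {w \<in> words D L. take k w \<in> A \<and> hit P n w} \<le> B * (mass A * m P)"
    "mass A * m P \<le> B * mass {w \<in> words D L. take k w \<in> A \<and> hit P n w}"
    "mass {w \<in> words D L. take k w \<in> A \<and> hit P n w}
      = mass {w \<in> words D (n + length P). take k w \<in> A \<and> drop n w = P}"
proof -
  let ?A = "{w \<in> words D (n + length P). take k w \<in> A \<and> drop n w = P}"
  have sets: "{w \<in> words D L. take k w \<in> A \<and> hit P n w} = {w \<in> words D L. take (n + length P) w \<in> ?A}"
  proof -
    have "take (n + length P) w \<in> words D (n + length P)" if "w \<in> words D L" for w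
      using that L by (auto simp: words_def dest: in_set_takeD)
    then show ?thesis using kn by (auto simp: hit_def drop_take min_def)
  qed
  have "mass {w \<in> words D L. take (n + length P) w \<in> ?A} = mass ?A"
    by (rule mass_take[OF _ L]) blast
  then show eq: "mass {w \<in> words D L. take k w \<in> A \<and> hit P n w} = mass ?A"
    unfolding sets .
  let ?A' = "{w \<in> words D n. take k w \<in> A}"
  have PD: "P \<in> words D (length P)" using P by (simp add: words_def)
  have "mass ?A = (\<Sum>w | w \<in> words D (n + length P) \<and> take k (take n w) \<in> A \<and> drop n w = P. m w)"
    using kn by (simp add: mass_def min_def)
  also have "\<dots> = (\<Sum>I | I \<in> words D n \<and> take k I \<in> A. \<Sum>J | J \<in> words D (length P) \<and> J = P. m (I @ J))"
    by (rule sum_words_split[OF finite_D, where P = "\<lambda>w. take k w \<in> A" and Q = "\<lambda>J. J = P"])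
  also have "\<dots> = (\<Sum>I\<in>?A'. m (I @ P))"
  proof -
    have "{J. J \<in> words D (length P) \<and> J = P} = {P}" using PD by auto
    then show ?thesis by simp
  qed
  finally have sum: "mass ?A = (\<Sum>I\<in>?A'. m (I @ P))" .
  have A': "mass A * m P = (\<Sum>I\<in>?A'. m I * m P)"
    using mass_take[OF A kn] by (simp add: mass_def flip: sum_distrib_right)
  show "mass {w \<in> words D L. take k w \<in> A \<and> hit P n w} \<le> B * (mass A * m P)"
    unfolding eq sum A' sum_distrib_left using P by (intro sum_mono m_append(1)) (auto simp: words_def)
  show "mass A * m P \<le> B * mass {w \<in> words D L. take k w \<in> A \<and> hit P n w}"
    unfolding eq sum A' sum_distrib_left using P by (intro sum_mono m_append(2)) (auto simp: words_def)
qed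

text \<open>The words with the first occurrence form an event that is determined by the first
  \<open>n + length P\<close> letters, so the one-occurrence bound applies to it.\<close>

lemma mass_hit_twice:
  assumes A: "A \<subseteq> words D k" and kn: "k \<le> n" and P: "set P \<subseteq> D" and P': "set P' \<subseteq> D"
    and n': "n + length P \<le> n'" and L: "n' + length P' \<le> L"
  shows "mass {w \<in> words D L. take k w \<in> A \<and> hit P n w \<and> hit P' n' w} \<le> B * B * (mass A * m P * m P')"
proof -
  let ?A = "{w \<in> words D (n + length P). take k w \<in> A \<and> drop n w = P}"
  have "{w \<in> words D L. take k w \<in> A \<and> hit P n w \<and> hit P' n' w}
      = {w \<in> words D L. take (n + length P) w \<in> ?A \<and> hit P' n' w}"
  proof -
    have "take (n + length P) w \<in> words D (n + length P)" if "w \<in> words D L" for w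
      using that L n' by (auto simp: words_def dest: in_set_takeD)
    then show ?thesis using kn by (auto simp: hit_def drop_take min_def)
  qed
  then have "mass {w \<in> words D L. take k w \<in> A \<and> hit P n w \<and> hit P' n' w} \<le> B * (mass ?A * m P')"
    using mass_hit(1)[of ?A "n + length P" n' P' L] n' P' L by simp
  also have "mass ?A \<le> B * (mass A * m P)"
    using mass_hit(1,3)[OF A kn P, of "n + length P"] by simp
  then have "B * (mass ?A * m P') \<le> B * (B * (mass A * m P) * m P')"
    using B_ge_1 m_pos[OF P'] by (intro mult_left_mono mult_right_mono) auto
  finally show ?thesis by (simp add: mult_ac)
qed

text \<open>The second moment method.  Two occurrences that do not overlap are quasi-independent.
  The occurrence at \<open>n\<close> overlaps with at most \<open>length (P n)\<close> positions from \<open>n\<close> on, and for these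
  the bound by the mass of the occurrence at \<open>n\<close> is enough.  So the number of occurrences has
  a second moment comparable with the square of its mean, and by the Cauchy--Schwarz inequality
  some occurrence takes place on a fixed proportion of every cylinder.\<close>

lemma mass_some_hit_ge:
  fixes P :: "nat \<Rightarrow> 'a list"
  assumes T: "finite T" "\<And>n. n \<in> T \<Longrightarrow> k \<le> n" "\<And>n. n \<in> T \<Longrightarrow> set (P n) \<subseteq> D"
    and L: "\<And>n. n \<in> T \<Longrightarrow> n + length (P n) \<le> L" and I: "I \<in> words D k"
    and S: "S = (\<Sum>n\<in>T. m (P n))" "0 < S"
    and overlap: "(\<Sum>n\<in>T. length (P n) * m (P n)) \<le> G * S\<^sup>2" and kL: "k \<le> L"
  shows "m I \<le> 2 * B\<^sup>2 * (B\<^sup>2 + B * G) * mass {w \<in> words D L. take k w = I \<and> (\<exists>n\<in>T. hit (P n) n w)}"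
proof -
  let ?\<Omega> = "{w \<in> words D L. take k w = I}"
  let ?U = "{w \<in> words D L. take k w = I \<and> (\<exists>n\<in>T. hit (P n) n w)}"
  define E where "E n = {w \<in> words D L. take k w = I \<and> hit (P n) n w}" for n
  have fin: "finite ?\<Omega>" "finite ?U" using finite_words[OF finite_D] by auto
  have mI: "0 < m I" using I m_pos by (auto simp: words_def)
  have A: "{I} \<subseteq> words D k" using I by simp
  have massI: "mass {I} = m I" by (simp add: mass_def)
  \<comment> \<open>the number of occurrences in \<open>w\<close>\<close>
  define f where "f w = (\<Sum>n\<in>T. of_bool (hit (P n) n w) :: real)" for w
  have w_pos: "0 \<le> m w" if "w \<in> words D L" for w using that m_pos[of w] by (auto simp: words_def)
  have f0: "f w = 0" if "\<not> (\<exists>n\<in>T. hit (P n) n w)" for w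
    using that by (auto simp: f_def intro!: sum.neutral)
  have E: "mass (E n) = (\<Sum>w\<in>?\<Omega>. m w * of_bool (hit (P n) n w))" for n
  proof -
    have "(\<Sum>w\<in>?\<Omega>. m w * of_bool (hit (P n) n w)) = (\<Sum>w\<in>?\<Omega>. if hit (P n) n w then m w else 0)"
      by (intro sum.cong) auto
    also have "\<dots> = (\<Sum>w | w \<in> ?\<Omega> \<and> hit (P n) n w. m w)"
      by (rule sum.inter_filter[OF fin(1), symmetric])
    also have "{w. w \<in> ?\<Omega> \<and> hit (P n) n w} = E n" by (auto simp: E_def)
    finally show ?thesis by (simp add: mass_def)
  qed
  have EE: "mass (E n \<inter> E n') = (\<Sum>w\<in>?\<Omega>. m w * (of_bool (hit (P n) n w) * of_bool (hit (P n') n' w)))" for n n'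
  proof -
    have "(\<Sum>w\<in>?\<Omega>. m w * (of_bool (hit (P n) n w) * of_bool (hit (P n') n' w)))
        = (\<Sum>w\<in>?\<Omega>. if hit (P n) n w \<and> hit (P n') n' w then m w else 0)"
      by (intro sum.cong) auto
    also have "\<dots> = (\<Sum>w | w \<in> ?\<Omega> \<and> (hit (P n) n w \<and> hit (P n') n' w). m w)"
      by (rule sum.inter_filter[OF fin(1), symmetric])
    also have "{w. w \<in> ?\<Omega> \<and> (hit (P n) n w \<and> hit (P n') n' w)} = E n \<inter> E n'" by (auto simp: E_def)
    finally show ?thesis by (simp add: mass_def)
  qed
  have first: "(\<Sum>w\<in>?\<Omega>. m w * f w) = (\<Sum>n\<in>T. mass (E n))"
    unfolding E f_def sum_distrib_left by (rule sum.swap)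
  have second: "(\<Sum>w\<in>?\<Omega>. m w * (f w)\<^sup>2) = (\<Sum>n\<in>T. \<Sum>n'\<in>T. mass (E n \<inter> E n'))"
  proof -
    have "(\<Sum>w\<in>?\<Omega>. m w * (f w)\<^sup>2)
        = (\<Sum>w\<in>?\<Omega>. \<Sum>n\<in>T. \<Sum>n'\<in>T. m w * (of_bool (hit (P n) n w) * of_bool (hit (P n') n' w)))"
      unfolding f_def power2_eq_square sum_product by (simp only: sum_distrib_left)
    also have "\<dots> = (\<Sum>n\<in>T. \<Sum>w\<in>?\<Omega>. \<Sum>n'\<in>T. m w * (of_bool (hit (P n) n w) * of_bool (hit (P n') n' w)))"
      by (rule sum.swap)
    also have "\<dots> = (\<Sum>n\<in>T. \<Sum>n'\<in>T. mass (E n \<inter> E n'))"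
      unfolding EE by (intro sum.cong refl sum.swap)
    finally show ?thesis .
  qed
  have lower: "m I * S \<le> B * (\<Sum>w\<in>?\<Omega>. m w * f w)"
  proof -
    have "m I * S = (\<Sum>n\<in>T. m I * m (P n))" by (simp add: S sum_distrib_left)
    also have "\<dots> \<le> (\<Sum>n\<in>T. B * mass (E n))"
      using mass_hit(2)[OF A] T L massI by (intro sum_mono) (auto simp: E_def)
    finally show ?thesis by (simp add: first sum_distrib_left)
  qed
  have upper: "(\<Sum>w\<in>?\<Omega>. m w * (f w)\<^sup>2) \<le> 2 * (B\<^sup>2 + B * G) * m I * S\<^sup>2"
  proof -
    have pair: "mass (E n \<inter> E n') \<le> B * B * (m I * m (P n) * m (P n'))
        + (if n' < n + length (P n) then B * (m I * m (P n)) else 0)"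
      if n: "n \<in> T" "n' \<in> T" "n \<le> n'" for n n'
    proof (cases "n' < n + length (P n)")
      case True
      have "mass (E n \<inter> E n') \<le> mass (E n)" by (rule mass_mono[of _ _ L]) (auto simp: E_def)
      also have "\<dots> \<le> B * (m I * m (P n))"
        using mass_hit(1)[OF A T(2)[OF n(1)] T(3)[OF n(1)] L[OF n(1)]] massI by (simp add: E_def)
      finally show ?thesis
        using True B_ge_1 mI m_pos[OF T(3)[OF n(1)]] m_pos[OF T(3)[OF n(2)]]
        by (simp add: add_increasing)
    next
      case False
      have "E n \<inter> E n' = {w \<in> words D L. take k w \<in> {I} \<and> hit (P n) n w \<and> hit (P n') n' w}"
        by (auto simp: E_def)
      then show ?thesis
        using mass_hit_twice[OF A T(2)[OF n(1)] T(3)[OF n(1)] T(3)[OF n(2)] _ L[OF n(2)]] False massI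
        by simp
    qed
    have half: "(\<Sum>n\<in>T. \<Sum>n'\<in>T. if n \<le> n' then mass (E n \<inter> E n') else 0) \<le> (B\<^sup>2 + B * G) * m I * S\<^sup>2"
    proof -
      have "(\<Sum>n'\<in>T. if n \<le> n' then mass (E n \<inter> E n') else 0)
          \<le> B * B * (m I * m (P n) * S) + B * m I * (length (P n) * m (P n))" if n: "n \<in> T" for n
      proof -
        have p: "0 < m (P n')" if "n' \<in> T" for n' using m_pos[OF T(3)[OF that]] .
        have "(\<Sum>n'\<in>T. if n \<le> n' then mass (E n \<inter> E n') else 0)
          \<le> (\<Sum>n'\<in>T. B * B * (m I * m (P n) * m (P n'))
               + (if n' \<in> {n..<n + length (P n)} then B * (m I * m (P n)) else 0))"
          using pair[OF n] p[OF n] p B_ge_1 mI by (intro sum_mono) (auto simp: less_imp_le)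
        also have "\<dots> = B * B * (m I * m (P n) * S)
            + (\<Sum>n'\<in>T \<inter> {n..<n + length (P n)}. B * (m I * m (P n)))"
          unfolding sum.inter_restrict[OF T(1)] by (simp only: sum.distrib S(1) sum_distrib_left)
        also have "(\<Sum>n'\<in>T \<inter> {n..<n + length (P n)}. B * (m I * m (P n)))
            \<le> (\<Sum>n'\<in>{n..<n + length (P n)}. B * (m I * m (P n)))"
          using B_ge_1 mI p[OF n] by (intro sum_mono2) auto
        finally show ?thesis by (simp add: mult_ac)
      qed
      then have "(\<Sum>n\<in>T. \<Sum>n'\<in>T. if n \<le> n' then mass (E n \<inter> E n') else 0)
          \<le> (\<Sum>n\<in>T. B * B * (m I * m (P n) * S) + B * m I * (length (P n) * m (P n)))"
        by (rule sum_mono)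
      also have "\<dots> = B * B * m I * S * S + B * m I * (\<Sum>n\<in>T. length (P n) * m (P n))"
        by (simp add: sum.distrib S(1) sum_distrib_left sum_distrib_right mult_ac)
      also have "\<dots> \<le> B * B * m I * S * S + B * m I * (G * S\<^sup>2)"
        using overlap B_ge_1 mI by (intro add_left_mono mult_left_mono) auto
      also have "\<dots> = (B\<^sup>2 + B * G) * m I * S\<^sup>2" by (simp add: power2_eq_square algebra_simps)
      finally show ?thesis .
    qed
    have "(\<Sum>n\<in>T. \<Sum>n'\<in>T. mass (E n \<inter> E n'))
        \<le> (\<Sum>n\<in>T. \<Sum>n'\<in>T. (if n \<le> n' then mass (E n \<inter> E n') else 0) + (if n' \<le> n then mass (E n' \<inter> E n) else 0))"
    proof (intro sum_mono)
      fix n n'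
      have "0 \<le> mass (E n \<inter> E n')" by (rule mass_nonneg[of _ L]) (auto simp: E_def)
      then show "mass (E n \<inter> E n') \<le> (if n \<le> n' then mass (E n \<inter> E n') else 0) + (if n' \<le> n then mass (E n' \<inter> E n) else 0)"
        by (auto simp: Int_commute)
    qed
    also have "\<dots> = 2 * (\<Sum>n\<in>T. \<Sum>n'\<in>T. if n \<le> n' then mass (E n \<inter> E n') else 0)"
      using sum.swap[of "\<lambda>n n'. if n \<le> n' then mass (E n \<inter> E n') else 0" T T] by (simp add: sum.distrib)
    finally show ?thesis using half second by linarith
  qed
  \<comment> \<open>The mean is a sum over the words with an occurrence only; the Cauchy--Schwarz inequality then
    brings in their mass.\<close>
  have U: "(\<Sum>w\<in>?\<Omega>. m w * f w) = (\<Sum>w\<in>?U. m w * f w)"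
    using fin f0 by (intro sum.mono_neutral_right) auto
  have "(\<Sum>w\<in>?U. m w * f w)\<^sup>2 = (\<Sum>w\<in>?U. sqrt (m w) * (sqrt (m w) * f w))\<^sup>2"
    using w_pos by (intro arg_cong[where f = "\<lambda>x. x\<^sup>2"] sum.cong) (auto simp: mult.assoc[symmetric])
  also have "\<dots> \<le> (\<Sum>w\<in>?U. (sqrt (m w))\<^sup>2) * (\<Sum>w\<in>?U. (sqrt (m w) * f w)\<^sup>2)"
    by (rule Cauchy_Schwarz_ineq_sum)
  also have "\<dots> = mass ?U * (\<Sum>w\<in>?U. m w * (f w)\<^sup>2)"
    using w_pos by (simp add: mass_def power_mult_distrib)
  also have "\<dots> \<le> mass ?U * (\<Sum>w\<in>?\<Omega>. m w * (f w)\<^sup>2)"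
    using fin w_pos mass_nonneg[of ?U L] by (intro mult_left_mono sum_mono2) auto
  finally have CS: "(\<Sum>w\<in>?\<Omega>. m w * f w)\<^sup>2 \<le> mass ?U * (\<Sum>w\<in>?\<Omega>. m w * (f w)\<^sup>2)" using U by simp
  have "(m I * S)\<^sup>2 \<le> (B * (\<Sum>w\<in>?\<Omega>. m w * f w))\<^sup>2"
    using lower mI S by (intro power_mono) auto
  also have "\<dots> \<le> B\<^sup>2 * (mass ?U * (\<Sum>w\<in>?\<Omega>. m w * (f w)\<^sup>2))"
    using CS by (simp add: power_mult_distrib mult_left_mono)
  also have "\<dots> \<le> B\<^sup>2 * (mass ?U * (2 * (B\<^sup>2 + B * G) * m I * S\<^sup>2))"
    using upper mass_nonneg[of ?U L] by (intro mult_left_mono) auto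
  finally have "m I * (m I * S\<^sup>2) \<le> 2 * B\<^sup>2 * (B\<^sup>2 + B * G) * mass ?U * (m I * S\<^sup>2)"
    by (simp add: power2_eq_square algebra_simps)
  then show ?thesis using mI S(2) by (simp add: mult_le_cancel_right)
qed

end

section \<open>Cylinders and Hausdorff measure\<close>

lemma sum_UN_le:
  fixes g :: "'b \<Rightarrow> real"
  assumes "finite F" "\<And>i. i \<in> F \<Longrightarrow> finite (A i)" "\<And>i x. i \<in> F \<Longrightarrow> x \<in> A i \<Longrightarrow> 0 \<le> g x"
  shows "sum g (\<Union>i\<in>F. A i) \<le> (\<Sum>i\<in>F. sum g (A i))"
  using assms
proof (induction F rule: finite_induct)
  case (insert i F)
  have "sum g (A i \<union> (\<Union>j\<in>F. A j))
      = sum g (A i) + sum g (\<Union>j\<in>F. A j) - sum g (A i \<inter> (\<Union>j\<in>F. A j))"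
    using insert.hyps insert.prems(1) by (intro sum_Un) auto
  moreover have "0 \<le> sum g (A i \<inter> (\<Union>j\<in>F. A j))"
    using insert.prems(2) by (intro sum_nonneg) auto
  moreover have "sum g (\<Union>j\<in>F. A j) \<le> (\<Sum>j\<in>F. sum g (A j))"
    using insert.prems by (intro insert.IH) auto
  ultimately show ?case using insert.hyps by simp
qed simp

text \<open>The balls of radius \<open>\<rho>\<close> about the points are disjoint; compare volumes.\<close>

lemma card_separated_le:
  fixes u :: "'a::euclidean_space" and \<rho> R :: real
  assumes "finite Q" and Q: "Q \<subseteq> cball u R" and sep: "\<And>x y. x \<in> Q \<Longrightarrow> y \<in> Q \<Longrightarrow> x \<noteq> y \<Longrightarrow> 2 * \<rho> \<le> dist x y"
    and \<rho>: "0 < \<rho>" and R: "0 \<le> R"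
  shows "card Q * \<rho> ^ DIM('a) \<le> (R + \<rho>) ^ DIM('a)"
proof -
  let ?v = "unit_ball_vol (real DIM('a))"
  have "card Q * (?v * \<rho> ^ DIM('a)) = (\<Sum>x\<in>Q. measure lborel (ball x \<rho>))"
    using \<rho> by (simp add: content_ball)
  also have "\<dots> = measure lborel (\<Union>x\<in>Q. ball x \<rho>)"
  proof (rule measure_finite_Union[symmetric])
    show "disjoint_family_on (\<lambda>x. ball x \<rho>) Q"
      unfolding disjoint_family_on_def
    proof (intro ballI impI)
      fix x y assume xy: "x \<in> Q" "y \<in> Q" "x \<noteq> y"
      have "dist x y < 2 * \<rho>" if "dist x w < \<rho>" "dist y w < \<rho>" for w
        using that dist_triangle2[of x y w] by linarith
      then show "ball x \<rho> \<inter> ball y \<rho> = {}" using sep[OF xy] by fastforce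
    qed
    show "emeasure lborel (ball x \<rho>) \<noteq> \<infinity>" for x
      using emeasure_bounded_finite[OF bounded_ball, of x \<rho>] by simp
  qed (use assms(1) in auto)
  also have "\<dots> \<le> measure lborel (ball u (R + \<rho>))"
  proof (rule measure_mono_fmeasurable)
    show "(\<Union>x\<in>Q. ball x \<rho>) \<subseteq> ball u (R + \<rho>)"
    proof
      fix w assume "w \<in> (\<Union>x\<in>Q. ball x \<rho>)"
      then obtain x where "x \<in> Q" "dist x w < \<rho>" by auto
      then show "w \<in> ball u (R + \<rho>)" using Q dist_triangle[of u w x] by force
    qed
    show "(\<Union>x\<in>Q. ball x \<rho>) \<in> sets lborel" by (auto intro!: borel_open)
    show "ball u (R + \<rho>) \<in> fmeasurable lborel"
      using emeasure_bounded_finite[OF bounded_ball] by (intro fmeasurableI) auto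
  qed
  also have "\<dots> = ?v * (R + \<rho>) ^ DIM('a)" using \<rho> R by (simp add: content_ball)
  finally have "?v * (card Q * \<rho> ^ DIM('a)) \<le> ?v * (R + \<rho>) ^ DIM('a)" by (simp add: mult_ac)
  then show ?thesis using unit_ball_vol_pos[of "real DIM('a)"] by simp
qed

text \<open>The two estimates that connect the words with the space: cylinders are not larger than their
  scale, and the marker \<open>p\<close> has separated images under incomparable words.  The second one is the
  form in which the open set condition is used.\<close>

locale cylinder_system = word_weights D scale a b K s C m
  for D :: "'i set" and scale a b K s C m +
  fixes \<phi> :: "'i \<Rightarrow> 'a::euclidean_space \<Rightarrow> 'a" and X :: "'a set" and z p :: 'a and M l :: real
  assumes compact_X: "compact X" and z_in_X: "z \<in> X"
    and X_eq: "X = (\<Union>i\<in>D. \<phi> i ` X)"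
    and M_ge_1: "1 \<le> M"
    and dist_le: "set I \<subseteq> D \<Longrightarrow> x \<in> X \<Longrightarrow> y \<in> insert p X \<Longrightarrow>
      dist (word_map \<phi> I x) (word_map \<phi> I y) \<le> M * scale I"
    and l_pos: "0 < l"
    and separated: "set I \<subseteq> D \<Longrightarrow> set J \<subseteq> D \<Longrightarrow> I \<parallel> J \<Longrightarrow>
      l * scale I \<le> dist (word_map \<phi> I p) (word_map \<phi> J p)"
begin

lemma word_map_X: "set I \<subseteq> D \<Longrightarrow> x \<in> X \<Longrightarrow> word_map \<phi> I x \<in> X"
proof (induction I)
  case (Cons i I)
  then have "word_map \<phi> I x \<in> X" "i \<in> D" by auto
  then show ?case using X_eq by auto
qed simp

lemma in_cylinder:
  assumes "x \<in> X"
  obtains I y where "I \<in> words D n" "y \<in> X" "x = word_map \<phi> I y"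
proof -
  have "\<exists>I\<in>words D n. \<exists>y\<in>X. x = word_map \<phi> I y" using assms
  proof (induction n arbitrary: x)
    case 0
    then show ?case by (auto simp: words_0)
  next
    case (Suc n)
    obtain i x' where x': "i \<in> D" "x' \<in> X" "x = \<phi> i x'" using Suc.prems X_eq by blast
    then obtain I y where "I \<in> words D n" "y \<in> X" "x' = word_map \<phi> I y" using Suc.IH by blast
    then have "i # I \<in> words D (Suc n)" "x = word_map \<phi> (i # I) y" using x' by (auto simp: words_def)
    then show ?case using \<open>y \<in> X\<close> by blast
  qed
  then show ?thesis using that by blast
qed

lemma diameter_cylinder_le:
  assumes "set I \<subseteq> D"
  shows "diameter (word_map \<phi> I ` X) \<le> M * scale I"
proof (rule diameter_le)
  show "norm (x - y) \<le> M * scale I" if "x \<in> word_map \<phi> I ` X" "y \<in> word_map \<phi> I ` X" for x y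
    using that dist_le[OF assms] by (auto simp: dist_norm)
qed (use z_in_X in auto)

lemma bounded_cylinder: "set I \<subseteq> D \<Longrightarrow> bounded (word_map \<phi> I ` X)"
  using word_map_X compact_imp_bounded[OF compact_X] by (auto intro: bounded_subset)

lemma hausdorff_measure_cylinder_le:
  assumes I: "set I \<subseteq> D"
  shows "hausdorff_measure s (word_map \<phi> I ` X) \<le> ennreal (M powr s * C * m I)"
proof (rule hausdorff_measure_le_finite_covers)
  fix \<delta> :: real assume \<delta>: "\<delta> > 0"
  obtain n where n: "b ^ n < \<delta> / M"
    using real_arch_pow_inv[of "\<delta> / M" b] b_less_1 \<delta> M_ge_1 by auto
  let ?U = "\<lambda>J. word_map \<phi> (I @ J) ` X"
  show "\<exists>(F :: 'i list set) U. finite F \<and> word_map \<phi> I ` X \<subseteq> (\<Union>J\<in>F. U J) \<and> (\<forall>J\<in>F. bounded (U J) \<and> diameter (U J) \<le> \<delta>)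
      \<and> (\<Sum>J\<in>F. rpow (diameter (U J)) s) \<le> M powr s * C * m I"
  proof (intro exI[of _ "words D n"] exI[of _ ?U] conjI ballI)
    show "finite (words D n)" by (rule finite_words[OF finite_D])
    show "word_map \<phi> I ` X \<subseteq> (\<Union>J\<in>words D n. ?U J)"
    proof
      fix y assume "y \<in> word_map \<phi> I ` X"
      then obtain x where x: "x \<in> X" "y = word_map \<phi> I x" by blast
      obtain J x' where "J \<in> words D n" "x' \<in> X" "x = word_map \<phi> J x'" using in_cylinder[OF x(1)] by blast
      then show "y \<in> (\<Union>J\<in>words D n. ?U J)" using x by (auto simp: word_map_append)
    qed
    have IJ: "set (I @ J) \<subseteq> D" if "J \<in> words D n" for J using I that by (auto simp: words_def)
    show "bounded (?U J)" if "J \<in> words D n" for J by (rule bounded_cylinder[OF IJ[OF that]])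
    show "diameter (?U J) \<le> \<delta>" if J: "J \<in> words D n" for J
    proof -
      have "scale (I @ J) \<le> b ^ length (I @ J)" by (rule scale_le[OF IJ[OF J]])
      also have "\<dots> \<le> b ^ n" using J b_pos b_less_1 by (intro power_decreasing) (auto simp: words_def)
      finally have "M * scale (I @ J) \<le> M * (\<delta> / M)" using n M_ge_1 by (intro mult_left_mono) auto
      then show ?thesis using diameter_cylinder_le[OF IJ[OF J]] M_ge_1 by simp
    qed
    have "(\<Sum>J\<in>words D n. rpow (diameter (?U J)) s) \<le> (\<Sum>J\<in>words D n. M powr s * C * m (I @ J))"
    proof (intro sum_mono)
      fix J assume J: "J \<in> words D n"
      have "rpow (diameter (?U J)) s \<le> (M * scale (I @ J)) powr s"
        using s_pos diameter_cylinder_le[OF IJ[OF J]] diameter_ge_0[OF bounded_cylinder[OF IJ[OF J]]]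
        by (auto simp: rpow_def intro!: powr_mono2)
      also have "\<dots> = M powr s * scale (I @ J) powr s"
        using M_ge_1 scale_pos[OF IJ[OF J]] by (simp add: powr_mult)
      also have "\<dots> \<le> M powr s * (C * m (I @ J))"
        using scale_le_m[OF IJ[OF J]] by (intro mult_left_mono) auto
      finally show "rpow (diameter (?U J)) s \<le> M powr s * C * m (I @ J)" by (simp add: mult.assoc)
    qed
    also have "\<dots> = M powr s * C * m I"
      using m_eq_sum_extensions[OF I, of n] by (simp flip: sum_distrib_left)
    finally show "(\<Sum>J\<in>words D n. rpow (diameter (?U J)) s) \<le> M powr s * C * m I" .
  qed
qed

text \<open>The markers of the words in a cut at scale \<open>r\<close> are separated by a multiple of \<open>r\<close>, so at most
  \<open>packing_bound\<close> of these words have cylinders near a given point.\<close>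

definition packing_bound :: real where
  "packing_bound = ((M + 2 + l * a / K / 2) / (l * a / K / 2)) ^ DIM('a)"

lemma mass_cut_near_le:
  assumes r: "0 < r" "r \<le> 1" and Js: "finite Js" "Js \<subseteq> cut r"
    and near: "\<And>J. J \<in> Js \<Longrightarrow> \<exists>x\<in>X. dist (word_map \<phi> J x) u \<le> 2 * r"
  shows "(\<Sum>J\<in>Js. m J) \<le> packing_bound * (C * r powr s)"
proof -
  define \<eta> where "\<eta> = l * a / K / 2"
  have \<eta>: "\<eta> > 0" using l_pos a_pos K_ge_1 by (simp add: \<eta>_def)
  let ?q = "\<lambda>J. word_map \<phi> J p"
  have D: "set J \<subseteq> D" "scale J \<le> r" if "J \<in> Js" for J using that Js by (auto simp: cut_def)
  have sep: "2 * (\<eta> * r) \<le> dist (?q I) (?q J)" if "I \<in> Js" "J \<in> Js" "I \<noteq> J" for I J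
  proof -
    have "2 * (\<eta> * r) = l * (a / K * r)" by (simp add: \<eta>_def)
    also have "\<dots> \<le> l * scale I"
      using cut_scale_ge[of I r] that Js r l_pos by (intro mult_left_mono) auto
    also have "\<dots> \<le> dist (?q I) (?q J)"
    proof (rule separated)
      show "I \<parallel> J" using that Js by (intro cut_parallel[of I r J]) auto
    qed (use that D in auto)
    finally show ?thesis .
  qed
  have inj: "inj_on ?q Js"
  proof (rule inj_onI, rule ccontr)
    fix I J assume IJ: "I \<in> Js" "J \<in> Js" "?q I = ?q J" "I \<noteq> J"
    have "dist (?q I) (?q J) = 0" using IJ(3) by simp
    then show False using sep[OF IJ(1,2,4)] mult_pos_pos[OF \<eta> r(1)] by linarith
  qed
  have "card (?q ` Js) * (\<eta> * r) ^ DIM('a) \<le> ((M + 2) * r + \<eta> * r) ^ DIM('a)"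
  proof (rule card_separated_le)
    show "?q ` Js \<subseteq> cball u ((M + 2) * r)"
    proof
      fix y assume "y \<in> ?q ` Js"
      then obtain J where J: "J \<in> Js" "y = ?q J" by blast
      obtain x where x: "x \<in> X" "dist (word_map \<phi> J x) u \<le> 2 * r" using near[OF J(1)] by blast
      have "dist (word_map \<phi> J x) y \<le> M * scale J" using dist_le[OF D(1)[OF J(1)] x(1)] J by simp
      also have "\<dots> \<le> M * r" using D(2)[OF J(1)] M_ge_1 by (intro mult_left_mono) auto
      finally have "dist u y \<le> 2 * r + M * r"
        using x(2) dist_triangle[of u y "word_map \<phi> J x"] by (simp add: dist_commute)
      then show "y \<in> cball u ((M + 2) * r)" by (simp add: algebra_simps)
    qed
    show "2 * (\<eta> * r) \<le> dist x y" if "x \<in> ?q ` Js" "y \<in> ?q ` Js" "x \<noteq> y" for x y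
      using that sep by auto
  qed (use Js \<eta> r M_ge_1 in auto)
  then have "card Js * (\<eta> * r) ^ DIM('a) \<le> ((M + 2 + \<eta>) * r) ^ DIM('a)"
    using card_image[OF inj] by (simp add: algebra_simps)
  also have "\<dots> = packing_bound * (\<eta> * r) ^ DIM('a)"
    unfolding packing_bound_def \<eta>_def[symmetric]
    using \<eta> by (simp add: power_mult_distrib power_divide)
  finally have card: "card Js \<le> packing_bound"
    using \<eta> r by (simp add: mult_le_cancel_right)
  have "(\<Sum>J\<in>Js. m J) \<le> (\<Sum>J\<in>Js. C * r powr s)"
  proof (rule sum_mono)
    fix J assume J: "J \<in> Js"
    have "scale J powr s \<le> r powr s"
      using D[OF J] scale_pos[of J] s_pos by (intro powr_mono2) auto
    then show "m J \<le> C * r powr s"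
      using m_le_scale[OF D(1)[OF J]] C_ge_1 mult_left_mono[of "scale J powr s" "r powr s" C] by linarith
  qed
  also have "\<dots> = card Js * (C * r powr s)" by simp
  also have "\<dots> \<le> packing_bound * (C * r powr s)"
    using card C_ge_1 by (intro mult_right_mono) auto
  finally show ?thesis .
qed

lemma packing_bound_pos: "0 < packing_bound"
proof -
  have 1: "0 < l * a / K / 2" using l_pos a_pos K_ge_1 by simp
  then have 2: "0 < M + 2 + l * a / K / 2" using M_ge_1 by linarith
  show ?thesis unfolding packing_bound_def by (rule zero_less_power[OF divide_pos_pos[OF 2 1]])
qed

text \<open>The mass distribution principle.  After enlarging the members of a cover slightly to open sets,
  compactness makes the cover finite; then every word of a large length has a prefix, in the
  cut at the scale of some member of the cover, whose cylinder is near this member.\<close>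

lemma mass_le_cover_sum:
  assumes cov: "X \<subseteq> (\<Union>k. U k)" and bd: "\<And>k. bounded (U k)"
    and r: "\<And>k::nat. diameter (U k) \<le> r k" "\<And>k. 0 < r k" "\<And>k. r k \<le> 1"
  obtains F where "finite F" "\<And>k. k \<in> F \<Longrightarrow> U k \<noteq> {}"
    "m [] \<le> (\<Sum>k\<in>F. packing_bound * (C * r k powr s))"
proof -
  define V where "V k = (\<Union>y\<in>U k. ball y (r k))" for k
  have opn: "\<And>k. k \<in> UNIV \<Longrightarrow> open (V k)" by (auto simp: V_def)
  have "U k \<subseteq> V k" for k
  proof
    fix x assume "x \<in> U k"
    moreover have "x \<in> ball x (r k)" using r(2) by simp
    ultimately show "x \<in> V k" unfolding V_def by blast
  qed
  then have "(\<Union>k. U k) \<subseteq> (\<Union>k. V k)" by (rule UN_mono[OF order_refl])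
  with cov have "X \<subseteq> (\<Union>k\<in>UNIV. V k)" by (rule order_trans)
  from compact_X opn this obtain F0 where "F0 \<subseteq> UNIV" and F0: "finite F0" "X \<subseteq> (\<Union>k\<in>F0. V k)"
    by (rule compactE_image)
  define F where "F = {k \<in> F0. U k \<noteq> {}}"
  have "(\<Union>k\<in>F0. V k) \<subseteq> (\<Union>k\<in>F. V k)" unfolding F_def V_def by blast
  then have F: "finite F" "X \<subseteq> (\<Union>k\<in>F. V k)" using F0 by (auto simp: F_def)
  have "F \<noteq> {}" using F z_in_X by auto
  define r0 where "r0 = Min (r ` F)"
  have r0: "0 < r0" "\<And>k. k \<in> F \<Longrightarrow> r0 \<le> r k" using F(1) \<open>F \<noteq> {}\<close> r(2) by (auto simp: r0_def)
  obtain L where L: "b ^ L < r0" using real_arch_pow_inv[OF r0(1) b_less_1] by blast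
  define Js where "Js k = {J \<in> cut (r k). length J \<le> L \<and> (\<exists>x\<in>X. word_map \<phi> J x \<in> V k)}" for k
  have fin_Js: "finite (Js k)" for k
  proof (rule finite_subset)
    show "Js k \<subseteq> {J. set J \<subseteq> D \<and> length J \<le> L}" by (auto simp: Js_def cut_def)
  qed (rule finite_lists_length_le[OF finite_D])
  have "words D L \<subseteq> (\<Union>k\<in>F. \<Union>J\<in>Js k. {I \<in> words D L. take (length J) I = J})"
  proof
    fix I assume I: "I \<in> words D L"
    then have ID: "set I \<subseteq> D" "length I = L" by (auto simp: words_def)
    obtain k where k: "k \<in> F" "word_map \<phi> I z \<in> V k" using F(2) word_map_X[OF ID(1) z_in_X] by blast
    have "scale I \<le> r k" using scale_le[OF ID(1)] L r0(2)[OF k(1)] ID(2) by simp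
    then obtain J where J: "J \<in> cut (r k)" "prefix J I" using cut_prefix_exists[OF ID(1)] by blast
    obtain I' where I': "I = J @ I'" using J(2) by (auto simp: prefix_def)
    have "word_map \<phi> I' z \<in> X" using ID I' z_in_X by (intro word_map_X) auto
    moreover have "word_map \<phi> J (word_map \<phi> I' z) \<in> V k" using k(2) by (simp add: I' word_map_append)
    ultimately have "J \<in> Js k" using J ID I' by (auto simp: Js_def)
    moreover have "take (length J) I = J" by (simp add: I')
    ultimately show "I \<in> (\<Union>k\<in>F. \<Union>J\<in>Js k. {I \<in> words D L. take (length J) I = J})"
      using k(1) I by blast
  qed
  have ext: "finite {I \<in> words D L. take (length J) I = J}" for J
    using finite_words[OF finite_D] by simp
  have ext_nonneg: "0 \<le> m I" if "I \<in> {I \<in> words D L. take (length J) I = J}" for I J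
    using that by (intro m_nonneg) (auto simp: words_def)
  have "m [] = mass (words D L)" using m_eq_sum_extensions[of "[]" L] by (simp add: mass_def)
  also have "\<dots> \<le> mass (\<Union>k\<in>F. \<Union>J\<in>Js k. {I \<in> words D L. take (length J) I = J})"
    by (rule mass_mono[of _ _ L]) (fact, auto)
  also have "\<dots> \<le> (\<Sum>k\<in>F. mass (\<Union>J\<in>Js k. {I \<in> words D L. take (length J) I = J}))"
    unfolding mass_def
    by (intro sum_UN_le F(1) finite_UN_I fin_Js ext) (use ext_nonneg in blast)
  also have "\<dots> \<le> (\<Sum>k\<in>F. \<Sum>J\<in>Js k. mass {I \<in> words D L. take (length J) I = J})"
    unfolding mass_def by (intro sum_mono sum_UN_le fin_Js ext ext_nonneg)
  also have "\<dots> = (\<Sum>k\<in>F. \<Sum>J\<in>Js k. m J)"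
  proof (intro sum.cong refl)
    fix k J assume "J \<in> Js k"
    then have "{J} \<subseteq> words D (length J)" "length J \<le> L" by (auto simp: Js_def cut_def words_def)
    then show "mass {I \<in> words D L. take (length J) I = J} = m J"
      using mass_take[of "{J}" "length J" L] by (simp add: mass_def)
  qed
  also have "\<dots> \<le> (\<Sum>k\<in>F. packing_bound * (C * r k powr s))"
  proof (rule sum_mono)
    fix k assume "k \<in> F"
    then obtain u where u: "u \<in> U k" by (auto simp: F_def)
    show "(\<Sum>J\<in>Js k. m J) \<le> packing_bound * (C * r k powr s)"
    proof (rule mass_cut_near_le[OF r(2,3) fin_Js, where u = u])
      show "Js k \<subseteq> cut (r k)" by (auto simp: Js_def)
      fix J assume "J \<in> Js k"
      then obtain x y where "x \<in> X" "y \<in> U k" "dist y (word_map \<phi> J x) < r k"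
        by (auto simp: Js_def V_def)
      moreover have "dist y u \<le> r k"
        using diameter_bounded_bound[OF bd \<open>y \<in> U k\<close> u] r(1)[of k] by simp
      ultimately show "\<exists>x\<in>X. dist (word_map \<phi> J x) u \<le> 2 * r k"
        using dist_triangle[of "word_map \<phi> J x" u y] by (intro bexI[of _ x]) (auto simp: dist_commute)
    qed
  qed
  finally have "m [] \<le> (\<Sum>k\<in>F. packing_bound * (C * r k powr s))" .
  moreover have "U k \<noteq> {}" if "k \<in> F" for k using that by (simp add: F_def)
  ultimately show ?thesis using F(1) that by metis
qed

lemma hausdorff_measure_X_pos: "hausdorff_measure s X \<noteq> 0"
proof -
  define A where "A = packing_bound * C * 2 powr s"
  have A: "0 < A" using packing_bound_pos C_ge_1 by (simp add: A_def)
  define \<tau> where "\<tau> = m [] / (2 * A)"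
  have \<tau>: "0 < \<tau>" using m_pos[of "[]"] A by (simp add: \<tau>_def)
  have "ennreal \<tau> \<le> hausdorff_premeasure s (1/2) X"
    unfolding hausdorff_premeasure_def
  proof (rule INF_greatest)
    fix U :: "nat \<Rightarrow> 'a set" assume "U \<in> {U. delta_cover (1/2) X U}"
    then have U: "X \<subseteq> (\<Union>k. U k)" "\<And>k. bounded (U k)" "\<And>k. diameter (U k) \<le> 1/2"
      by (auto simp: delta_cover_def)
    let ?cost = "\<lambda>k. if U k = {} then 0 else ennreal (rpow (diameter (U k)) s)"
    \<comment> \<open>The enlargements are so small that the powers \<open>e k powr s\<close> add up to at most \<open>\<tau>\<close>.\<close>
    define e where "e k = min (1/2) ((\<tau> * (1/2) ^ Suc k) powr (1 / s))" for k
    have e: "0 < e k" "e k \<le> 1/2" for k using \<tau> by (auto simp: e_def)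
    have es: "e k powr s \<le> \<tau> * (1/2) ^ Suc k" for k
    proof -
      have "e k powr s \<le> ((\<tau> * (1/2) ^ Suc k) powr (1 / s)) powr s"
        using e(1)[of k] s_pos by (intro powr_mono2) (auto simp: e_def)
      then show ?thesis using \<tau> s_pos by (simp add: powr_powr)
    qed
    have d0: "0 \<le> diameter (U k)" for k using U(2) by (rule diameter_ge_0)
    define r where "r k = diameter (U k) + e k" for k
    have rk: "diameter (U k) \<le> r k" "0 < r k" "r k \<le> 1" for k
      using d0[of k] e[of k] U(3)[of k] by (auto simp: r_def)
    obtain F where F: "finite F" "\<And>k. k \<in> F \<Longrightarrow> U k \<noteq> {}"
        "m [] \<le> (\<Sum>k\<in>F. packing_bound * (C * r k powr s))"
      using mass_le_cover_sum[OF U(1,2) rk] by metis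
    have rs: "r k powr s \<le> 2 powr s * (diameter (U k) powr s + \<tau> * (1/2) ^ Suc k)" for k
    proof -
      have "r k powr s \<le> (2 * max (diameter (U k)) (e k)) powr s"
        using rk(2)[of k] s_pos by (intro powr_mono2) (auto simp: r_def)
      also have "\<dots> = 2 powr s * max (diameter (U k)) (e k) powr s"
        using d0[of k] by (simp add: powr_mult)
      also have "\<dots> \<le> 2 powr s * (diameter (U k) powr s + e k powr s)"
        by (intro mult_left_mono) (auto simp: max_def)
      also have "\<dots> \<le> 2 powr s * (diameter (U k) powr s + \<tau> * (1/2) ^ Suc k)"
        using es by (intro mult_left_mono add_left_mono) auto
      finally show ?thesis .
    qed
    note F(3)
    also have "(\<Sum>k\<in>F. packing_bound * (C * r k powr s))
        \<le> (\<Sum>k\<in>F. packing_bound * (C * (2 powr s * (diameter (U k) powr s + \<tau> * (1/2) ^ Suc k))))"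
      using rs packing_bound_pos C_ge_1 by (intro sum_mono mult_left_mono) auto
    also have "\<dots> = (\<Sum>k\<in>F. A * (diameter (U k) powr s + \<tau> * (1/2) ^ Suc k))"
      by (simp only: A_def mult.assoc)
    also have "\<dots> = A * ((\<Sum>k\<in>F. diameter (U k) powr s) + \<tau> * (\<Sum>k\<in>F. (1/2) ^ Suc k))"
      by (simp only: sum.distrib sum_distrib_left distrib_left)
    also have "(\<Sum>k\<in>F. (1/2) ^ Suc k) \<le> (1::real)"
      using sum_le_suminf[OF sums_summable[OF power_half_series] F(1)] sums_unique[OF power_half_series]
      by simp
    finally have "m [] \<le> A * ((\<Sum>k\<in>F. diameter (U k) powr s) + \<tau> * 1)"
      using A \<tau> by (auto intro: mult_left_mono add_left_mono)
    moreover have "m [] = A * (2 * \<tau>)" using A by (simp add: \<tau>_def)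
    ultimately have "\<tau> \<le> (\<Sum>k\<in>F. diameter (U k) powr s)" using A by (simp add: mult_le_cancel_left)
    then have "ennreal \<tau> \<le> ennreal (\<Sum>k\<in>F. diameter (U k) powr s)" by (rule ennreal_leI)
    also have "\<dots> = (\<Sum>k\<in>F. ?cost k)"
      using F(2) s_pos by (subst sum_ennreal[symmetric]) (auto intro!: sum.cong simp: rpow_def)
    also have "\<dots> \<le> (\<Sum>k. ?cost k)" by (rule sum_le_suminf) (use F(1) in auto)
    finally show "ennreal \<tau> \<le> (\<Sum>k. ?cost k)" .
  qed
  also have "\<dots> \<le> hausdorff_measure s X" by (rule hausdorff_premeasure_le_measure) simp
  finally show ?thesis using \<tau> by auto
qed

lemma hausdorff_dim_X: "hausdorff_dim X = s"
proof (rule hausdorff_dim_eqI)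
  show "hausdorff_measure s X < top"
    using hausdorff_measure_cylinder_le[of "[]"] by (auto simp: le_less_trans image_ident)
qed (use s_pos hausdorff_measure_X_pos in auto)

text \<open>Cover the set by the subcylinders that are not known to miss it, and iterate: the mass of the
  cover decays geometrically.\<close>

lemma hausdorff_measure_zero_if_misses_proportion:
  assumes F: "F \<subseteq> X" and \<rho>: "0 < \<rho>" "\<rho> \<le> 1"
    and miss: "\<And>I. set I \<subseteq> D \<Longrightarrow> \<exists>L bad. length I \<le> L \<and>
      (\<forall>w. w \<in> words D L \<longrightarrow> bad w \<longrightarrow> F \<inter> word_map \<phi> w ` X = {}) \<and>
      \<rho> * m I \<le> mass {w \<in> words D L. take (length I) w = I \<and> bad w}"
  shows "hausdorff_measure s F = 0"
proof -
  define A where "A = M powr s * C"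
  have A: "0 \<le> A" using C_ge_1 by (simp add: A_def)
  have decay: "hausdorff_measure s (F \<inter> word_map \<phi> I ` X) \<le> ennreal (A * (1 - \<rho>) ^ k * m I)"
    if "set I \<subseteq> D" for I k
    using that
  proof (induction k arbitrary: I)
    case 0
    have "hausdorff_measure s (F \<inter> word_map \<phi> I ` X) \<le> hausdorff_measure s (word_map \<phi> I ` X)"
      by (rule hausdorff_measure_mono) auto
    also have "\<dots> \<le> ennreal (A * m I)" using hausdorff_measure_cylinder_le[OF 0] by (simp add: A_def)
    finally show ?case by simp
  next
    case (Suc k)
    obtain L bad where L: "length I \<le> L"
      and bad: "\<And>w. w \<in> words D L \<Longrightarrow> bad w \<Longrightarrow> F \<inter> word_map \<phi> w ` X = {}"
      and mass: "\<rho> * m I \<le> mass {w \<in> words D L. take (length I) w = I \<and> bad w}"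
      using miss[OF Suc.prems] by blast
    let ?W = "{w \<in> words D L. take (length I) w = I}"
    let ?G = "{w \<in> words D L. take (length I) w = I \<and> \<not> bad w}"
    let ?B = "{w \<in> words D L. take (length I) w = I \<and> bad w}"
    have finG: "finite ?G" using finite_words[OF finite_D] by auto
    have "F \<inter> word_map \<phi> I ` X \<subseteq> (\<Union>w\<in>?G. F \<inter> word_map \<phi> w ` X)"
    proof
      fix y assume y: "y \<in> F \<inter> word_map \<phi> I ` X"
      then obtain x where x: "x \<in> X" "y = word_map \<phi> I x" by blast
      obtain J x' where J: "J \<in> words D (L - length I)" "x' \<in> X" "x = word_map \<phi> J x'"
        using in_cylinder[OF x(1)] by blast
      have w: "I @ J \<in> words D L" "take (length I) (I @ J) = I" "y \<in> word_map \<phi> (I @ J) ` X"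
        using J x L Suc.prems by (auto simp: words_def word_map_append)
      moreover have "\<not> bad (I @ J)" using bad[OF w(1)] w(3) y by blast
      ultimately show "y \<in> (\<Union>w\<in>?G. F \<inter> word_map \<phi> w ` X)" using y by blast
    qed
    then have "hausdorff_measure s (F \<inter> word_map \<phi> I ` X)
        \<le> hausdorff_measure s (\<Union>w\<in>?G. F \<inter> word_map \<phi> w ` X)"
      by (rule hausdorff_measure_mono)
    also have "\<dots> \<le> (\<Sum>w\<in>?G. hausdorff_measure s (F \<inter> word_map \<phi> w ` X))"
      by (rule hausdorff_measure_finite_UN_le[OF finG])
    also have "\<dots> \<le> (\<Sum>w\<in>?G. ennreal (A * (1 - \<rho>) ^ k * m w))"
      by (intro sum_mono Suc.IH) (auto simp: words_def)
    also have "\<dots> = ennreal (\<Sum>w\<in>?G. A * (1 - \<rho>) ^ k * m w)"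
      using A \<rho> by (intro sum_ennreal mult_nonneg_nonneg m_nonneg) (auto simp: words_def)
    also have "(\<Sum>w\<in>?G. A * (1 - \<rho>) ^ k * m w) = A * (1 - \<rho>) ^ k * mass ?G"
      by (simp add: mass_def sum_distrib_left)
    also have "\<dots> \<le> A * (1 - \<rho>) ^ k * ((1 - \<rho>) * m I)"
    proof (intro mult_left_mono)
      have "mass ?W = m I"
        using mass_take[of "{I}" "length I" L] L Suc.prems by (simp add: words_def mass_def)
      moreover have "mass ?W = mass ?G + mass ?B"
      proof -
        have "?W = ?G \<union> ?B" by auto
        then show ?thesis unfolding mass_def using finite_words[OF finite_D]
          by (simp only:) (intro sum.union_disjoint, auto)
      qed
      ultimately show "mass ?G \<le> (1 - \<rho>) * m I" using mass by (simp add: algebra_simps)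
    qed (use A \<rho> in auto)
    finally show ?case by (simp add: ennreal_leI mult_ac)
  qed
  have "(\<lambda>k. ennreal (A * (1 - \<rho>) ^ k * m [])) \<longlonglongrightarrow> ennreal (A * 0 * m [])"
    using \<rho> by (intro tendsto_ennrealI tendsto_intros LIMSEQ_realpow_zero) auto
  moreover have "F \<inter> word_map \<phi> [] ` X = F" using F by (auto simp: image_def)
  ultimately have "hausdorff_measure s F \<le> ennreal (A * 0 * m [])"
    using decay[of "[]"] by (intro LIMSEQ_le_const) auto
  then show ?thesis by simp
qed

end

section \<open>The limsup set\<close>

lemma finitely_many_levels_if_not_in_W_set:
  assumes "finite D" "x \<in> X" "x \<notin> W_set D \<phi> X \<theta> z"
  obtains N where
    "\<And>n I. N \<le> n \<Longrightarrow> I \<in> words D n \<Longrightarrow>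
      x \<notin> cball (word_map \<phi> I z) (diameter (word_map \<phi> I ` X) * \<theta> n)"
proof -
  let ?S = "{I \<in> (\<Union>n\<in>{1..}. words D n).
    x \<in> cball (word_map \<phi> I z) (diameter (word_map \<phi> I ` X) * \<theta> (length I))}"
  have fin: "finite ?S" using assms by (simp add: W_set_def)
  define N where "N = Suc (Max (insert 0 (length ` ?S)))"
  show ?thesis
  proof (rule that[of N], rule notI)
    fix n I assume n: "N \<le> n" and I: "I \<in> words D n"
      and x: "x \<in> cball (word_map \<phi> I z) (diameter (word_map \<phi> I ` X) * \<theta> n)"
    have len: "length I = n" using I by (simp add: words_def)
    have "1 \<le> n" using n by (simp add: N_def)
    then have "I \<in> ?S" using I x len by auto
    then have "length I \<le> Max (insert 0 (length ` ?S))" using fin by (intro Max_ge) auto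
    then show False using len n by (simp add: N_def)
  qed
qed

context cylinder_system
begin

lemma target_word:
  assumes r: "0 < r"
  obtains P x where "P \<in> cut r" "x \<in> X" "word_map \<phi> P x = z"
proof -
  obtain n where n: "b ^ n < r" using real_arch_pow_inv[OF r b_less_1] by blast
  obtain I y where I: "I \<in> words D n" "y \<in> X" "z = word_map \<phi> I y" using in_cylinder[OF z_in_X] by metis
  have ID: "set I \<subseteq> D" "length I = n" using I(1) by (auto simp: words_def)
  obtain P where P: "P \<in> cut r" "prefix P I"
    using cut_prefix_exists[OF ID(1), of r] scale_le[OF ID(1)] ID(2) n by force
  obtain I' where I': "I = P @ I'" using P(2) by (auto simp: prefix_def)
  have "word_map \<phi> I' y \<in> X" using ID I' I(2) by (intro word_map_X) auto
  then show ?thesis using that[OF P(1), of "word_map \<phi> I' y"] I(3) I' by (simp add: word_map_append)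
qed

lemma length_cut_le:
  assumes P: "P \<in> cut r" and r: "0 < r" "r \<le> 1"
  shows "length P * ln (1 / b) \<le> ln (1 / r) + ln (K / a)"
proof -
  have PD: "set P \<subseteq> D" using P by (simp add: cut_def)
  have "a / K * r \<le> b ^ length P" using cut_scale_ge[OF P r] scale_le[OF PD] by linarith
  moreover have pos: "0 < a / K * r" using a_pos K_ge_1 r by simp
  ultimately have "ln (a / K * r) \<le> ln (b ^ length P)" using b_pos by simp
  then show ?thesis
    using a_pos b_pos K_ge_1 r pos by (simp add: ln_mult ln_div ln_realpow algebra_simps)
qed

lemma cut_mass_bounds:
  assumes P: "P \<in> cut r" and r: "0 < r" "r \<le> 1"
  shows "m P \<le> C * r powr s" "(a / K) powr s / C * r powr s \<le> m P"
proof -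
  have PD: "set P \<subseteq> D" "scale P \<le> r" using P by (auto simp: cut_def)
  have "scale P powr s \<le> r powr s" using PD scale_pos[OF PD(1)] s_pos by (intro powr_mono2) auto
  then show "m P \<le> C * r powr s"
    using m_le_scale[OF PD(1)] C_ge_1 mult_left_mono[of "scale P powr s" "r powr s" C] by linarith
  have "(a / K) powr s * r powr s = (a / K * r) powr s"
    using a_pos K_ge_1 r by (subst powr_mult) auto
  also have "\<dots> \<le> scale P powr s"
    using cut_scale_ge[OF P r] a_pos K_ge_1 r s_pos by (intro powr_mono2) auto
  also have "\<dots> \<le> C * m P" by (rule scale_le_m[OF PD(1)])
  finally show "(a / K) powr s / C * r powr s \<le> m P" using C_ge_1 by (simp add: field_simps)
qed

text \<open>Tails of the two sums satisfy the growth condition with a constant that does not depend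
  on where the tail begins, because the discarded parts are eventually negligible.\<close>

lemma tail_growth:
  fixes u v :: "nat \<Rightarrow> real"
  assumes u: "\<And>n. 0 \<le> u n" and div: "\<And>c. \<exists>Q. c \<le> (\<Sum>n=1..Q. u n)"
    and growth: "\<And>Q. Q0 \<le> Q \<Longrightarrow> (\<Sum>n=1..Q. v n) \<le> c0 * (\<Sum>n=1..Q. u n)\<^sup>2" and c0: "0 \<le> c0"
    and k: "1 \<le> k"
  obtains Q where "1 \<le> (\<Sum>n=k..Q. u n)" "(\<Sum>n=k..Q. v n) \<le> (4 * c0 + 1) * (\<Sum>n=k..Q. u n)\<^sup>2"
proof -
  define a1 where "a1 = (\<Sum>n=1..<k. u n)"
  define a2 where "a2 = (\<Sum>n=1..<k. v n)"
  have a1: "0 \<le> a1" using u by (simp add: a1_def sum_nonneg)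
  obtain Q1 where Q1: "1 + 2 * a1 + \<bar>a2\<bar> \<le> (\<Sum>n=1..Q1. u n)" using div by blast
  define Q where "Q = max Q1 (max Q0 k)"
  have split: "(\<Sum>n=1..Q. f n) = (\<Sum>n=1..<k. f n) + (\<Sum>n=k..Q. f n)" for f :: "nat \<Rightarrow> real"
  proof -
    have "{1..Q} = {1..<k} \<union> {k..Q}" using k by (auto simp: Q_def)
    then show ?thesis by (simp only:) (intro sum.union_disjoint, auto)
  qed
  let ?S = "\<Sum>n=k..Q. u n" and ?T = "\<Sum>n=1..Q. u n"
  have "(\<Sum>n=1..Q1. u n) \<le> ?T" using u by (intro sum_mono2) (auto simp: Q_def)
  then have S: "1 + a1 + \<bar>a2\<bar> \<le> ?S" using Q1 split[of u] by (simp add: a1_def)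
  then have S1: "1 \<le> ?S" using a1 by linarith
  have T: "0 \<le> ?T" "?T \<le> 2 * ?S" using S a1 u split[of u] by (auto simp: a1_def sum_nonneg)
  have "?S * 1 \<le> ?S * ?S" using S1 by (intro mult_left_mono) auto
  then have "\<bar>a2\<bar> \<le> ?S\<^sup>2" using S a1 by (simp add: power2_eq_square)
  moreover have "(\<Sum>n=1..Q. v n) \<le> c0 * ?T\<^sup>2" using growth by (simp add: Q_def)
  moreover have "c0 * ?T\<^sup>2 \<le> c0 * (2 * ?S)\<^sup>2" using T c0 by (intro mult_left_mono power_mono) auto
  ultimately have "(\<Sum>n=k..Q. v n) \<le> (4 * c0 + 1) * ?S\<^sup>2"
    using split[of v] by (simp add: a2_def algebra_simps power_mult_distrib)
  then show ?thesis using that S1 by blast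
qed

text \<open>Balls are replaced by cylinders inside them: a word of length \<open>n\<close> followed by the target \<open>P n\<close>.
  The target has mass of order \<open>\<theta> n powr s\<close> and length of order \<open>ln (1 / \<theta> n)\<close>, so the growth
  condition on \<open>\<theta>\<close> is what the second moment estimate requires of the overlaps.  Hence the balls
  of the levels beyond any \<open>N\<close> cover a fixed proportion of every cylinder.\<close>

theorem hausdorff_measure_not_in_W_set:
  assumes \<theta>: "\<And>n. 0 \<le> \<theta> n" and N0: "\<And>n. N0 \<le> n \<Longrightarrow> \<theta> n < 1"
    and l0: "0 < l0" "\<And>I. set I \<subseteq> D \<Longrightarrow> l0 * scale I \<le> diameter (word_map \<phi> I ` X)"
    and div: "\<And>c. \<exists>Q. c \<le> (\<Sum>n=1..Q. \<theta> n powr s)"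
    and growth: "\<And>Q. Q0 \<le> Q \<Longrightarrow>
      (\<Sum>n=1..Q. if \<theta> n = 0 then 0 else \<theta> n powr s * ln (1 / \<theta> n)) \<le> c0 * (\<Sum>n=1..Q. \<theta> n powr s)\<^sup>2"
    and c0: "0 \<le> c0"
  shows "hausdorff_measure s (X - W_set D \<phi> X \<theta> z) = 0"
proof -
  \<comment> \<open>The word \<open>P n\<close> is a target: its cylinder contains \<open>z\<close> and is so small that the cylinder of
    \<open>J @ P n\<close>, for every \<open>J\<close> of length \<open>n\<close>, lies in the ball that belongs to \<open>J\<close>.\<close>
  define \<beta> where "\<beta> = min 1 (l0 / (M * K))"
  have \<beta>: "0 < \<beta>" "\<beta> \<le> 1" "\<beta> * (M * K) \<le> l0"
  proof -
    have MK: "0 < M * K" using M_ge_1 K_ge_1 by simp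
    then show "0 < \<beta>" "\<beta> \<le> 1" using l0 by (auto simp: \<beta>_def)
    have "\<beta> \<le> l0 / (M * K)" by (simp add: \<beta>_def)
    then show "\<beta> * (M * K) \<le> l0" using MK by (simp add: pos_le_divide_eq)
  qed
  define P where "P n = (SOME J. J \<in> cut (\<beta> * \<theta> n) \<and> (\<exists>x\<in>X. word_map \<phi> J x = z))" for n
  have P: "P n \<in> cut (\<beta> * \<theta> n)" "\<exists>x\<in>X. word_map \<phi> (P n) x = z" if "0 < \<theta> n" for n
  proof -
    have "0 < \<beta> * \<theta> n" using \<beta> that by simp
    then have "\<exists>J. J \<in> cut (\<beta> * \<theta> n) \<and> (\<exists>x\<in>X. word_map \<phi> J x = z)"
      using target_word by metis
    from someI_ex[OF this] show "P n \<in> cut (\<beta> * \<theta> n)" "\<exists>x\<in>X. word_map \<phi> (P n) x = z"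
      by (simp_all add: P_def)
  qed
  have PD: "set (P n) \<subseteq> D" if "0 < \<theta> n" for n using P(1)[OF that] by (simp add: cut_def)
  have target: "word_map \<phi> (J @ P n) y \<in> cball (word_map \<phi> J z) (diameter (word_map \<phi> J ` X) * \<theta> n)"
    if n: "0 < \<theta> n" and J: "J \<in> words D n" and y: "y \<in> X" for n J y
  proof -
    have JD: "set J \<subseteq> D" "set (J @ P n) \<subseteq> D" using J PD[OF n] by (auto simp: words_def)
    obtain x where x: "x \<in> X" "word_map \<phi> (P n) x = z" using P(2)[OF n] by blast
    have "dist (word_map \<phi> J z) (word_map \<phi> (J @ P n) y) \<le> M * scale (J @ P n)"
      using dist_le[OF JD(2) x(1), of y] y x(2) by (simp add: word_map_append)
    also have "\<dots> \<le> M * (K * (scale J * scale (P n)))"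
      using scale_append_le[OF JD(1) PD[OF n]] M_ge_1 by (intro mult_left_mono) auto
    also have "\<dots> \<le> M * (K * (scale J * (\<beta> * \<theta> n)))"
      using P(1)[OF n] scale_pos[OF JD(1)] M_ge_1 K_ge_1 by (intro mult_left_mono) (auto simp: cut_def)
    also have "\<dots> = \<beta> * (M * K) * (scale J * \<theta> n)" by (simp add: mult_ac)
    also have "\<dots> \<le> l0 * (scale J * \<theta> n)"
      using \<beta>(3) scale_pos[OF JD(1)] \<theta> by (intro mult_right_mono) auto
    also have "\<dots> \<le> diameter (word_map \<phi> J ` X) * \<theta> n"
      using mult_right_mono[OF l0(2)[OF JD(1)] \<theta>[of n]] by (simp add: mult.assoc)
    finally show ?thesis by simp
  qed

  \<comment> \<open>The target \<open>P n\<close> has length at most \<open>G1 * (ln (1 / \<theta> n) + G2)\<close> and mass at least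
    \<open>c1 * \<theta> n powr s\<close>.  This gives the overlap constant \<open>G\<close>, and the proportion \<open>\<rho>\<close> is the one in
    the second moment estimate.\<close>
  define G1 where "G1 = 1 / ln (1 / b)"
  define G2 where "G2 = ln (1 / \<beta>) + ln (K / a)"
  define c1 where "c1 = (a / K) powr s / C * \<beta> powr s"
  define G where "G = C * G1 * (4 * c0 + 1 + G2) / c1\<^sup>2"
  define \<rho> where "\<rho> = 1 / (2 * B\<^sup>2 * (B\<^sup>2 + B * G))"
  have lnb: "0 < ln (1 / b)" using b_pos b_less_1 by (simp add: ln_div)
  have G1: "0 < G1" using lnb by (simp add: G1_def)
  have G2: "0 \<le> G2"
    unfolding G2_def using \<beta> K_ge_1 a_pos a_less_1 by (intro add_nonneg_nonneg ln_ge_zero) auto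
  have c1: "0 < c1" using a_pos K_ge_1 C_ge_1 \<beta> by (simp add: c1_def)
  have G: "0 \<le> G" using C_ge_1 G1 G2 c0 by (simp add: G_def)
  have BG: "1 \<le> 2 * B\<^sup>2 * (B\<^sup>2 + B * G)"
  proof -
    have "1 \<le> B\<^sup>2" using B_ge_1 by (simp add: one_le_power)
    moreover from this have "1 \<le> B\<^sup>2 + B * G" using G B_ge_1 by (simp add: add_increasing2)
    ultimately have "1 * 1 \<le> (2 * B\<^sup>2) * (B\<^sup>2 + B * G)" by (intro mult_mono) auto
    then show ?thesis by simp
  qed
  have \<rho>: "0 < \<rho>" "\<rho> \<le> 1" using BG by (auto simp: \<rho>_def)
  have target_mass: "length (P n) * m (P n) \<le> C * G1 * (\<theta> n powr s * ln (1 / \<theta> n) + G2 * \<theta> n powr s)"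
    "c1 * \<theta> n powr s \<le> m (P n)" if n: "0 < \<theta> n" "\<theta> n < 1" for n
  proof -
    have r: "0 < \<beta> * \<theta> n" "\<beta> * \<theta> n \<le> 1" using \<beta> n by (auto intro: mult_le_one)
    have "length (P n) * ln (1 / b) \<le> ln (1 / (\<beta> * \<theta> n)) + ln (K / a)"
      by (rule length_cut_le[OF P(1)[OF n(1)] r])
    also have "\<dots> = ln (1 / \<theta> n) + G2" using \<beta> n by (simp add: G2_def ln_div ln_mult)
    finally have len: "length (P n) \<le> G1 * (ln (1 / \<theta> n) + G2)"
      using lnb by (simp add: G1_def field_simps)
    have "m (P n) \<le> C * (\<beta> * \<theta> n) powr s" by (rule cut_mass_bounds(1)[OF P(1)[OF n(1)] r])
    also have "\<dots> \<le> C * \<theta> n powr s"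
    proof -
      have "\<beta> * \<theta> n \<le> 1 * \<theta> n" using \<beta> n by (intro mult_right_mono) auto
      then show ?thesis using C_ge_1 r s_pos by (intro mult_left_mono powr_mono2) auto
    qed
    finally have "length (P n) * m (P n) \<le> (G1 * (ln (1 / \<theta> n) + G2)) * (C * \<theta> n powr s)"
      using len m_nonneg[OF PD[OF n(1)]] by (intro mult_mono) auto
    then show "length (P n) * m (P n) \<le> C * G1 * (\<theta> n powr s * ln (1 / \<theta> n) + G2 * \<theta> n powr s)"
      by (simp add: algebra_simps)
    show "c1 * \<theta> n powr s \<le> m (P n)"
      using cut_mass_bounds(2)[OF P(1)[OF n(1)] r] \<beta> n by (simp add: c1_def powr_mult mult.assoc)
  qed

  define F where "F N = {x \<in> X. \<forall>n\<ge>N. \<forall>I\<in>words D n.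
    x \<notin> cball (word_map \<phi> I z) (diameter (word_map \<phi> I ` X) * \<theta> n)}" for N
  have F0: "hausdorff_measure s (F N) = 0" if N: "N0 \<le> N" "1 \<le> N" for N
  proof (rule hausdorff_measure_zero_if_misses_proportion[OF _ \<rho>])
    show "F N \<subseteq> X" by (auto simp: F_def)
    fix I assume I: "set I \<subseteq> D"
    define k where "k = max N (length I)"
    define u where "u n = \<theta> n powr s" for n
    define v where "v n = (if \<theta> n = 0 then 0 else \<theta> n powr s * ln (1 / \<theta> n))" for n
    have u: "0 \<le> u n" for n by (simp add: u_def)
    have k: "1 \<le> k" using N by (simp add: k_def)
    obtain Q where Q: "1 \<le> (\<Sum>n=k..Q. u n)" "(\<Sum>n=k..Q. v n) \<le> (4 * c0 + 1) * (\<Sum>n=k..Q. u n)\<^sup>2"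
      by (rule tail_growth[OF u div[folded u_def] growth[folded u_def v_def] c0 k])
    let ?S = "\<Sum>n=k..Q. u n"
    define T where "T = {n \<in> {k..Q}. 0 < \<theta> n}"
    have T: "finite T" "\<And>n. n \<in> T \<Longrightarrow> 0 < \<theta> n \<and> \<theta> n < 1 \<and> k \<le> n"
      using N0 N by (auto simp: T_def k_def)
    have uT: "?S = (\<Sum>n\<in>T. u n)" and vT: "(\<Sum>n=k..Q. v n) = (\<Sum>n\<in>T. \<theta> n powr s * ln (1 / \<theta> n))"
    proof -
      have z0: "\<theta> n = 0" if "n \<in> {k..Q} - T" for n using that \<theta>[of n] by (auto simp: T_def)
      have sub: "T \<subseteq> {k..Q}" by (auto simp: T_def)
      have zero: "\<forall>n\<in>{k..Q} - T. u n = 0" "\<forall>n\<in>{k..Q} - T. v n = 0"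
        by (intro ballI, drule z0, simp add: u_def v_def)+
      show "?S = (\<Sum>n\<in>T. u n)"
        by (rule sum.mono_neutral_right[OF _ sub zero(1)]) simp
      have "(\<Sum>n=k..Q. v n) = (\<Sum>n\<in>T. v n)"
        by (rule sum.mono_neutral_right[OF _ sub zero(2)]) simp
      also have "\<dots> = (\<Sum>n\<in>T. \<theta> n powr s * ln (1 / \<theta> n))"
        by (intro sum.cong) (auto simp: v_def T_def)
      finally show "(\<Sum>n=k..Q. v n) = (\<Sum>n\<in>T. \<theta> n powr s * ln (1 / \<theta> n))" .
    qed
    define S where "S = (\<Sum>n\<in>T. m (P n))"
    have S: "c1 * ?S \<le> S"
      unfolding S_def uT sum_distrib_left using T target_mass(2) by (intro sum_mono) (auto simp: u_def)
    have "c1 * 1 \<le> c1 * ?S" using Q c1 by (intro mult_left_mono) auto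
    then have S0: "0 < S" using S c1 by linarith
    have "(\<Sum>n\<in>T. length (P n) * m (P n))
        \<le> (\<Sum>n\<in>T. C * G1 * (\<theta> n powr s * ln (1 / \<theta> n) + G2 * \<theta> n powr s))"
      using T target_mass(1) by (intro sum_mono) auto
    also have "\<dots> = C * G1 * ((\<Sum>n=k..Q. v n) + G2 * ?S)"
      unfolding uT vT unfolding u_def by (simp only: sum.distrib sum_distrib_left distrib_left)
    also have "\<dots> \<le> C * G1 * ((4 * c0 + 1) * ?S\<^sup>2 + G2 * ?S\<^sup>2)"
    proof (intro mult_left_mono add_mono Q(2))
      have "?S * 1 \<le> ?S * ?S" using Q by (intro mult_left_mono) auto
      then show "?S \<le> ?S\<^sup>2" by (simp add: power2_eq_square)
    qed (use G1 G2 C_ge_1 in auto)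
    also have "\<dots> = G * (c1 * ?S)\<^sup>2" using c1 by (simp add: G_def field_simps)
    also have "\<dots> \<le> G * S\<^sup>2" using S G c1 Q by (intro mult_left_mono power_mono) auto
    finally have overlap: "(\<Sum>n\<in>T. length (P n) * m (P n)) \<le> G * S\<^sup>2" .
    \<comment> \<open>any length that leaves room for all targets\<close>
    define L where "L = length I + (\<Sum>n\<in>T. n + length (P n))"
    have L: "n + length (P n) \<le> L" if "n \<in> T" for n
      using member_le_sum[of n T "\<lambda>n. n + length (P n)"] that T(1) by (simp add: L_def)
    have "m I \<le> 2 * B\<^sup>2 * (B\<^sup>2 + B * G) *
        mass {w \<in> words D L. take (length I) w = I \<and> (\<exists>n\<in>T. hit (P n) n w)}"
    proof (rule mass_some_hit_ge[OF T(1) _ _ L _ S_def S0 overlap])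
      show "length I \<le> n" if "n \<in> T" for n using T(2)[OF that] by (simp add: k_def)
      show "set (P n) \<subseteq> D" if "n \<in> T" for n using T(2)[OF that] PD by blast
    qed (use I in \<open>auto simp: words_def L_def\<close>)
    then have "\<rho> * m I \<le> mass {w \<in> words D L. take (length I) w = I \<and> (\<exists>n\<in>T. hit (P n) n w)}"
      using BG by (simp add: \<rho>_def field_simps)
    moreover have "F N \<inter> word_map \<phi> w ` X = {}" if w: "w \<in> words D L" and h: "\<exists>n\<in>T. hit (P n) n w" for w
    proof -
      obtain n where n: "n \<in> T" "hit (P n) n w" using h by blast
      define J where "J = take n w"
      define R where "R = drop (n + length (P n)) w"
      have "w = J @ drop n w" by (simp add: J_def)
      also have "drop n w = P n @ R"
        using n(2) append_take_drop_id[of "length (P n)" "drop n w"]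
        by (simp add: hit_def R_def add.commute)
      finally have w_eq: "w = (J @ P n) @ R" by simp
      have J: "J \<in> words D n" using w L[OF n(1)] by (auto simp: J_def words_def dest: in_set_takeD)
      have R: "set R \<subseteq> D" using w by (auto simp: R_def words_def dest: in_set_dropD)
      have nN: "N \<le> n" "0 < \<theta> n" using T(2)[OF n(1)] by (auto simp: k_def)
      have "word_map \<phi> w y \<notin> F N" if "y \<in> X" for y
      proof -
        have "word_map \<phi> w y \<in> cball (word_map \<phi> J z) (diameter (word_map \<phi> J ` X) * \<theta> n)"
          using target[OF nN(2) J word_map_X[OF R that]] w_eq word_map_append by metis
        then show ?thesis using J nN(1) unfolding F_def by blast
      qed
      then show ?thesis by blast
    qed
    ultimately show "\<exists>L bad. length I \<le> L \<and>
        (\<forall>w. w \<in> words D L \<longrightarrow> bad w \<longrightarrow> F N \<inter> word_map \<phi> w ` X = {}) \<and>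
        \<rho> * m I \<le> mass {w \<in> words D L. take (length I) w = I \<and> bad w}"
      by (intro exI[of _ L] exI[of _ "\<lambda>w. \<exists>n\<in>T. hit (P n) n w"]) (auto simp: L_def)
  qed
  have "X - W_set D \<phi> X \<theta> z \<subseteq> (\<Union>N. F (N + Suc N0))"
  proof
    fix x assume "x \<in> X - W_set D \<phi> X \<theta> z"
    then obtain N where "\<And>n I. N \<le> n \<Longrightarrow> I \<in> words D n \<Longrightarrow>
        x \<notin> cball (word_map \<phi> I z) (diameter (word_map \<phi> I ` X) * \<theta> n)" and "x \<in> X"
      using finitely_many_levels_if_not_in_W_set[OF finite_D] by (metis DiffD1 DiffD2)
    then have "x \<in> F (N + Suc N0)" by (simp add: F_def)
    then show "x \<in> (\<Union>N. F (N + Suc N0))" by blast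
  qed
  then have "hausdorff_measure s (X - W_set D \<phi> X \<theta> z) \<le> hausdorff_measure s (\<Union>N. F (N + Suc N0))"
    by (rule hausdorff_measure_mono)
  also have "\<dots> \<le> (\<Sum>N. hausdorff_measure s (F (N + Suc N0)))" by (rule hausdorff_measure_UN_le)
  also have "\<dots> = 0" using F0 by simp
  finally show ?thesis by simp
qed

end

section \<open>Conformal iterated function systems\<close>

lemma in_W_setI:
  assumes "finite D" "x \<in> X" and inf: "\<And>N. \<exists>n\<ge>N. \<exists>I\<in>words D n.
      x \<in> cball (word_map \<phi> I z) (diameter (word_map \<phi> I ` X) * \<theta> n)"
  shows "x \<in> W_set D \<phi> X \<theta> z"
proof (rule ccontr)
  assume "x \<notin> W_set D \<phi> X \<theta> z"
  then obtain N where "\<And>n I. N \<le> n \<Longrightarrow> I \<in> words D n \<Longrightarrow>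
      x \<notin> cball (word_map \<phi> I z) (diameter (word_map \<phi> I ` X) * \<theta> n)"
    using finitely_many_levels_if_not_in_W_set[OF assms(1,2)] by metis
  then show False using inf[of N] by blast
qed

text \<open>The alphabet is finite, so the constants of the single maps have common bounds.\<close>

lemma conformal_ifs_imp_conformal_attractor:
  assumes ifs: "conformal_ifs Y V D \<phi>" and X: "attractor Y D \<phi> X" and z: "z \<in> X"
  obtains a b c \<alpha> \<epsilon> where "conformal_attractor D \<phi> X V a b c \<alpha> \<epsilon> z"
proof -
  have D: "finite D" using ifs by (auto simp: conformal_ifs_def ifs_def)
  have V: "open V" "X \<subseteq> V" using ifs X by (auto simp: conformal_ifs_def attractor_def)
  have XX: "compact X" "X = (\<Union>i\<in>D. \<phi> i ` X)" using X by (auto simp: attractor_def)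
  have "D \<noteq> {}" using XX(2) z by auto
  obtain \<epsilon> where \<epsilon>: "0 < \<epsilon>" "(\<Union>x\<in>X. ball x \<epsilon>) \<subseteq> V"
    using compact_subset_open_imp_ball_epsilon_subset[OF XX(1) V] by blast
  have inj: "inj_on (\<phi> i) V" and conf: "conformal_on V (\<phi> i)" if "i \<in> D" for i
    using ifs that by (auto simp: conformal_ifs_def)
  have "\<forall>i\<in>D. \<exists>r. r < 1 \<and> r-lipschitz_on V (\<phi> i)"
    using ifs by (auto simp: conformal_ifs_def contraction_on_def)
  then obtain r where r: "\<And>i. i \<in> D \<Longrightarrow> r i < 1" "\<And>i. i \<in> D \<Longrightarrow> (r i)-lipschitz_on V (\<phi> i)" by metis
  have "\<forall>i\<in>D. \<exists>a b. 0 < a \<and> b < 1 \<and> (\<forall>x\<in>V. a \<le> deriv_norm (\<phi> i) x \<and> deriv_norm (\<phi> i) x \<le> b)"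
    using ifs by (auto simp: conformal_ifs_def)
  then obtain lo hi where lo: "\<And>i. i \<in> D \<Longrightarrow> 0 < lo i"
      "\<And>i x. i \<in> D \<Longrightarrow> x \<in> V \<Longrightarrow> lo i \<le> deriv_norm (\<phi> i) x"
    and hi: "\<And>i. i \<in> D \<Longrightarrow> hi i < 1" "\<And>i x. i \<in> D \<Longrightarrow> x \<in> V \<Longrightarrow> deriv_norm (\<phi> i) x \<le> hi i"
    by metis
  obtain \<alpha> c where hol: "0 < \<alpha>" "0 < c" "\<And>i x y. i \<in> D \<Longrightarrow> x \<in> V \<Longrightarrow> y \<in> V \<Longrightarrow>
      \<bar>deriv_norm (\<phi> i) x - deriv_norm (\<phi> i) y\<bar> \<le> c * norm (x - y) powr \<alpha>"
    using ifs by (auto simp: conformal_ifs_def)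
  define a where "a = Min (lo ` D)"
  define b where "b = Max (insert (1/2) (r ` D \<union> hi ` D))"
  have a: "0 < a" "\<And>i. i \<in> D \<Longrightarrow> a \<le> lo i" using D \<open>D \<noteq> {}\<close> lo(1) by (auto simp: a_def)
  have ge: "x \<le> b" if "x \<in> insert (1/2) (r ` D \<union> hi ` D)" for x
    unfolding b_def using D that by (intro Max_ge) auto
  have b: "1/2 \<le> b" "\<And>i. i \<in> D \<Longrightarrow> r i \<le> b" "\<And>i. i \<in> D \<Longrightarrow> hi i \<le> b"
    by (rule ge, blast)+
  have b1: "b < 1" unfolding b_def using D r(1) hi(1) by (subst Max_less_iff) auto
  have "conformal_attractor D \<phi> X V a b c \<alpha> \<epsilon> z"
  proof
    fix i x y v assume i: "i \<in> D" and x: "x \<in> V"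
    show "(\<phi> i has_derivative frechet_derivative (\<phi> i) (at x)) (at x)"
      using conf[OF i] x unfolding conformal_on_def C1_on_def
      by (metis differentiableI frechet_derivative_works)
    show "norm (frechet_derivative (\<phi> i) (at x) v) = deriv_norm (\<phi> i) x * norm v"
      using conf[OF i] x by (auto simp: conformal_on_def)
    show "a \<le> deriv_norm (\<phi> i) x" using a(2)[OF i] lo(2)[OF i x] by linarith
    show "deriv_norm (\<phi> i) x \<le> b" using b(3)[OF i] hi(2)[OF i x] by linarith
    assume y: "y \<in> V"
    have "dist (\<phi> i x) (\<phi> i y) \<le> r i * dist x y" by (rule lipschitz_onD[OF r(2)[OF i] x y])
    also have "\<dots> \<le> b * dist x y" using b(2)[OF i] by (intro mult_right_mono) auto
    finally show "dist (\<phi> i x) (\<phi> i y) \<le> b * dist x y" .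
    show "\<bar>deriv_norm (\<phi> i) x - deriv_norm (\<phi> i) y\<bar> \<le> c * norm (x - y) powr \<alpha>"
      by (rule hol(3)[OF i x y])
  next
    show "X = (\<Union>i\<in>D. \<phi> i ` X)" by (rule XX(2))
    show "ball x \<epsilon> \<subseteq> V" if "x \<in> X" for x using \<epsilon>(2) that by blast
  qed (use D XX(1) z \<epsilon> inj a(1) b(1) b1 hol in auto)
  then show ?thesis using that by blast
qed

lemma (in conformal_attractor) attractor_singleton_if_one_map:
  assumes D: "card D = 1"
  shows "X = {z}"
proof -
  obtain i where i: "D = {i}" using D card_1_singletonE by blast
  obtain R where R: "0 < R" "\<And>x y. x \<in> nbhd \<Longrightarrow> y \<in> nbhd \<Longrightarrow> dist x y \<le> R" using bounded_nbhd by blast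
  have contr: "dist x y \<le> b ^ n * R" if "x \<in> X" "y \<in> X" for x y n
    using that
  proof (induction n arbitrary: x y)
    case 0
    then show ?case using R(2)[of x y] X_subset_nbhd by auto
  next
    case (Suc n)
    have "X = \<phi> i ` X" using X_eq by (simp add: i)
    then have "x \<in> \<phi> i ` X" "y \<in> \<phi> i ` X" using Suc.prems by blast+
    then obtain x' y' where xy: "x' \<in> X" "y' \<in> X" "x = \<phi> i x'" "y = \<phi> i y'" by blast
    have "dist x y \<le> b * dist x' y'" using xy X_subset_V i by (auto intro!: contraction_phi)
    also have "\<dots> \<le> b * (b ^ n * R)" using Suc.IH[OF xy(1,2)] b_pos by (intro mult_left_mono) auto
    finally show ?case by (simp add: mult.assoc)
  qed
  have "x = z" if x: "x \<in> X" for x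
  proof -
    have "(\<lambda>n. b ^ n * R) \<longlonglongrightarrow> 0 * R"
      using b_pos b_less_1 by (intro tendsto_intros LIMSEQ_realpow_zero) auto
    then have "dist x z \<le> 0 * R" using contr[OF x z_in_X] by (intro LIMSEQ_le_const) auto
    then show ?thesis by simp
  qed
  then have "X \<subseteq> {z}" by blast
  moreover have "{z} \<subseteq> X" using z_in_X by blast
  ultimately show ?thesis by (rule equalityI)
qed

text \<open>Two maps are needed for a positive critical exponent.\<close>

lemma (in conformal_attractor) cylinder_systemE:
  assumes osc: "open_set_condition V D \<phi>" and card: "2 \<le> card D"
  obtains K s C m p M l where "cylinder_system D scale a b K s C m \<phi> X z p M l"
proof -
  obtain K where K: "1 \<le> K"
    "\<And>I J. set I \<subseteq> D \<Longrightarrow> set J \<subseteq> D \<Longrightarrow> scale I * scale J \<le> K * scale (I @ J)"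
    "\<And>I J. set I \<subseteq> D \<Longrightarrow> set J \<subseteq> D \<Longrightarrow> scale (I @ J) \<le> K * (scale I * scale J)"
    using scale_quasi_multiplicative by blast
  interpret word_scale D scale a b K
    by unfold_locales (use finite_D card a_pos b_pos b_less_1 scale_bounds K in auto)
  obtain s where s: "0 < s" "\<And>n. 1 \<le> K powr s * level_sum s n" "\<And>n. level_sum s n \<le> K powr s"
    using critical_exponent by blast
  obtain m C where m: "1 \<le> C"
    "\<And>I. set I \<subseteq> D \<Longrightarrow> m I = (\<Sum>i\<in>D. m (I @ [i]))"
    "\<And>I. set I \<subseteq> D \<Longrightarrow> scale I powr s \<le> C * m I"
    "\<And>I. set I \<subseteq> D \<Longrightarrow> m I \<le> C * scale I powr s"
    using additive_weights[OF s] by metis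
  obtain U where U: "open U" "U \<noteq> {}" "U \<subseteq> V" "\<And>i. i \<in> D \<Longrightarrow> \<phi> i ` U \<subseteq> U"
      "\<And>i j. i \<in> D \<Longrightarrow> j \<in> D \<Longrightarrow> i \<noteq> j \<Longrightarrow> \<phi> i ` U \<inter> \<phi> j ` U = {}"
    using osc unfolding open_set_condition_def by metis
  obtain p l where p: "p \<in> nbhd" and l: "0 < l"
    "\<And>I J. set I \<subseteq> D \<Longrightarrow> set J \<subseteq> D \<Longrightarrow> I \<parallel> J \<Longrightarrow> l * scale I \<le> dist (word_map \<phi> I p) (word_map \<phi> J p)"
    by (rule separated_markers[OF U]) (assumption | rule that)+
  obtain M where M: "1 \<le> M" "\<And>I x y. set I \<subseteq> D \<Longrightarrow> x \<in> X \<Longrightarrow> y \<in> nbhd \<Longrightarrow>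
      dist (word_map \<phi> I x) (word_map \<phi> I y) \<le> M * scale I"
    using dist_word_map_le_scale by metis
  have "cylinder_system D scale a b K s C m \<phi> X z p M l"
  proof unfold_locales
    show "X = (\<Union>i\<in>D. \<phi> i ` X)" by (rule X_eq)
    show "m I = (\<Sum>i\<in>D. m (I @ [i]))" if "set I \<subseteq> D" for I by (rule m(2)[OF that])
    show "dist (word_map \<phi> I x) (word_map \<phi> I y) \<le> M * scale I"
      if "set I \<subseteq> D" "x \<in> X" "y \<in> insert p X" for I x y
      using M(2)[OF that(1,2)] that(3) p X_subset_nbhd by auto
    show "l * scale I \<le> dist (word_map \<phi> I p) (word_map \<phi> J p)"
      if "set I \<subseteq> D" "set J \<subseteq> D" "I \<parallel> J" for I J by (rule l(2)[OF that])
  qed (use s(1) m l(1) M(1) compact_X z_in_X in auto)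
  then show ?thesis using that by blast
qed

text \<open>Every level has total mass \<open>m []\<close>, so the words of length \<open>n\<close> contribute at most a constant
  multiple of \<open>\<theta> n powr s\<close> to the divergent series.\<close>

lemma (in cylinder_system) partial_sums_unbounded:
  assumes \<theta>: "\<And>n. 0 \<le> \<theta> n"
    and div: "(\<Sum>n. \<Sum>I\<in>words D (Suc n).
      ennreal (rpow (diameter (word_map \<phi> I ` X) * \<theta> (Suc n)) s)) = \<infinity>"
  shows "\<exists>Q. c \<le> (\<Sum>n=1..Q. \<theta> n powr s)"
proof (rule ccontr)
  assume "\<not> ?thesis"
  then have c: "(\<Sum>n=1..Q. \<theta> n powr s) \<le> c" for Q by (meson linear)
  define A where "A = M powr s * C * m []"
  have A: "0 \<le> A" using C_ge_1 m_nonneg[of "[]"] by (simp add: A_def)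
  have level: "(\<Sum>I\<in>words D n. ennreal (rpow (diameter (word_map \<phi> I ` X) * \<theta> n) s))
      \<le> ennreal (A * \<theta> n powr s)" for n
  proof -
    have "rpow (diameter (word_map \<phi> I ` X) * \<theta> n) s \<le> M powr s * C * m I * \<theta> n powr s"
      if I: "I \<in> words D n" for I
    proof -
      have ID: "set I \<subseteq> D" using I by (simp add: words_def)
      have d: "0 \<le> diameter (word_map \<phi> I ` X)" by (rule diameter_ge_0[OF bounded_cylinder[OF ID]])
      have "rpow (diameter (word_map \<phi> I ` X) * \<theta> n) s \<le> (M * scale I * \<theta> n) powr s"
        using s_pos d \<theta> diameter_cylinder_le[OF ID]
        by (auto simp: rpow_def intro!: powr_mono2 mult_right_mono)
      also have "\<dots> = M powr s * scale I powr s * \<theta> n powr s"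
        using M_ge_1 scale_pos[OF ID] \<theta> by (simp add: powr_mult)
      also have "\<dots> \<le> M powr s * (C * m I) * \<theta> n powr s"
        using scale_le_m[OF ID] by (intro mult_right_mono mult_left_mono) auto
      finally show ?thesis by (simp add: mult.assoc)
    qed
    then have "(\<Sum>I\<in>words D n. ennreal (rpow (diameter (word_map \<phi> I ` X) * \<theta> n) s))
        \<le> (\<Sum>I\<in>words D n. ennreal (M powr s * C * m I * \<theta> n powr s))"
      by (intro sum_mono ennreal_leI)
    also have "\<dots> = ennreal (\<Sum>I\<in>words D n. M powr s * C * m I * \<theta> n powr s)"
      using C_ge_1 by (intro sum_ennreal mult_nonneg_nonneg m_nonneg) (auto simp: words_def)
    also have "(\<Sum>I\<in>words D n. M powr s * C * m I * \<theta> n powr s) = A * \<theta> n powr s"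
      using m_eq_sum_extensions[of "[]" n] by (simp add: A_def sum_distrib_left sum_distrib_right mult_ac)
    finally show ?thesis .
  qed
  have "(\<Sum>n. \<Sum>I\<in>words D (Suc n). ennreal (rpow (diameter (word_map \<phi> I ` X) * \<theta> (Suc n)) s))
      \<le> (\<Sum>n. ennreal (A * \<theta> (Suc n) powr s))"
    by (intro suminf_le level summableI)
  also have "\<dots> \<le> ennreal (A * c)"
  proof (rule suminf_le_const[OF summableI])
    fix N
    have "(\<Sum>n<N. ennreal (A * \<theta> (Suc n) powr s)) = ennreal (\<Sum>n<N. A * \<theta> (Suc n) powr s)"
      using A by (intro sum_ennreal) auto
    also have "(\<Sum>n<N. A * \<theta> (Suc n) powr s) = A * (\<Sum>n=1..N. \<theta> n powr s)"
      by (simp add: sum_distrib_left sum.atLeast1_atMost_eq)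
    also have "\<dots> \<le> A * c" using A c by (intro mult_left_mono) auto
    finally show "(\<Sum>n<N. ennreal (A * \<theta> (Suc n) powr s)) \<le> ennreal (A * c)" by (simp add: ennreal_leI)
  qed
  finally show False using div by (simp add: top_unique)
qed

theorem theorem1p6:
  fixes Y V X :: "'a::euclidean_space set"
    and D :: "'i set"
    and \<phi> :: "'i \<Rightarrow> 'a \<Rightarrow> 'a"
    and z :: 'a
    and \<theta> :: "nat \<Rightarrow> real"
  assumes "conformal_ifs Y V D \<phi>"
    and "open_set_condition V D \<phi>"
    and "attractor Y D \<phi> X"
    and "z \<in> X"
    and "\<And>n. 0 \<le> \<theta> n"
    and "(\<Sum>n. \<Sum>I\<in>words D (Suc n).
            ennreal (rpow (diameter (word_map \<phi> I ` X) * \<theta> (Suc n)) (hausdorff_dim X))) = \<infinity>"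
    and "(\<lambda>Q::nat. \<Sum>n=1..Q. if \<theta> n = 0 then 0
                               else rpow (\<theta> n) (hausdorff_dim X) * ln (1 / \<theta> n))
          \<in> O(\<lambda>Q. (\<Sum>n=1..Q. rpow (\<theta> n) (hausdorff_dim X))\<^sup>2)"
  shows "hausdorff_measure (hausdorff_dim X) (X - W_set D \<phi> X \<theta> z) = 0"
proof -
  note \<theta> = assms(5)
  obtain a b c \<alpha> \<epsilon> where "conformal_attractor D \<phi> X V a b c \<alpha> \<epsilon> z"
    using conformal_ifs_imp_conformal_attractor[OF assms(1,3,4)] by blast
  then interpret conformal_attractor D \<phi> X V a b c \<alpha> \<epsilon> z .
  have "D \<noteq> {}" using X_eq z_in_X by auto
  then have "card D \<noteq> 0" using finite_D by simp
  then consider "card D = 1" | "2 \<le> card D" by linarith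
  then show ?thesis
  proof cases
    case 1
    \<comment> \<open>Every word fixes the only point, which therefore is the centre of all balls.\<close>
    have X: "X = {z}" using 1 by (rule attractor_singleton_if_one_map)
    obtain i where i: "i \<in> D" using \<open>D \<noteq> {}\<close> by blast
    have "z \<in> W_set D \<phi> X \<theta> z"
    proof (rule in_W_setI[OF finite_D z_in_X])
      fix N
      have I: "replicate N i \<in> words D N" using i by (auto simp: words_def)
      then have "word_map \<phi> (replicate N i) z \<in> X"
        by (intro word_map_in_X z_in_X) (auto simp: words_def)
      then have "word_map \<phi> (replicate N i) z = z" using X by auto
      moreover have "0 \<le> diameter (word_map \<phi> (replicate N i) ` X) * \<theta> N"
        unfolding X using \<theta> by simp
      ultimately show "\<exists>n\<ge>N. \<exists>I\<in>words D n.
          z \<in> cball (word_map \<phi> I z) (diameter (word_map \<phi> I ` X) * \<theta> n)"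
        using I by (intro exI[of _ N] conjI bexI[of _ "replicate N i"]) auto
    qed
    then have "X - W_set D \<phi> X \<theta> z = {}" using X by blast
    then show ?thesis by (simp only: hausdorff_measure_empty)
  next
    case 2
    obtain K s C m p M l where "cylinder_system D scale a b K s C m \<phi> X z p M l"
      using cylinder_systemE[OF assms(2) 2] by blast
    then interpret cyl: cylinder_system D scale a b K s C m \<phi> X z p M l .
    have dim: "hausdorff_dim X = s" by (rule cyl.hausdorff_dim_X)
    have rpow: "rpow (\<theta> n) s = \<theta> n powr s" for n using cyl.s_pos by (simp add: rpow_def)
    show ?thesis
    proof (cases "\<forall>N. \<exists>n\<ge>N. 1 \<le> \<theta> n")
      case True
      \<comment> \<open>On infinitely many levels every ball contains its whole cylinder.\<close>
      have "x \<in> W_set D \<phi> X \<theta> z" if x: "x \<in> X" for x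
      proof (rule in_W_setI[OF finite_D x])
        fix N
        obtain n where n: "N \<le> n" "1 \<le> \<theta> n" using True by blast
        obtain I y where I: "I \<in> words D n" "y \<in> X" "x = word_map \<phi> I y"
          using cyl.in_cylinder[OF x] by metis
        have bd: "bounded (word_map \<phi> I ` X)" using I(1) by (intro cyl.bounded_cylinder) (simp add: words_def)
        have "dist (word_map \<phi> I z) x \<le> diameter (word_map \<phi> I ` X)"
          using I z_in_X by (intro diameter_bounded_bound[OF bd]) auto
        also have "\<dots> \<le> diameter (word_map \<phi> I ` X) * \<theta> n"
          using mult_left_mono[OF n(2) diameter_ge_0[OF bd]] by simp
        finally show "\<exists>n\<ge>N. \<exists>I\<in>words D n. x \<in> cball (word_map \<phi> I z) (diameter (word_map \<phi> I ` X) * \<theta> n)"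
          using n(1) I(1) by auto
      qed
      then have "X - W_set D \<phi> X \<theta> z = {}" by auto
      then show ?thesis by (simp only: hausdorff_measure_empty)
    next
      case False
      then obtain N0 where N0: "\<And>n. N0 \<le> n \<Longrightarrow> \<theta> n < 1" by (meson not_le)
      \<comment> \<open>A second point of \<open>X\<close> bounds the diameters of the cylinders from below.\<close>
      have "X \<noteq> {z}"
        using cyl.hausdorff_measure_X_pos hausdorff_measure_singleton[of s z] cyl.s_pos by auto
      then obtain y where y: "y \<in> X" "y \<noteq> z" using z_in_X by blast
      obtain l0 where l0: "0 < l0"
          "\<And>I. set I \<subseteq> D \<Longrightarrow> l0 * scale I \<le> dist (word_map \<phi> I y) (word_map \<phi> I z)"
        using scale_le_dist_word_map[OF y(1) z_in_X y(2)] by metis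
      have diam: "l0 * scale I \<le> diameter (word_map \<phi> I ` X)" if "set I \<subseteq> D" for I
        using l0(2)[OF that] diameter_bounded_bound[OF cyl.bounded_cylinder[OF that], of "word_map \<phi> I y" "word_map \<phi> I z"]
          y(1) z_in_X by auto
      have div: "\<exists>Q. c \<le> (\<Sum>n=1..Q. \<theta> n powr s)" for c
        by (rule cyl.partial_sums_unbounded[OF \<theta>]) (use assms(6) dim in simp)
      obtain c0 where c0: "0 < c0" "\<forall>\<^sub>F Q in sequentially.
          norm (\<Sum>n=1..Q. if \<theta> n = 0 then 0 else \<theta> n powr s * ln (1 / \<theta> n))
            \<le> c0 * norm ((\<Sum>n=1..Q. \<theta> n powr s)\<^sup>2)"
        using landau_o.bigE[OF assms(7)] unfolding dim rpow by blast
      obtain Q0 where Q0: "\<And>Q. Q0 \<le> Q \<Longrightarrow>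
          norm (\<Sum>n=1..Q. if \<theta> n = 0 then 0 else \<theta> n powr s * ln (1 / \<theta> n))
            \<le> c0 * norm ((\<Sum>n=1..Q. \<theta> n powr s)\<^sup>2)"
        using c0(2) unfolding eventually_sequentially by blast
      have growth: "(\<Sum>n=1..Q. if \<theta> n = 0 then 0 else \<theta> n powr s * ln (1 / \<theta> n))
          \<le> c0 * (\<Sum>n=1..Q. \<theta> n powr s)\<^sup>2" if "Q0 \<le> Q" for Q
        using Q0[OF that] by simp
      show ?thesis
        unfolding dim
        by (rule cyl.hausdorff_measure_not_in_W_set[OF \<theta> N0 l0(1) diam div growth]) (use c0 in auto)
    qed
  qed
qed

end
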